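(* For every $m\ge 1$ there are homeomorphisms \[ \mathrm{Rep}(\mathbb{Z}^{2},Sp(m))\cong \mathbb{C}P^{m},\qquad \mathrm{Rep}(\mathbb{Z}^{2},SU(m))\cong\mathbb{C}P^{m-1}. \]
   Context: For a Lie group $G$, $\mathrm{Hom}(\mathbb{Z}^{2},G)\subset G^2$ is the space of commuting pairs and $\mathrm{Rep}(\mathbb{Z}^{2},G)=\mathrm{Hom}(\mathbb{Z}^{2},G)/G$ its orbit space under simultaneous conjugation. *)

theory Defs
  imports "HOL-Analysis.Analysis" "HOL-Algebra.Group"
begin

section \<open>Quotient topologies\<close>

definition quotient_topology :: "'a topology \<Rightarrow> ('a \<times> 'a) set \<Rightarrow> 'a set topology" where
  "quotient_topology X r = topology (\<lambda>U. U \<subseteq> topspace X // r \<and>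
     openin X {x \<in> topspace X. r `` {x} \<in> U})"

lemma openin_quotient_topology:
  "openin (quotient_topology X r) U \<longleftrightarrow>
     U \<subseteq> topspace X // r \<and> openin X {x \<in> topspace X. r `` {x} \<in> U}"
proof -
  let ?L = "\<lambda>U. U \<subseteq> topspace X // r \<and> openin X {x \<in> topspace X. r `` {x} \<in> U}"
  have "istopology ?L"
    unfolding istopology_def
  proof (intro conjI allI impI)
    fix S T assume S: "?L S" and T: "?L T"
    then show "S \<inter> T \<subseteq> topspace X // r" by blast
    have "{x \<in> topspace X. r `` {x} \<in> S \<inter> T} =
        {x \<in> topspace X. r `` {x} \<in> S} \<inter> {x \<in> topspace X. r `` {x} \<in> T}" by blast
    then show "openin X {x \<in> topspace X. r `` {x} \<in> S \<inter> T}"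
      using S T by auto
  next
    fix K assume K: "\<forall>S\<in>K. ?L S"
    then show "\<Union>K \<subseteq> topspace X // r" by blast
    have "{x \<in> topspace X. r `` {x} \<in> \<Union>K} = (\<Union>S\<in>K. {x \<in> topspace X. r `` {x} \<in> S})"
      by blast
    then show "openin X {x \<in> topspace X. r `` {x} \<in> \<Union>K}"
      using K by auto
  qed
  then show ?thesis
    by (simp add: quotient_topology_def)
qed

lemma topspace_quotient_topology: "topspace (quotient_topology X r) = topspace X // r"
proof
  show "topspace (quotient_topology X r) \<subseteq> topspace X // r"
    using openin_quotient_topology[of X r] by (metis openin_topspace)
  have "{x \<in> topspace X. r `` {x} \<in> topspace X // r} = topspace X"
    by (auto simp: quotient_def)
  then have "openin (quotient_topology X r) (topspace X // r)"
    by (simp add: openin_quotient_topology)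
  then show "topspace X // r \<subseteq> topspace (quotient_topology X r)"
    by (rule openin_subset)
qed

lemma quotient_map_quotient_topology:
  "quotient_map X (quotient_topology X r) (\<lambda>x. r `` {x})"
  unfolding quotient_map_def
  by (auto simp: topspace_quotient_topology openin_quotient_topology quotient_def)


section \<open>Commuting pairs modulo conjugation\<close>

definition Hom_Z2 :: "('a, 'b) monoid_scheme \<Rightarrow> ('a \<times> 'a) set" where
  "Hom_Z2 G = {(x, y). x \<in> carrier G \<and> y \<in> carrier G \<and> x \<otimes>\<^bsub>G\<^esub> y = y \<otimes>\<^bsub>G\<^esub> x}"

definition conj_rel :: "('a, 'b) monoid_scheme \<Rightarrow> (('a \<times> 'a) \<times> ('a \<times> 'a)) set" where
  "conj_rel G = {((x, y), (x', y')). (x, y) \<in> Hom_Z2 G \<and>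
     (\<exists>g \<in> carrier G. x' = g \<otimes>\<^bsub>G\<^esub> x \<otimes>\<^bsub>G\<^esub> inv\<^bsub>G\<^esub> g \<and> y' = g \<otimes>\<^bsub>G\<^esub> y \<otimes>\<^bsub>G\<^esub> inv\<^bsub>G\<^esub> g)}"

(* The topology of G is the one induced from the ambient type of its elements. *)
definition Rep_Z2 :: "('a::topological_space, 'b) monoid_scheme \<Rightarrow> ('a \<times> 'a) set topology" where
  "Rep_Z2 G = quotient_topology (top_of_set (Hom_Z2 G)) (conj_rel G)"

lemma (in group) conj_Hom_Z2:
  assumes "(x, y) \<in> Hom_Z2 G" "g \<in> carrier G"
  shows "(g \<otimes> x \<otimes> inv g, g \<otimes> y \<otimes> inv g) \<in> Hom_Z2 G"
proof -
  have c: "x \<in> carrier G" "y \<in> carrier G" "x \<otimes> y = y \<otimes> x"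
    using assms by (auto simp: Hom_Z2_def)
  have *: "(g \<otimes> a \<otimes> inv g) \<otimes> (g \<otimes> b \<otimes> inv g) = g \<otimes> (a \<otimes> b) \<otimes> inv g"
    if "a \<in> carrier G" "b \<in> carrier G" for a b
    using that assms(2) by (simp add: m_assoc inv_solve_left')
  show ?thesis
    using c assms(2) by (auto simp: Hom_Z2_def *)
qed

lemma (in group) equiv_conj_rel: "equiv (Hom_Z2 G) (conj_rel G)"
proof (rule equivI)
  show "conj_rel G \<subseteq> Hom_Z2 G \<times> Hom_Z2 G"
    using conj_Hom_Z2 by (auto simp: conj_rel_def)
  show "refl_on (Hom_Z2 G) (conj_rel G)"
    by (auto simp: refl_on_def conj_rel_def Hom_Z2_def intro!: bexI[of _ \<one>])
  show "sym (conj_rel G)"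
  proof (rule symI)
    fix p q assume "(p, q) \<in> conj_rel G"
    then obtain x y g where *: "p = (x, y)" "(x, y) \<in> Hom_Z2 G" "g \<in> carrier G"
        "q = (g \<otimes> x \<otimes> inv g, g \<otimes> y \<otimes> inv g)"
      by (auto simp: conj_rel_def)
    have "a = inv g \<otimes> (g \<otimes> a \<otimes> inv g) \<otimes> inv (inv g)" if "a \<in> carrier G" for a
      using that *(3) by (simp add: m_assoc inv_solve_left)
    then show "(q, p) \<in> conj_rel G"
      using * conj_Hom_Z2[OF *(2,3)]
      by (auto simp: conj_rel_def Hom_Z2_def intro!: bexI[of _ "inv g"])
  qed
  show "trans (conj_rel G)"
  proof (rule transI)
    fix p q s assume "(p, q) \<in> conj_rel G" "(q, s) \<in> conj_rel G"
    then obtain x y g h where *: "p = (x, y)" "(x, y) \<in> Hom_Z2 G"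
        "g \<in> carrier G" "h \<in> carrier G"
        "s = (h \<otimes> (g \<otimes> x \<otimes> inv g) \<otimes> inv h, h \<otimes> (g \<otimes> y \<otimes> inv g) \<otimes> inv h)"
      by (auto simp: conj_rel_def)
    have "h \<otimes> (g \<otimes> a \<otimes> inv g) \<otimes> inv h = (h \<otimes> g) \<otimes> a \<otimes> inv (h \<otimes> g)" if "a \<in> carrier G" for a
      using that *(3,4) by (simp add: m_assoc inv_mult_group)
    then show "(p, s) \<in> conj_rel G"
      using * by (auto simp: conj_rel_def Hom_Z2_def intro!: bexI[of _ "h \<otimes> g"])
  qed
qed


section \<open>The special unitary and compact symplectic groups\<close>

definition adjoint_mat :: "complex^'n^'m \<Rightarrow> complex^'m^'n" where
  "adjoint_mat A = map_matrix cnj (transpose A)"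

definition unitary_matrices :: "(complex^'n^'n) set" where
  "unitary_matrices = {A. adjoint_mat A ** A = mat 1}"

definition matrix_group :: "(complex^'n^'n) set \<Rightarrow> (complex^'n^'n) monoid" where
  "matrix_group S = \<lparr>carrier = S, mult = (**), one = mat 1\<rparr>"

definition SU :: "(complex^'n^'n) monoid" where
  "SU = matrix_group {A \<in> unitary_matrices. det A = 1}"

(* The matrix with blocks 0, 1, -1, 0 (row by row) of the standard symplectic form. *)
definition symplectic_J :: "complex^('m::finite + 'm)^('m + 'm)" where
  "symplectic_J = (\<chi> i j. case (i, j) of
      (Inl a, Inr b) \<Rightarrow> if a = b then 1 else 0
    | (Inr a, Inl b) \<Rightarrow> if a = b then -1 else 0
    | _ \<Rightarrow> 0)"

(* The compact group Sp(m), m = CARD('m), realised as the intersection of U(2m) with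
   Sp(2m, C). Writing H^m = C^m + C^m j identifies it with the group of quaternionic
   unitary m x m matrices. *)
definition Sp :: "(complex^('m::finite + 'm)^('m + 'm)) monoid" where
  "Sp = matrix_group
     {A \<in> unitary_matrices. transpose A ** symplectic_J ** A = symplectic_J}"

lemma adjoint_mat_mult:
  fixes A :: "complex^'n^'m" and B :: "complex^'k^'n"
  shows "adjoint_mat (A ** B) = adjoint_mat B ** adjoint_mat A"
  by (simp add: adjoint_mat_def vec_eq_iff transpose_def matrix_matrix_mult_def mult.commute)

lemma adjoint_mat_adjoint_mat [simp]: "adjoint_mat (adjoint_mat A) = A"
  by (simp add: adjoint_mat_def vec_eq_iff transpose_def)

lemma adjoint_mat_1 [simp]: "adjoint_mat (mat 1) = mat 1"
  by (auto simp: adjoint_mat_def vec_eq_iff transpose_def mat_def)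

lemma group_matrix_group:
  assumes "mat 1 \<in> S" "\<And>A B. A \<in> S \<Longrightarrow> B \<in> S \<Longrightarrow> A ** B \<in> S"
    and "\<And>A. A \<in> S \<Longrightarrow> adjoint_mat A \<in> S" "S \<subseteq> unitary_matrices"
  shows "group (matrix_group S)"
proof (rule groupI)
  fix A assume A: "A \<in> carrier (matrix_group S)"
  show "\<exists>B \<in> carrier (matrix_group S). B \<otimes>\<^bsub>matrix_group S\<^esub> A = \<one>\<^bsub>matrix_group S\<^esub>"
    using A assms(3,4)
    by (intro bexI[of _ "adjoint_mat A"]) (auto simp: matrix_group_def unitary_matrices_def)
qed (use assms in \<open>auto simp: matrix_group_def matrix_mul_assoc\<close>)

lemma unitary_matrices_mult:
  assumes "A \<in> unitary_matrices" "B \<in> unitary_matrices"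
  shows "A ** B \<in> unitary_matrices"
proof -
  have "adjoint_mat (A ** B) ** (A ** B) = adjoint_mat B ** (adjoint_mat A ** A) ** B"
    by (simp add: adjoint_mat_mult matrix_mul_assoc)
  then show ?thesis
    using assms by (simp add: unitary_matrices_def)
qed

lemma unitary_matrices_adjoint:
  assumes "A \<in> unitary_matrices"
  shows "adjoint_mat A \<in> unitary_matrices" "A ** adjoint_mat A = mat 1"
  using assms by (auto simp: unitary_matrices_def matrix_left_right_inverse)

lemma group_SU: "group (SU :: (complex^'n^'n) monoid)"
  unfolding SU_def
proof (rule group_matrix_group)
  fix A :: "complex^'n^'n" assume A: "A \<in> {A \<in> unitary_matrices. det A = 1}"
  then have "det (adjoint_mat A) * det A = 1"
    by (metis (mono_tags, lifting) det_I det_mul mem_Collect_eq unitary_matrices_def)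
  then show "adjoint_mat A \<in> {A \<in> unitary_matrices. det A = 1}"
    using A by (simp add: unitary_matrices_adjoint)
qed (auto simp: unitary_matrices_mult det_mul, simp add: unitary_matrices_def)

lemma group_Sp: "group (Sp :: (complex^('m::finite + 'm)^('m + 'm)) monoid)"
  unfolding Sp_def
proof (rule group_matrix_group)
  let ?J = "symplectic_J :: complex^('m::finite + 'm)^('m + 'm)"
  fix A :: "complex^('m::finite + 'm)^('m + 'm)"
  assume A: "A \<in> {A \<in> unitary_matrices. transpose A ** ?J ** A = ?J}"
  then have AA: "A ** adjoint_mat A = mat 1" by (simp add: unitary_matrices_adjoint)
  have "transpose (adjoint_mat A) ** transpose A = mat 1"
    by (metis AA matrix_transpose_mul transpose_mat)
  then have "?J = transpose (adjoint_mat A) ** transpose A ** ?J ** (A ** adjoint_mat A)"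
    using AA by simp
  also have "\<dots> = transpose (adjoint_mat A) ** (transpose A ** ?J ** A) ** adjoint_mat A"
    by (simp add: matrix_mul_assoc)
  finally have "transpose (adjoint_mat A) ** ?J ** adjoint_mat A = ?J"
    using A by simp
  then show "adjoint_mat A \<in> {A \<in> unitary_matrices. transpose A ** ?J ** A = ?J}"
    using A by (simp add: unitary_matrices_adjoint)
next
  let ?J = "symplectic_J :: complex^('m::finite + 'm)^('m + 'm)"
  fix A B :: "complex^('m::finite + 'm)^('m + 'm)"
  assume A: "A \<in> {A \<in> unitary_matrices. transpose A ** ?J ** A = ?J}"
    and B: "B \<in> {A \<in> unitary_matrices. transpose A ** ?J ** A = ?J}"
  have "transpose (A ** B) ** ?J ** (A ** B) = transpose B ** (transpose A ** ?J ** A) ** B"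
    by (simp add: matrix_transpose_mul matrix_mul_assoc)
  then show "A ** B \<in> {A \<in> unitary_matrices. transpose A ** ?J ** A = ?J}"
    using A B by (simp add: unitary_matrices_mult)
qed (auto simp: unitary_matrices_def transpose_mat)


section \<open>Complex projective space\<close>

definition proj_rel :: "((complex^'n) \<times> (complex^'n)) set" where
  "proj_rel = {(v, w). v \<noteq> 0 \<and> (\<exists>c. c \<noteq> 0 \<and> w = c *s v)}"

(* The space of lines in complex^'n: 'n indexes the homogeneous coordinates, so this is
   CP^(CARD('n) - 1). *)
definition complex_proj_space :: "(complex^'n) set topology" where
  "complex_proj_space = quotient_topology (top_of_set (- {0})) proj_rel"

lemma equiv_proj_rel: "equiv (- {0}) (proj_rel :: ((complex^'n) \<times> (complex^'n)) set)"
proof (rule equivI)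
  show "proj_rel \<subseteq> (- {0}) \<times> (- {0 :: complex^'n})"
    by (auto simp: proj_rel_def)
  show "refl_on (- {0}) (proj_rel :: ((complex^'n) \<times> (complex^'n)) set)"
    by (auto simp: refl_on_def proj_rel_def intro!: exI[of _ 1])
  show "sym (proj_rel :: ((complex^'n) \<times> (complex^'n)) set)"
  proof (rule symI)
    fix v w :: "complex^'n" assume "(v, w) \<in> proj_rel"
    then obtain c where "v \<noteq> 0" "c \<noteq> 0" "w = c *s v" by (auto simp: proj_rel_def)
    then show "(w, v) \<in> proj_rel"
      by (auto simp: proj_rel_def vector_smult_assoc intro!: exI[of _ "inverse c"])
  qed
  show "trans (proj_rel :: ((complex^'n) \<times> (complex^'n)) set)"
  proof (rule transI)
    fix u v w :: "complex^'n" assume "(u, v) \<in> proj_rel" "(v, w) \<in> proj_rel"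
    then obtain c d where "u \<noteq> 0" "c \<noteq> 0" "d \<noteq> 0" "w = (d * c) *s u"
      by (auto simp: proj_rel_def vector_smult_assoc)
    then show "(u, w) \<in> proj_rel"
      by (auto simp: proj_rel_def intro!: exI[of _ "d * c"])
  qed
qed

end

(* Commuting pairs of matrices in SU(m) or Sp(m) are simultaneously diagonalised inside the group, so a
   class in Rep is a configuration of points on the torus of pairs of unit complex numbers: m points
   with product 1, up to permutation, for SU(m), and m points up to permutation and inversion for Sp(m).
   Identify the torus with the elliptic curve E, the quotient of the nonzero complex numbers by the
   powers of q = exp (-2 pi). A configuration {a_i} with product 1 is the divisor of the theta
   product f(w) = prod theta (w / a_i). These products are, up to scalars, exactly the nonzero functions
   with f(q w) = (-1)^m w^(-m) f(w), a space of dimension m, whence CP^(m-1). For Sp(m) the products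
   prod theta (w / a_i) theta (w a_i) are the nonzero even functions of degree 2m, a space of dimension
   m + 1, whence CP^m. Values at suitably chosen sample points serve as linear coordinates on these
   spaces, and Lagrange interpolation shows that all values occur. Finally Rep and CP are both compact
   Hausdorff quotients, with the same fibres, of one compact parameter space of logarithms. *)
theory Submission
  imports Defs "HOL-Complex_Analysis.Complex_Analysis"
    "HOL-Computational_Algebra.Fundamental_Theorem_Algebra"
begin

no_notation fps_nth (infixl "$" 75)

section \<open>Comparing quotients of a compact space\<close>

text \<open>No inverse map is built by hand: a continuous surjection from a compact space onto a
  Hausdorff space is a quotient map, so two such maps with the same fibres suffice. What remains
  topologically is that both targets are Hausdorff; for Rep this comes from conjugation invariants,
  the values of det (x + y A + z B), which separate classes. The identification of the torus with E
  is only topological; its complex structure (modulus i) is an auxiliary choice. Three obstacles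
  shape the rest. A point of E lifts to a nonzero complex number only up to powers of q, and a
  change of lift multiplies a theta product by a monomial in w; hence the SU logarithms sum to
  exactly 0 and not just to an integer. For Sp the lifts of a and 1 / a give cancelling monomials,
  so no sums need balancing, but at the fixed points of w -> 1 / w on E an even function must be
  shown to vanish at least doubly. And zeros are found without contour integrals: without zeros, w
  f' / f would be additively quasiperiodic, which the period of exp excludes.\<close>

text \<open>Both \<open>f\<close> and \<open>g\<close> are quotient maps, so each descends along the
  other; the two descended maps are mutually inverse.\<close>

lemma homeomorphic_space_if_same_fibres:
  assumes K: "compact_space K" and f: "continuous_map K X f" and g: "continuous_map K Y g"
    and X: "Hausdorff_space X" and Y: "Hausdorff_space Y"
    and fs: "f ` topspace K = topspace X" and gs: "g ` topspace K = topspace Y"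
    and fg: "\<And>p p'. p \<in> topspace K \<Longrightarrow> p' \<in> topspace K \<Longrightarrow> f p = f p' \<longleftrightarrow> g p = g p'"
  shows "X homeomorphic_space Y"
proof -
  have qf: "quotient_map K X f" and qg: "quotient_map K Y g"
    using assms by (simp_all add: continuous_imp_quotient_map)
  obtain h where h: "continuous_map X Y h" "\<And>x. x \<in> topspace K \<Longrightarrow> h (f x) = g x"
    using quotient_map_lift_exists[OF qf g] fg by metis
  obtain k where k: "continuous_map Y X k" "\<And>x. x \<in> topspace K \<Longrightarrow> k (g x) = f x"
    using quotient_map_lift_exists[OF qg f] fg by metis
  have "homeomorphic_maps X Y h k"
    unfolding homeomorphic_maps_def using h k fs gs by force
  then show ?thesis
    unfolding homeomorphic_space_def by blast
qed

lemma Hausdorff_space_if_separated: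
  assumes "\<And>x y. x \<in> topspace X \<Longrightarrow> y \<in> topspace X \<Longrightarrow> x \<noteq> y \<Longrightarrow>
             \<exists>h :: 'a \<Rightarrow> 'b::metric_space. continuous_map X euclidean h \<and> h x \<noteq> h y"
  shows "Hausdorff_space X"
  unfolding Hausdorff_space_def
proof (intro allI impI, elim conjE)
  fix x y assume xy: "x \<in> topspace X" "y \<in> topspace X" "x \<noteq> y"
  then obtain h :: "'a \<Rightarrow> 'b" where h: "continuous_map X euclidean h" "h x \<noteq> h y"
    using assms by blast
  then obtain U V where "open U" "open V" "h x \<in> U" "h y \<in> V" "U \<inter> V = {}"
    by (meson hausdorff)
  then show "\<exists>U V. openin X U \<and> openin X V \<and> x \<in> U \<and> y \<in> V \<and> disjnt U V"
    using xy h openin_continuous_map_preimage[OF h(1)]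
    by (intro exI[of _ "{x \<in> topspace X. h x \<in> U}"] exI[of _ "{x \<in> topspace X. h x \<in> V}"])
       (auto simp: disjnt_def)
qed

lemma Hausdorff_space_quotient_topology_if_separated:
  fixes h :: "'l \<Rightarrow> 'a \<Rightarrow> 'b::metric_space"
  assumes cont: "\<And>l. continuous_map X euclidean (h l)"
    and inv: "\<And>l x y. x \<in> topspace X \<Longrightarrow> y \<in> topspace X \<Longrightarrow> r `` {x} = r `` {y} \<Longrightarrow> h l x = h l y"
    and sep: "\<And>x y. x \<in> topspace X \<Longrightarrow> y \<in> topspace X \<Longrightarrow> (\<And>l. h l x = h l y) \<Longrightarrow> r `` {x} = r `` {y}"
  shows "Hausdorff_space (quotient_topology X r)"
proof (rule Hausdorff_space_if_separated[where 'b = 'b])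
  fix c d assume "c \<in> topspace (quotient_topology X r)" "d \<in> topspace (quotient_topology X r)" "c \<noteq> d"
  then obtain x y where xy: "x \<in> topspace X" "y \<in> topspace X" "c = r `` {x}" "d = r `` {y}" "c \<noteq> d"
    by (auto simp: topspace_quotient_topology quotient_def)
  then obtain l where l: "h l x \<noteq> h l y"
    using sep by blast
  obtain h' where "continuous_map (quotient_topology X r) euclidean h'"
    "\<And>x. x \<in> topspace X \<Longrightarrow> h' (r `` {x}) = h l x"
    using quotient_map_lift_exists[OF quotient_map_quotient_topology cont] inv by metis
  then show "\<exists>h :: 'a set \<Rightarrow> 'b. continuous_map (quotient_topology X r) euclidean h \<and> h c \<noteq> h d"
    using l xy by (intro exI[of _ h']) auto
qed

lemma proj_rel_class_eq_iff:
  "v \<noteq> 0 \<Longrightarrow> w \<noteq> 0 \<Longrightarrow> proj_rel `` {v} = proj_rel `` {w} \<longleftrightarrow> (v, w) \<in> proj_rel"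
  by (rule eq_equiv_class_iff[OF equiv_proj_rel]) auto

text \<open>The functions separating points are the entries of the orthogonal projection onto a line.\<close>

lemma Hausdorff_space_complex_proj_space:
  "Hausdorff_space (complex_proj_space :: (complex^'n) set topology)"
  unfolding complex_proj_space_def
proof -
  define h :: "'n \<times> 'n \<Rightarrow> complex^'n \<Rightarrow> complex"
    where "h l v = v $ fst l * cnj (v $ snd l) / of_real ((norm v)\<^sup>2)" for l v
  have cont: "continuous_on (- {0}) (h l)" for l
    unfolding h_def by (intro continuous_intros) auto
  show "Hausdorff_space (quotient_topology (top_of_set (- {0})) (proj_rel :: ((complex^'n) \<times> (complex^'n)) set))"
  proof (rule Hausdorff_space_quotient_topology_if_separated[of _ h])
    show "continuous_map (top_of_set (- {0})) euclidean (h l)" for l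
      using cont by simp
  next
    fix l :: "'n \<times> 'n" and v w :: "complex^'n"
    assume v: "v \<in> topspace (top_of_set (- {0}))" and w: "w \<in> topspace (top_of_set (- {0}))"
      and eq: "proj_rel `` {v} = proj_rel `` {w}"
    then have "(v, w) \<in> proj_rel"
      using proj_rel_class_eq_iff[of v w] by simp
    then obtain c where c: "c \<noteq> 0" "w = c *s v"
      by (auto simp: proj_rel_def)
    have "(norm (c *s v))\<^sup>2 = (cmod c)\<^sup>2 * (norm v)\<^sup>2"
      by (simp add: norm_vec_def L2_set_def norm_mult power_mult_distrib sum_distrib_left sum_nonneg)
    then have n: "complex_of_real ((norm w)\<^sup>2) = c * cnj c * of_real ((norm v)\<^sup>2)"
      using c(2) by (simp add: complex_norm_square del: of_real_power)
    show "h l v = h l w"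
      unfolding h_def n using c by (simp add: field_simps)
  next
    fix x y :: "complex^'n"
    assume "x \<in> topspace (top_of_set (- {0}))" "y \<in> topspace (top_of_set (- {0}))"
      and eq: "\<And>l. h l x = h l y"
    then have x: "x \<noteq> 0" and y: "y \<noteq> 0" by simp_all
    obtain j where j: "x $ j \<noteq> 0" using x by (auto simp: vec_eq_iff)
    \<comment> \<open>Column \<open>j\<close> of the projection onto the line of \<open>x\<close> is
      a nonzero multiple of \<open>x\<close>, and likewise for \<open>y\<close>; equating these
      columns makes the two vectors proportional.\<close>
    define c where "c = (of_real ((norm y)\<^sup>2) * cnj (x $ j)) / of_real ((norm x)\<^sup>2)"
    have e: "x $ i * c = y $ i * cnj (y $ j)" for i
      using eq[of "(i, j)"] x y unfolding h_def c_def by (simp add: field_simps)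
    have "c \<noteq> 0" using j x y by (auto simp: c_def)
    then have "y $ j \<noteq> 0" using e[of j] j by auto
    have "y = (c / cnj (y $ j)) *s x"
      using e \<open>y $ j \<noteq> 0\<close> by (simp add: vec_eq_iff field_simps)
    then have "(x, y) \<in> proj_rel"
      using x \<open>c \<noteq> 0\<close> \<open>y $ j \<noteq> 0\<close> unfolding proj_rel_def
      by (auto intro!: exI[of _ "c / cnj (y $ j)"])
    then show "proj_rel `` {x} = proj_rel `` {y}" using x y by (simp add: proj_rel_class_eq_iff)
  qed
qed

text \<open>The common frame for both groups. The three implications "equal invariants, hence
  proportional \<open>F\<close>, hence related \<open>\<delta>\<close>, hence equal invariants" form
  a circle: it identifies the fibres of the two maps on \<open>K\<close>, and it also shows that the
  invariants separate classes, so that the orbit space is Hausdorff.\<close>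

lemma quotient_homeomorphic_complex_proj_space:
  fixes K :: "'p::topological_space set" and H :: "'a::topological_space set"
    and F :: "'p \<Rightarrow> complex^'n" and inv_fun :: "'l \<Rightarrow> 'a \<Rightarrow> complex"
  assumes K: "compact K" and r: "equiv H r"
    and \<delta>: "continuous_on K \<delta>" "\<delta> ` K \<subseteq> H" "\<And>x. x \<in> H \<Longrightarrow> \<exists>p\<in>K. (\<delta> p, x) \<in> r"
    and inv_cont: "\<And>l. continuous_on H (inv_fun l)"
    and inv_eq: "\<And>l x y. (x, y) \<in> r \<Longrightarrow> inv_fun l x = inv_fun l y"
    and F: "continuous_on K F" "\<And>p. p \<in> K \<Longrightarrow> F p \<noteq> 0" "\<And>v. v \<noteq> 0 \<Longrightarrow> \<exists>p\<in>K. (F p, v) \<in> proj_rel"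
    and inv_imp_F: "\<And>p p'. p \<in> K \<Longrightarrow> p' \<in> K \<Longrightarrow> (\<And>l. inv_fun l (\<delta> p) = inv_fun l (\<delta> p')) \<Longrightarrow>
           (F p, F p') \<in> proj_rel"
    and F_imp_r: "\<And>p p'. p \<in> K \<Longrightarrow> p' \<in> K \<Longrightarrow> (F p, F p') \<in> proj_rel \<Longrightarrow> (\<delta> p, \<delta> p') \<in> r"
  shows "quotient_topology (top_of_set H) r homeomorphic_space (complex_proj_space :: (complex^'n) set topology)"
proof -
  have class_eq: "r `` {x} = r `` {y} \<longleftrightarrow> (x, y) \<in> r" if "x \<in> H" "y \<in> H" for x y
    using r that by (auto simp: eq_equiv_class_iff)
  have \<delta>H: "\<delta> p \<in> H" if "p \<in> K" for p using that \<delta>(2) by auto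
  have sym: "(y, x) \<in> r" if "(x, y) \<in> r" for x y
    using r that by (meson equivE symE)
  have tr: "(x, z) \<in> r" if "(x, y) \<in> r" "(y, z) \<in> r" for x y z
    using r that by (meson equivE transE)
  show ?thesis
  proof (rule homeomorphic_space_if_same_fibres)
    show "compact_space (top_of_set K)" using K by (simp add: compact_space_subtopology compactin_euclidean_iff)
    show "Hausdorff_space (complex_proj_space :: (complex^'n) set topology)"
      by (rule Hausdorff_space_complex_proj_space)
    show "continuous_map (top_of_set K) (quotient_topology (top_of_set H) r) ((\<lambda>x. r `` {x}) \<circ> \<delta>)"
      using \<delta> by (intro continuous_map_compose[where X' = "top_of_set H",
            OF _ quotient_imp_continuous_map[OF quotient_map_quotient_topology]]) auto
    show "continuous_map (top_of_set K) complex_proj_space ((\<lambda>x. proj_rel `` {x}) \<circ> F)"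
      unfolding complex_proj_space_def
      using F(1,2) by (intro continuous_map_compose[where X' = "top_of_set (- {0})",
            OF _ quotient_imp_continuous_map[OF quotient_map_quotient_topology]]) auto
    show "((\<lambda>x. r `` {x}) \<circ> \<delta>) ` topspace (top_of_set K) = topspace (quotient_topology (top_of_set H) r)"
    proof
      show "topspace (quotient_topology (top_of_set H) r) \<subseteq> ((\<lambda>x. r `` {x}) \<circ> \<delta>) ` topspace (top_of_set K)"
      proof
        fix c assume "c \<in> topspace (quotient_topology (top_of_set H) r)"
        then obtain x where x: "x \<in> H" "c = r `` {x}"
          by (auto simp: topspace_quotient_topology quotient_def)
        with \<delta>(3) obtain p where "p \<in> K" "(\<delta> p, x) \<in> r" by blast
        then show "c \<in> ((\<lambda>x. r `` {x}) \<circ> \<delta>) ` topspace (top_of_set K)"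
          using x class_eq[of "\<delta> p" x] \<delta>H[of p] by (intro image_eqI[of _ _ p]) auto
      qed
    qed (use \<delta>(2) in \<open>auto simp: topspace_quotient_topology quotient_def\<close>)
    show "((\<lambda>x. proj_rel `` {x}) \<circ> F) ` topspace (top_of_set K) = topspace (complex_proj_space :: (complex^'n) set topology)"
    proof
      show "topspace (complex_proj_space :: (complex^'n) set topology) \<subseteq> ((\<lambda>x. proj_rel `` {x}) \<circ> F) ` topspace (top_of_set K)"
      proof
        fix c assume "c \<in> topspace (complex_proj_space :: (complex^'n) set topology)"
        then obtain x where x: "x \<noteq> 0" "c = proj_rel `` {x}"
          by (auto simp: complex_proj_space_def topspace_quotient_topology quotient_def)
        with F(3) obtain p where "p \<in> K" "(F p, x) \<in> proj_rel" by blast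
        then show "c \<in> ((\<lambda>x. proj_rel `` {x}) \<circ> F) ` topspace (top_of_set K)"
          using x proj_rel_class_eq_iff[of "F p" x] F(2)[of p] by (intro image_eqI[of _ _ p]) auto
      qed
    qed (use F(2) in \<open>auto simp: complex_proj_space_def topspace_quotient_topology quotient_def\<close>)
    show "Hausdorff_space (quotient_topology (top_of_set H) r)"
    proof (rule Hausdorff_space_quotient_topology_if_separated[of _ inv_fun])
      show "continuous_map (top_of_set H) euclidean (inv_fun l)" for l
        using inv_cont by simp
    next
      fix l x y assume "x \<in> topspace (top_of_set H)" "y \<in> topspace (top_of_set H)" "r `` {x} = r `` {y}"
      then show "inv_fun l x = inv_fun l y"
        using inv_eq[of x y l] class_eq[of x y] by simp
    next
      fix x y assume xy: "x \<in> topspace (top_of_set H)" "y \<in> topspace (top_of_set H)"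
        and eq: "\<And>l. inv_fun l x = inv_fun l y"
      obtain p p' where p: "p \<in> K" "p' \<in> K" "(\<delta> p, x) \<in> r" "(\<delta> p', y) \<in> r"
        using \<delta>(3)[of x] \<delta>(3)[of y] xy by auto
      have "inv_fun l (\<delta> p) = inv_fun l (\<delta> p')" for l
        using inv_eq[OF p(3), of l] inv_eq[OF p(4), of l] eq by simp
      then have "(\<delta> p, \<delta> p') \<in> r" using inv_imp_F F_imp_r p by blast
      then have "(x, y) \<in> r" using p sym tr by blast
      then show "r `` {x} = r `` {y}" using xy class_eq[of x y] by simp
    qed
    fix p p' assume "p \<in> topspace (top_of_set K)" "p' \<in> topspace (top_of_set K)"
    then have p: "p \<in> K" "p' \<in> K" by auto
    have "(\<delta> p, \<delta> p') \<in> r \<longleftrightarrow> (F p, F p') \<in> proj_rel"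
      using inv_imp_F[OF p] F_imp_r[OF p] inv_eq[of "\<delta> p" "\<delta> p'"] by blast
    then show "((\<lambda>x. r `` {x}) \<circ> \<delta>) p = ((\<lambda>x. r `` {x}) \<circ> \<delta>) p' \<longleftrightarrow>
       ((\<lambda>x. proj_rel `` {x}) \<circ> F) p = ((\<lambda>x. proj_rel `` {x}) \<circ> F) p'"
      using p F(2) by (simp add: class_eq \<delta>H proj_rel_class_eq_iff)
  qed
qed

section \<open>A theta function\<close>

text \<open>This is q = exp (2 pi i tau) for tau = i. With this value the nome is
  \<open>torus_pt 0 1\<close>, so that both logarithmic coordinates have period 1 on the elliptic
  curve.\<close>

definition nome :: complex where "nome = of_real (exp (- 2 * pi))"

lemma nome_nonzero [simp]: "nome \<noteq> 0"
  by (simp add: nome_def)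

lemma norm_nome: "norm nome = exp (- 2 * pi)"
  by (simp add: nome_def)

lemma norm_nome_bounds: "0 < norm nome" "norm nome < 1"
  by (simp_all add: norm_nome)

lemma nome_power_neq_1: "n > 0 \<Longrightarrow> nome ^ n \<noteq> 1"
  using norm_nome_bounds by (metis norm_one norm_power power_less_one_iff less_irrefl less_le norm_ge_zero)

lemma nome_power_int_eq_1_iff: "nome powi k = 1 \<longleftrightarrow> k = 0"
proof
  assume eq: "nome powi k = 1"
  show "k = 0"
  proof (cases "k \<ge> 0")
    case True
    then have "nome ^ nat k = 1" using eq by (simp add: power_int_def)
    then show ?thesis using nome_power_neq_1[of "nat k"] True by (cases "nat k") auto
  next
    case False
    then have "nome ^ nat (- k) = 1" using eq by (simp add: power_int_def field_simps)
    then show ?thesis using nome_power_neq_1[of "nat (- k)"] False by (cases "nat (- k)") auto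
  qed
qed simp

text \<open>Euler's coefficients (-1)^n q^(n(n-1)/2) / ((1 - q) ... (1 - q^n)), in the recursive
  form that the functional equation \<open>qexp_eq\<close> forces.\<close>

primrec qexp_coeff :: "nat \<Rightarrow> complex" where
  "qexp_coeff 0 = 1"
| "qexp_coeff (Suc n) = - (nome ^ n / (1 - nome ^ Suc n)) * qexp_coeff n"

text \<open>The power series of the infinite product over \<open>n \<ge> 0\<close> of \<open>1 - nome ^ n * w\<close>.\<close>

definition qexp :: "complex \<Rightarrow> complex" where
  "qexp w = (\<Sum>n. qexp_coeff n * w ^ n)"

lemma qexp_sums: "(\<lambda>n. qexp_coeff n * w ^ n) sums qexp w"
proof -
  have "(\<lambda>n. nome ^ n) \<longlonglongrightarrow> 0"
    by (rule LIMSEQ_power_zero[OF norm_nome_bounds(2)])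
  moreover from this have "(\<lambda>n. nome ^ Suc n) \<longlonglongrightarrow> 0"
    by (rule LIMSEQ_Suc)
  ultimately have "(\<lambda>n. norm (nome ^ n / (1 - nome ^ Suc n) * w)) \<longlonglongrightarrow> norm (0 / (1 - 0) * w)"
    by (intro tendsto_norm tendsto_mult tendsto_divide tendsto_diff tendsto_const) auto
  then have "eventually (\<lambda>n. norm (nome ^ n / (1 - nome ^ Suc n) * w) < 1 / 2) sequentially"
    by (rule order_tendstoD) simp
  then obtain N where N: "norm (nome ^ n / (1 - nome ^ Suc n) * w) < 1 / 2" if "n \<ge> N" for n
    by (auto simp: eventually_sequentially)
  have "norm (qexp_coeff (Suc n) * w ^ Suc n) \<le> 1 / 2 * norm (qexp_coeff n * w ^ n)" if "n \<ge> N" for n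
  proof -
    have "qexp_coeff (Suc n) * w ^ Suc n = - (nome ^ n / (1 - nome ^ Suc n) * w) * (qexp_coeff n * w ^ n)"
      by simp
    then have "norm (qexp_coeff (Suc n) * w ^ Suc n)
        = norm (nome ^ n / (1 - nome ^ Suc n) * w) * norm (qexp_coeff n * w ^ n)"
      by (simp only: norm_mult norm_minus_cancel)
    also have "\<dots> \<le> 1 / 2 * norm (qexp_coeff n * w ^ n)"
      using N[OF that] by (intro mult_right_mono) auto
    finally show ?thesis .
  qed
  then have "summable (\<lambda>n. qexp_coeff n * w ^ n)"
    by (intro summable_ratio_test[of "1 / 2" N]) auto
  then show ?thesis
    unfolding qexp_def by (rule summable_sums)
qed

lemma holomorphic_qexp: "qexp holomorphic_on UNIV"
proof -
  have "qexp holomorphic_on ball 0 r" for r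
    using qexp_sums by (intro power_series_holomorphic[of 0 r qexp_coeff]) auto
  then have "qexp field_differentiable at z" for z
    by (rule holomorphic_on_imp_differentiable_at[of _ "ball 0 (norm z + 1)"]) auto
  then show ?thesis
    by (simp add: holomorphic_on_def field_differentiable_at_within)
qed

lemma holomorphic_on_qexp [holomorphic_intros]:
  "f holomorphic_on S \<Longrightarrow> (\<lambda>z. qexp (f z)) holomorphic_on S"
  using holomorphic_on_compose_gen[OF _ holomorphic_qexp, of f S] by (simp add: o_def)

lemma qexp_0 [simp]: "qexp 0 = 1"
proof -
  have "(\<lambda>n. qexp_coeff n * 0 ^ n) sums (\<Sum>n\<in>{0}. qexp_coeff n * 0 ^ n)"
    by (rule sums_finite) (auto simp: power_0_left)
  then show ?thesis using sums_unique2[OF qexp_sums[of 0]] by simp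
qed

text \<open>Coefficientwise this is the recursion (1 - q^(n+1)) a_(n+1) = - q^n a_n. The series
  together with this equation does all the work that the infinite product would do.\<close>

lemma qexp_eq: "qexp w = (1 - w) * qexp (nome * w)"
proof -
  have "(\<lambda>n. qexp_coeff n * w ^ n - qexp_coeff n * (nome * w) ^ n) sums (qexp w - qexp (nome * w))"
    by (intro sums_diff qexp_sums)
  then have "(\<lambda>n. qexp_coeff (Suc n) * w ^ Suc n - qexp_coeff (Suc n) * (nome * w) ^ Suc n)
               sums (qexp w - qexp (nome * w))"
    by (subst sums_Suc_iff) simp
  moreover have "qexp_coeff (Suc n) * w ^ Suc n - qexp_coeff (Suc n) * (nome * w) ^ Suc n
                   = - w * (qexp_coeff n * (nome * w) ^ n)" for n
  proof -
    have "qexp_coeff (Suc n) * w ^ Suc n - qexp_coeff (Suc n) * (nome * w) ^ Suc n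
            = qexp_coeff (Suc n) * (1 - nome ^ Suc n) * w ^ Suc n"
      by (simp add: power_mult_distrib algebra_simps del: qexp_coeff.simps)
    also have "qexp_coeff (Suc n) * (1 - nome ^ Suc n) = - (nome ^ n * qexp_coeff n)"
      using nome_power_neq_1[of "Suc n"] by (simp add: field_simps)
    finally show ?thesis by (simp add: power_mult_distrib)
  qed
  ultimately have "(\<lambda>n. - w * (qexp_coeff n * (nome * w) ^ n)) sums (qexp w - qexp (nome * w))"
    by simp
  moreover have "(\<lambda>n. - w * (qexp_coeff n * (nome * w) ^ n)) sums (- w * qexp (nome * w))"
    by (intro sums_mult qexp_sums)
  ultimately have "qexp w - qexp (nome * w) = - w * qexp (nome * w)"
    by (rule sums_unique2)
  then show ?thesis by (simp add: algebra_simps)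
qed

text \<open>If no factor \<open>1 - nome ^ n * w\<close> vanishes, the functional equation carries
  the zero along w, q w, q^2 w, ... to the limit 0, where \<open>qexp\<close> is 1.\<close>

lemma qexp_eq_0D:
  assumes "qexp w = 0"
  shows "\<exists>n. nome ^ n * w = 1"
proof (rule ccontr)
  assume contra: "\<not> ?thesis"
  have zero: "qexp (nome ^ n * w) = 0" for n
  proof (induction n)
    case (Suc n)
    then show ?case
      using qexp_eq[of "nome ^ n * w"] contra by (auto simp: mult.assoc)
  qed (simp add: assms)
  have "isCont qexp 0"
    using holomorphic_qexp holomorphic_on_imp_continuous_on continuous_on_eq_continuous_at open_UNIV by blast
  moreover have "(\<lambda>n. nome ^ n * w) \<longlonglongrightarrow> 0"
    using norm_nome_bounds by (intro tendsto_mult_left_zero LIMSEQ_power_zero) auto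
  ultimately have "(\<lambda>n. qexp (nome ^ n * w)) \<longlonglongrightarrow> qexp 0"
    by (rule isCont_tendsto_compose)
  then show False by (simp add: zero LIMSEQ_const_iff)
qed

text \<open>The product side of the Jacobi triple product in multiplicative notation, without its
  constant factor.\<close>

definition theta :: "complex \<Rightarrow> complex" where
  "theta w = qexp w * qexp (nome / w)"

lemma holomorphic_on_theta [holomorphic_intros]:
  "f holomorphic_on S \<Longrightarrow> (\<And>z. z \<in> S \<Longrightarrow> f z \<noteq> 0) \<Longrightarrow> (\<lambda>z. theta (f z)) holomorphic_on S"
  unfolding theta_def by (intro holomorphic_intros) auto

lemma theta_nome_mult: "w \<noteq> 0 \<Longrightarrow> w * theta (nome * w) = - theta w"
proof -
  assume w: "w \<noteq> 0"
  have "w * theta (nome * w) = w * (qexp (nome * w) * qexp (1 / w))"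
    using w by (simp add: theta_def)
  also have "\<dots> = - ((1 - w) * qexp (nome * w) * qexp (nome / w))"
    using w by (subst qexp_eq[of "1 / w"]) (simp add: field_simps)
  also have "\<dots> = - theta w"
    unfolding theta_def by (subst (3) qexp_eq) simp
  finally show ?thesis .
qed

lemma theta_inverse: "w \<noteq> 0 \<Longrightarrow> theta (1 / w) = theta (nome * w)"
  by (simp add: theta_def)

lemma theta_1 [simp]: "theta 1 = 0"
  using qexp_eq[of 1] by (simp add: theta_def)

text \<open>The sections of a line bundle of degree \<open>k\<close> on \<open>\<complex>\<^sup>* / nome\<^bsup>\<int>\<^esup>\<close>.\<close>

definition qfun :: "nat \<Rightarrow> complex \<Rightarrow> (complex \<Rightarrow> complex) set" where
  "qfun k l = {f. f holomorphic_on - {0} \<and> (\<forall>w. w \<noteq> 0 \<longrightarrow> w ^ k * f (nome * w) = l * f w)}"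

lemma qfunD:
  assumes "f \<in> qfun k l"
  shows "f holomorphic_on - {0}" "w \<noteq> 0 \<Longrightarrow> w ^ k * f (nome * w) = l * f w"
  using assms by (auto simp: qfun_def)

lemma qfun_mult: "f \<in> qfun k l \<Longrightarrow> g \<in> qfun k' l' \<Longrightarrow> (\<lambda>w. f w * g w) \<in> qfun (k + k') (l * l')"
  unfolding qfun_def
proof (intro CollectI conjI allI impI; elim CollectE conjE)
  fix w :: complex
  assume *: "\<forall>w. w \<noteq> 0 \<longrightarrow> w ^ k * f (nome * w) = l * f w" "\<forall>w. w \<noteq> 0 \<longrightarrow> w ^ k' * g (nome * w) = l' * g w"
    and w: "w \<noteq> 0"
  have "w ^ (k + k') * (f (nome * w) * g (nome * w)) = (w ^ k * f (nome * w)) * (w ^ k' * g (nome * w))"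
    by (simp add: power_add mult_ac)
  also have "\<dots> = l * l' * (f w * g w)"
    unfolding *(1)[rule_format, OF w] *(2)[rule_format, OF w] by simp
  finally show "w ^ (k + k') * (f (nome * w) * g (nome * w)) = l * l' * (f w * g w)" .
qed (auto intro: holomorphic_intros)

lemma qfun_add: "f \<in> qfun k l \<Longrightarrow> g \<in> qfun k l \<Longrightarrow> (\<lambda>w. f w + g w) \<in> qfun k l"
  by (auto simp: qfun_def ring_distribs intro!: holomorphic_intros)

lemma qfun_0: "(\<lambda>w. 0) \<in> qfun k l"
  by (simp add: qfun_def)

lemma qfun_const: "(\<lambda>w. c) \<in> qfun 0 1"
  by (simp add: qfun_def)

lemma qfun_cmult: "f \<in> qfun k l \<Longrightarrow> (\<lambda>w. c * f w) \<in> qfun k l"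
  using qfun_mult[OF qfun_const] by fastforce

lemma qfun_sum: "(\<And>i. i \<in> I \<Longrightarrow> f i \<in> qfun k l) \<Longrightarrow> (\<lambda>w. \<Sum>i\<in>I. f i w) \<in> qfun k l"
  by (induction I rule: infinite_finite_induct) (auto intro: qfun_add qfun_0)

lemma qfun_diff: "f \<in> qfun k l \<Longrightarrow> g \<in> qfun k l \<Longrightarrow> (\<lambda>w. f w - g w) \<in> qfun k l"
  using qfun_add[of f k l "\<lambda>w. (-1) * g w"] qfun_cmult[of g k l "-1"] by simp

lemma qfun_prod: "finite I \<Longrightarrow> (\<And>i. i \<in> I \<Longrightarrow> f i \<in> qfun k (l i)) \<Longrightarrow>
    (\<lambda>w. \<Prod>i\<in>I. f i w) \<in> qfun (k * card I) (\<Prod>i\<in>I. l i)"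
  by (induction I rule: finite_induct) (auto intro: qfun_mult simp: qfun_const)

lemma theta_qfun: "a \<noteq> 0 \<Longrightarrow> (\<lambda>w. theta (w / a)) \<in> qfun 1 (- a)"
  using theta_nome_mult[of "w / a" for w]
  by (auto simp: qfun_def field_simps intro!: holomorphic_intros)

lemma qfun_nome_power_mult:
  assumes "l \<noteq> 0"
  obtains c where "c \<noteq> 0"
    "\<And>f w. f \<in> qfun k l \<Longrightarrow> w \<noteq> 0 \<Longrightarrow> f (nome powi n * w) = c * w powi (- (int k * n)) * f w"
proof -
  have "\<exists>c. c \<noteq> 0 \<and> (\<forall>f\<in>qfun k l. \<forall>w. w \<noteq> 0 \<longrightarrow> f (nome powi n * w) = c * w powi (- (int k * n)) * f w)"
  proof (induction n rule: int_induct[of _ 0])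
    case base
    show ?case by (intro exI[of _ 1]) auto
  next
    case (step1 n)
    then obtain c where c: "c \<noteq> 0"
      "\<And>f w. f \<in> qfun k l \<Longrightarrow> w \<noteq> 0 \<Longrightarrow> f (nome powi n * w) = c * w powi (- (int k * n)) * f w"
      by blast
    define d where "d = c * l / (nome powi n) ^ k"
    have "f (nome powi (n + 1) * w) = d * w powi (- (int k * (n + 1))) * f w" if f: "f \<in> qfun k l" and w: "w \<noteq> 0" for f w
    proof -
      have "f (nome powi (n + 1) * w) = f (nome * (nome powi n * w))"
        by (simp add: power_int_add mult_ac)
      also have "\<dots> = l * f (nome powi n * w) / (nome powi n * w) ^ k"
        using qfunD(2)[OF f, of "nome powi n * w"] w by (simp add: field_simps)
      also have "\<dots> = d * (w powi (- (int k * n)) / w ^ k) * f w"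
        using c(2)[OF f w] by (simp add: d_def power_mult_distrib)
      also have "w powi (- (int k * n)) / w ^ k = w powi (- (int k * (n + 1)))"
        using w power_int_diff[of w "- (int k * n)" "int k"] by (simp add: distrib_left)
      finally show ?thesis .
    qed
    with c(1) assms show ?case by (intro exI[of _ d]) (auto simp: d_def)
  next
    case (step2 n)
    then obtain c where c: "c \<noteq> 0"
      "\<And>f w. f \<in> qfun k l \<Longrightarrow> w \<noteq> 0 \<Longrightarrow> f (nome powi n * w) = c * w powi (- (int k * n)) * f w"
      by blast
    define d where "d = c * (nome powi (n - 1)) ^ k / l"
    have "f (nome powi (n - 1) * w) = d * w powi (- (int k * (n - 1))) * f w" if f: "f \<in> qfun k l" and w: "w \<noteq> 0" for f w
    proof -
      have eq: "nome * (nome powi (n - 1) * w) = nome powi n * w"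
        by (simp add: power_int_diff)
      have "f (nome powi (n - 1) * w) = (nome powi (n - 1) * w) ^ k * f (nome powi n * w) / l"
        using qfunD(2)[OF f, of "nome powi (n - 1) * w"] w assms unfolding eq by (simp add: field_simps)
      also have "\<dots> = d * (w ^ k * w powi (- (int k * n))) * f w"
        using c(2)[OF f w] by (simp add: d_def power_mult_distrib)
      also have "w ^ k * w powi (- (int k * n)) = w powi (- (int k * (n - 1)))"
        using w power_int_add[of w "int k" "- (int k * n)"] by (simp add: algebra_simps)
      finally show ?thesis .
    qed
    with c(1) assms show ?case by (intro exI[of _ d]) (auto simp: d_def)
  qed
  then show thesis using that by blast
qed

lemma qfun_zero_shift:
  assumes "f \<in> qfun k l" "l \<noteq> 0" "a \<noteq> 0" "f a = 0"
  shows "f (nome powi n * a) = 0"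
  using qfun_nome_power_mult[OF assms(2), of k n] assms by (metis mult_zero_right)

lemma theta_nome_power_mult:
  obtains c where "c \<noteq> 0" "\<And>w. w \<noteq> 0 \<Longrightarrow> theta (nome powi n * w) = c * w powi (- n) * theta w"
  using qfun_nome_power_mult[of "-1" 1 n] theta_qfun[of 1] by (simp add: o_def) (metis mult_1)

lemma theta_eq_0_iff:
  assumes "w \<noteq> 0"
  shows "theta w = 0 \<longleftrightarrow> (\<exists>k. w = nome powi k)"
proof
  assume "theta w = 0"
  then consider "qexp w = 0" | "qexp (nome / w) = 0"
    by (auto simp: theta_def)
  then show "\<exists>k. w = nome powi k"
  proof cases
    case 1
    then obtain n where "nome ^ n * w = 1" using qexp_eq_0D by blast
    then show ?thesis
      by (intro exI[of _ "- int n"]) (simp add: power_int_minus field_simps)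
  next
    case 2
    \<comment> \<open>The shift in \<open>nome / w\<close> makes the exponent \<open>n + 1\<close>:
      the first factor of \<open>theta\<close> accounts for the exponents \<le> 0, the second for
      those \<ge> 1.\<close>
    then obtain n where "nome ^ n * (nome / w) = 1" using qexp_eq_0D by blast
    then show ?thesis
      using assms by (intro exI[of _ "int (Suc n)"]) (simp add: field_simps del: of_nat_Suc)
  qed
next
  assume "\<exists>k. w = nome powi k"
  then show "theta w = 0"
    using theta_nome_power_mult by (metis mult.right_neutral mult_zero_right theta_1 zero_neq_one)
qed

text \<open>At 1 the factor \<open>1 - z\<close> splits off and the cofactor has the value
  \<open>qexp nome\<close> squared, which is nonzero. Quasiperiodicity transports this to the other
  zeros, the powers of the nome.\<close>

lemma deriv_theta_nonzero:
  assumes "w \<noteq> 0" "theta w = 0"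
  shows "deriv theta w \<noteq> 0"
proof -
  have hol: "theta holomorphic_on - {0}"
    by (rule holomorphic_on_theta[of "\<lambda>z. z"]) auto
  have D: "(theta has_field_derivative deriv theta z) (at z)" if "z \<noteq> 0" for z
    using hol that by (intro holomorphic_derivI[OF hol]) auto
  define g where "g = (\<lambda>z. qexp (nome * z) * qexp (nome / z))"
  have "g holomorphic_on - {0}"
    unfolding g_def by (intro holomorphic_intros) auto
  then have Dg: "(g has_field_derivative deriv g 1) (at 1)"
    by (intro holomorphic_derivI[of g "- {0}"]) auto
  have eq: "theta = (\<lambda>z. (1 - z) * g z)"
  proof
    fix z show "theta z = (1 - z) * g z"
      unfolding theta_def g_def by (subst qexp_eq) simp
  qed
  have "((\<lambda>z. (1 - z) * g z) has_field_derivative - g 1) (at 1)"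
    by (rule derivative_eq_intros Dg refl | simp)+
  then have D1: "(theta has_field_derivative - g 1) (at 1)"
    unfolding eq[symmetric] .
  have "qexp nome \<noteq> 0"
    using qexp_eq_0D[of nome] nome_power_neq_1[of "Suc _"] by (auto simp: mult.commute)
  then have g1: "g 1 \<noteq> 0" by (simp add: g_def)
  obtain k where k: "w = nome powi k" using assms theta_eq_0_iff by blast
  obtain c where c: "c \<noteq> 0" "\<And>w. w \<noteq> 0 \<Longrightarrow> theta (nome powi k * w) = c * w powi (- k) * theta w"
    using theta_nome_power_mult by blast
  have "((\<lambda>z. theta (w * z)) has_field_derivative deriv theta w * w) (at 1)"
    by (rule DERIV_chain'[of "\<lambda>z. w * z" w 1 UNIV theta "deriv theta w"])
       (use D assms in \<open>auto intro!: derivative_eq_intros\<close>)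
  moreover have "((\<lambda>z. c * z powi (- k) * theta z) has_field_derivative - (c * g 1)) (at 1)"
    by (rule derivative_eq_intros D1 refl | simp)+
  then have "((\<lambda>z. theta (w * z)) has_field_derivative - (c * g 1)) (at 1)"
    by (rule has_field_derivative_transform_within_open[of _ _ _ "- {0}"])
       (use c k in auto)
  ultimately have "deriv theta w * w = - (c * g 1)"
    by (rule DERIV_unique)
  then show ?thesis using g1 c by auto
qed

section \<open>Quasiperiodic functions and their zeros\<close>

lemma isCont_eq_if_eventually_eq:
  fixes f g :: "'a::{perfect_space,t2_space} \<Rightarrow> 'b::t2_space"
  assumes "isCont f z" "isCont g z" "eventually (\<lambda>w. f w = g w) (at z)"
  shows "f z = g z"
proof -
  have "(f \<longlongrightarrow> g z) (at z)"
    using assms(2) unfolding isCont_def by (subst tendsto_cong[OF assms(3)])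
  then show ?thesis
    using assms(1) unfolding isCont_def by (intro tendsto_unique[of "at z" f]) auto
qed

lemma holomorphic_isCont: "f holomorphic_on S \<Longrightarrow> open S \<Longrightarrow> z \<in> S \<Longrightarrow> isCont f z"
  using continuous_on_eq_continuous_at holomorphic_on_imp_continuous_on by blast

text \<open>Near a common zero \<open>a\<close>, the quotient of \<open>f\<close> and
  \<open>g\<close> equals that of their difference quotients \<open>F\<close> and \<open>G\<close>
  at \<open>a\<close>. These extend holomorphically over \<open>a\<close>, and \<open>G a\<close> is
  the nonzero derivative of \<open>g\<close>.\<close>

lemma holomorphic_quotient_simple_zeros:
  assumes S: "open S" and f: "f holomorphic_on S" and g: "g holomorphic_on S"
    and zero: "\<And>z. z \<in> S \<Longrightarrow> g z = 0 \<Longrightarrow> f z = 0 \<and> deriv g z \<noteq> 0"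
  obtains h where "h holomorphic_on S" "\<And>z. z \<in> S \<Longrightarrow> f z = g z * h z"
proof
  define h where "h z = (if g z = 0 then deriv f z / deriv g z else f z / g z)" for z
  show "f z = g z * h z" if "z \<in> S" for z
    using zero[OF that] by (simp add: h_def)
  have "h field_differentiable at a" if a: "a \<in> S" for a
  proof (cases "g a = 0")
    case False
    have "isCont g a" using holomorphic_isCont g S a by blast
    then have "\<forall>\<^sub>F z in at a. g z \<noteq> 0"
      using False by (simp add: isCont_def tendsto_imp_eventually_ne)
    then have "\<forall>\<^sub>F z in nhds a. g z \<noteq> 0"
      using False by (simp add: eventually_nhds_conv_at)
    then obtain T where T: "open T" "a \<in> T" "\<And>z. z \<in> T \<Longrightarrow> g z \<noteq> 0"
      by (auto simp: eventually_nhds)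
    have "(\<lambda>z. f z / g z) holomorphic_on S \<inter> T"
      using f g T by (intro holomorphic_intros) (auto intro: holomorphic_on_subset)
    then have "h holomorphic_on S \<inter> T"
      using T by (subst holomorphic_cong[OF refl, of _ _ "\<lambda>z. f z / g z"]) (auto simp: h_def)
    then show ?thesis
      using S T a by (intro holomorphic_on_imp_differentiable_at[of h "S \<inter> T"]) auto
  next
    case True
    define F where "F z = (if z = a then deriv f a else (f z - f a) / (z - a))" for z
    define G where "G z = (if z = a then deriv g a else (g z - g a) / (z - a))" for z
    have F: "F holomorphic_on S" and G: "G holomorphic_on S"
      unfolding F_def G_def using pole_lemma f g a S by (simp_all add: interior_open)
    have Ga: "G a \<noteq> 0" using zero a True by (simp add: G_def)
    have "isCont G a" using holomorphic_isCont G S a by blast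
    then have "\<forall>\<^sub>F z in at a. G z \<noteq> 0"
      using Ga by (simp add: isCont_def tendsto_imp_eventually_ne)
    then have "\<forall>\<^sub>F z in nhds a. G z \<noteq> 0"
      using Ga by (simp add: eventually_nhds_conv_at)
    then obtain T where T: "open T" "a \<in> T" "\<And>z. z \<in> T \<Longrightarrow> G z \<noteq> 0"
      by (auto simp: eventually_nhds)
    have "(\<lambda>z. F z / G z) holomorphic_on S \<inter> T"
      using F G T by (intro holomorphic_intros) (auto intro: holomorphic_on_subset)
    moreover have "h z = F z / G z" if "z \<in> S \<inter> T" for z
    proof (cases "z = a")
      case False
      then have "g z \<noteq> 0" using T(3)[of z] that True by (auto simp: G_def)
      then show ?thesis using False True zero[OF a] by (simp add: h_def F_def G_def)
    qed (simp add: h_def F_def G_def True)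
    ultimately have "h holomorphic_on S \<inter> T"
      by (subst holomorphic_cong[OF refl, of _ _ "\<lambda>z. F z / G z"]) auto
    then show ?thesis
      using S T a by (intro holomorphic_on_imp_differentiable_at[of h "S \<inter> T"]) auto
  qed
  then show "h holomorphic_on S"
    by (simp add: holomorphic_on_def field_differentiable_at_within)
qed

text \<open>The only power of the nome that is a root of unity is 1. This provides explicit points
  off the zero set, such as -1 and \<i>.\<close>

lemma theta_nonzero_if_root_of_unity:
  assumes "w ^ k = 1" "w \<noteq> 1" "k > 0"
  shows "theta w \<noteq> 0"
proof
  have w: "w \<noteq> 0" using assms by (auto simp: power_0_left)
  assume "theta w = 0"
  then obtain n where n: "w = nome powi n" using theta_eq_0_iff w by blast
  then have "nome powi (n * int k) = 1" using assms(1) by (simp add: power_int_mult)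
  then have "n = 0" using nome_power_int_eq_1_iff assms(3) by auto
  then show False using n assms(2) by simp
qed

lemma eventually_theta_nonzero:
  assumes "a \<noteq> 0" "w \<noteq> 0"
  shows "\<forall>\<^sub>F z in at w. theta (z / a) \<noteq> 0"
proof -
  have "(\<lambda>w. theta (w / a)) holomorphic_on - {0}"
    using assms by (intro holomorphic_intros) auto
  \<comment> \<open>A single nonzero value suffices: on the connected punctured plane the zeros of a
    nonzero holomorphic function are isolated.\<close>
  moreover have "theta (- a / a) \<noteq> 0"
    using assms theta_nonzero_if_root_of_unity[of "-1" 2] by simp
  ultimately have "\<forall>\<^sub>F z in at w. theta (z / a) \<noteq> 0 \<and> z \<in> - {0}"
    using assms by (intro non_zero_neighbour_alt[of _ _ _ "- a"])
      (auto simp: connected_punctured_universe)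
  then show ?thesis by eventually_elim auto
qed

text \<open>A zero \<open>a\<close> of \<open>f\<close> entails zeros at all
  \<open>nome powi n * a\<close>, which are precisely the zeros of \<open>theta (w / a)\<close>, all
  of them simple. The divisor has degree 1 and multiplier \<open>- a\<close>, whence the degree and
  the multiplier of the quotient.\<close>

lemma qfun_divide_theta:
  assumes f: "f \<in> qfun (Suc k) l" "l \<noteq> 0" and a: "a \<noteq> 0" "f a = 0"
  obtains g where "g \<in> qfun k (- l / a)" "\<And>w. w \<noteq> 0 \<Longrightarrow> f w = theta (w / a) * g w"
proof -
  define T where "T w = theta (w / a)" for w
  have T: "T holomorphic_on - {0}"
    unfolding T_def using a by (intro holomorphic_intros) auto
  have T0: "f w = 0 \<and> deriv T w \<noteq> 0" if w: "w \<in> - {0}" "T w = 0" for w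
  proof
    obtain n where "w / a = nome powi n"
      using theta_eq_0_iff[of "w / a"] w a by (auto simp: T_def)
    then have "w = nome powi n * a" using a by (simp add: field_simps)
    then show "f w = 0" using qfun_zero_shift[OF f a] by simp
    have "(theta has_field_derivative deriv theta (w / a)) (at (w / a))"
      using w a by (intro holomorphic_derivI[of theta "- {0}"] holomorphic_on_theta[of "\<lambda>z. z"]) auto
    then have "(T has_field_derivative deriv theta (w / a) * (1 / a)) (at w)"
      unfolding T_def by (rule DERIV_chain'[rotated]) (auto intro!: derivative_eq_intros simp: a)
    then have "deriv T w = deriv theta (w / a) / a"
      using DERIV_imp_deriv by force
    then show "deriv T w \<noteq> 0"
      using deriv_theta_nonzero[of "w / a"] w a by (simp add: T_def)
  qed
  obtain g where g: "g holomorphic_on - {0}" "\<And>w. w \<in> - {0} \<Longrightarrow> f w = T w * g w"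
    using holomorphic_quotient_simple_zeros[of "- {0}" f T] qfunD(1)[OF f(1)] T T0 by blast
  \<comment> \<open>Cancelling \<open>theta (w / a)\<close> gives this only off its zeros;
    continuity of both sides does the rest.\<close>
  have eq: "w ^ k * g (nome * w) = - l / a * g w" if w: "w \<noteq> 0" for w
  proof (rule isCont_eq_if_eventually_eq[where f = "\<lambda>w. w ^ k * g (nome * w)" and g = "\<lambda>w. - l / a * g w"])
    have "(\<lambda>w. w ^ k * g (nome * w)) holomorphic_on - {0}"
      by (intro holomorphic_intros holomorphic_on_compose_gen[OF _ g(1), unfolded o_def]) auto
    then show "isCont (\<lambda>w. w ^ k * g (nome * w)) w"
      using w by (intro holomorphic_isCont[of _ "- {0}"]) auto
    have "(\<lambda>w. - l / a * g w) holomorphic_on - {0}"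
      by (intro holomorphic_intros g)
    then show "isCont (\<lambda>w. - l / a * g w) w"
      using w by (intro holomorphic_isCont[of _ "- {0}"]) auto
    have "\<forall>\<^sub>F z in at w. theta (z / a) \<noteq> 0 \<and> z \<noteq> 0"
      using eventually_theta_nonzero[OF a(1) w] eventually_neq_at_within[of 0 w UNIV]
      by (simp add: eventually_conj)
    then show "\<forall>\<^sub>F z in at w. z ^ k * g (nome * z) = - l / a * g z"
    proof eventually_elim
      case (elim z)
      then have elim: "T z \<noteq> 0" "z \<noteq> 0" by (simp_all add: T_def)
      have "T z * (z * z ^ k * g (nome * z)) = - a * (z * (- 1 / a * T z) * z ^ k * g (nome * z))"
        using a by simp
      also have "- 1 / a * T z = z / a / a * T (nome * z)"
        using theta_nome_mult[of "z / a"] elim a by (simp add: T_def field_simps)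
      also have "- a * (z * (z / a / a * T (nome * z)) * z ^ k * g (nome * z)) = - z / a * (z ^ Suc k * f (nome * z))"
        using elim g(2)[of "nome * z"] a by (simp add: field_simps)
      also have "\<dots> = - z / a * (l * (T z * g z))"
        using qfunD(2)[OF f(1), of z] elim g(2)[of z] by simp
      finally have "(z * T z) * (z ^ k * g (nome * z)) = (z * T z) * (- l / a * g z)"
        by (simp add: mult_ac)
      then show ?case using elim by (simp only: mult_cancel_left mult_eq_0_iff) auto
    qed
  qed
  show thesis
    using that[of g] g eq by (auto simp: qfun_def T_def)
qed

text \<open>Multiplying by a high power \<open>w ^ N\<close> makes the multiplier \<mu> at most 1 in
  norm, so the product stays bounded near 0 and extends to an entire function. Comparing Taylor
  coefficients leaves a single monomial. The zero function is why \<open>l\<close> is constrained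
  only when \<open>c\<close> is nonzero.\<close>

lemma qfun_0_monomial:
  assumes f: "f \<in> qfun 0 l"
  obtains c n where "\<And>w. w \<noteq> 0 \<Longrightarrow> f w = c * w powi n" "c = 0 \<or> l = nome powi n"
proof -
  have hol: "f holomorphic_on - {0}" and feq: "\<And>w. w \<noteq> 0 \<Longrightarrow> f (nome * w) = l * f w"
    using qfunD[OF f] by auto
  have "(\<lambda>N. norm l * norm nome ^ N) \<longlonglongrightarrow> norm l * 0"
    using norm_nome_bounds by (intro tendsto_intros LIMSEQ_power_zero) auto
  then have "\<forall>\<^sub>F N in sequentially. norm l * norm nome ^ N < 1"
    by (rule order_tendstoD) simp
  then obtain N where N: "norm l * norm nome ^ N < 1"
    by (auto simp: eventually_sequentially)
  define \<mu> where "\<mu> = l * nome ^ N"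
  define g where "g w = w ^ N * f w" for w
  have holg: "g holomorphic_on - {0}"
    unfolding g_def by (intro holomorphic_intros hol)
  have geq: "g (nome * w) = \<mu> * g w" if "w \<noteq> 0" for w
    using feq[OF that] by (simp add: g_def \<mu>_def power_mult_distrib)
  have \<mu>: "norm \<mu> \<le> 1" using N by (simp add: \<mu>_def norm_mult norm_power)
  have "compact (cball 0 1 - ball 0 (norm nome) :: complex set)"
    by (intro compact_diff) auto
  moreover have "continuous_on (cball 0 1 - ball 0 (norm nome)) g"
    using holg norm_nome_bounds
    by (intro holomorphic_on_imp_continuous_on holomorphic_on_subset[OF holg]) auto
  ultimately have "compact (g ` (cball 0 1 - ball 0 (norm nome)))"
    by (rule compact_continuous_image[rotated])
  then obtain B where B: "norm (g w) \<le> B" if "norm nome \<le> norm w" "norm w \<le> 1" for w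
    unfolding bounded_iff using compact_imp_bounded bounded_iff
    by (metis (no_types, lifting) DiffI image_eqI mem_ball_0 mem_cball_0 not_le)
  \<comment> \<open>Multiplication by the nome maps each annulus onto the next one inward, and the
    norm of \<open>g\<close> does not increase along it; so a bound on the outermost annulus holds
    on all.\<close>
  have bound: "norm nome ^ Suc n \<le> norm w \<Longrightarrow> norm w \<le> norm nome ^ n \<Longrightarrow> norm (g w) \<le> B" for n w
  proof (induction n arbitrary: w)
    case 0
    then show ?case using B by simp
  next
    case (Suc n)
    define v where "v = w / nome"
    have w: "w = nome * v" by (simp add: v_def)
    have "0 < norm nome ^ Suc (Suc n)" using norm_nome_bounds(1) by (rule zero_less_power)
    then have "0 < norm w" using Suc.prems(1) by (rule less_le_trans)
    then have "w \<noteq> 0" by simp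
    then have v0: "v \<noteq> 0" using w by auto
    have "norm nome ^ Suc n \<le> norm v" "norm v \<le> norm nome ^ n"
      using Suc.prems norm_nome_bounds by (auto simp: w norm_mult)
    then have "norm (g v) \<le> B" by (rule Suc.IH)
    then show ?case
      using geq[OF v0] \<mu> mult_left_le_one_le[of "norm (g v)" "norm \<mu>"] by (simp add: w norm_mult)
  qed
  have gB: "norm (g w) \<le> B" if w: "w \<noteq> 0" "norm w \<le> 1" for w
  proof -
    have "(\<lambda>n. norm nome ^ n) \<longlonglongrightarrow> 0"
      using norm_nome_bounds by (intro LIMSEQ_power_zero) auto
    then have "\<forall>\<^sub>F n in sequentially. norm nome ^ n < norm w"
      using w by (intro order_tendstoD) auto
    then have ex: "\<exists>n. norm nome ^ n < norm w"
      by (auto simp: eventually_sequentially)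
    define n where "n = (LEAST n. norm nome ^ n < norm w)"
    have n: "norm nome ^ n < norm w" unfolding n_def using ex by (rule LeastI_ex)
    with w(2) have "n \<noteq> 0" by (intro notI) simp
    then obtain k where k: "n = Suc k" using not0_implies_Suc by blast
    then have "k < (LEAST n. norm nome ^ n < norm w)" by (simp only: n_def)
    then have "\<not> norm nome ^ k < norm w" by (rule not_less_Least)
    then show ?thesis using bound[of k w] n k by simp
  qed
  have "\<forall>\<^sub>F z in at 0. norm (g z) \<le> B"
    unfolding eventually_at using gB by (intro exI[of _ 1]) (auto simp: dist_norm)
  then have "\<exists>G. G holomorphic_on UNIV \<and> (\<forall>z\<in>UNIV - {0}. G z = g z)"
    using holg by (subst holomorphic_on_extend_bounded) (auto simp: Compl_eq_Diff_UNIV)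
  then obtain G where G: "G holomorphic_on UNIV" "\<And>z. z \<noteq> 0 \<Longrightarrow> G z = g z" by auto
  have G\<mu>: "(\<lambda>w. G (nome * w)) = (\<lambda>w. \<mu> * G w)"
  proof
    fix w
    show "G (nome * w) = \<mu> * G w"
    proof (rule isCont_eq_if_eventually_eq[where f = "\<lambda>w. G (nome * w)" and g = "\<lambda>w. \<mu> * G w"])
      have "(\<lambda>w. G (nome * w)) holomorphic_on UNIV"
        by (intro holomorphic_intros holomorphic_on_compose_gen[OF _ G(1), unfolded o_def]) auto
      then show "isCont (\<lambda>w. G (nome * w)) w"
        by (intro holomorphic_isCont[of _ UNIV]) auto
      have "(\<lambda>w. \<mu> * G w) holomorphic_on UNIV"
        by (intro holomorphic_intros G)
      then show "isCont (\<lambda>w. \<mu> * G w) w"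
        by (intro holomorphic_isCont[of _ UNIV]) auto
      have "\<forall>\<^sub>F z in at w. z \<noteq> 0"
        using eventually_neq_at_within[of 0 w UNIV] by simp
      then show "\<forall>\<^sub>F z in at w. G (nome * z) = \<mu> * G z"
        by eventually_elim (use G geq in auto)
    qed
  qed
  define a where "a n = (deriv ^^ n) G 0" for n
  \<comment> \<open>Since the powers \<open>nome ^ n\<close> are pairwise different, at most one of
    them equals \<mu>, so at most one coefficient survives.\<close>
  have a: "nome ^ n * a n = \<mu> * a n" for n
  proof -
    have "(deriv ^^ n) (\<lambda>w. G (nome * w)) 0 = nome ^ n * (deriv ^^ n) G (nome * 0)"
      by (rule higher_deriv_compose_linear[OF G(1) open_UNIV open_UNIV]) auto
    moreover have "(deriv ^^ n) (\<lambda>w. \<mu> * G w) 0 = \<mu> * (deriv ^^ n) G 0"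
      by (rule higher_deriv_cmult[OF G(1)]) auto
    ultimately show ?thesis unfolding G\<mu> a_def by (simp only: mult_zero_right)
  qed
  have Gs: "(\<lambda>n. a n / fact n * w ^ n) sums G w" for w
    using holomorphic_power_series[of G 0 "norm w + 1" w] G(1)
    by (auto simp: a_def intro: holomorphic_on_subset)
  show thesis
  proof (cases "\<exists>m. a m \<noteq> 0")
    case False
    then have "G w = 0" for w using Gs[of w] sums_unique2[OF _ sums_zero] by simp
    then have "f w = 0 * w powi 0" if "w \<noteq> 0" for w using G(2)[OF that] that by (simp add: g_def)
    then show thesis using that[of 0 0] by blast
  next
    case True
    then obtain m where m: "a m \<noteq> 0" by blast
    then have \<mu>m: "\<mu> = nome ^ m" using a[of m] by simp
    have "a n = 0" if "n \<noteq> m" for n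
    proof (rule ccontr)
      assume "a n \<noteq> 0"
      then have "nome ^ n = nome ^ m" using a[of n] \<mu>m by simp
      then have "nome powi (int n - int m) = 1" by (simp add: power_int_diff)
      then show False using that by (simp add: nome_power_int_eq_1_iff)
    qed
    then have "(\<lambda>n. a n / fact n * w ^ n) sums (\<Sum>n\<in>{m}. a n / fact n * w ^ n)" for w
      by (intro sums_finite) auto
    then have Gm: "G w = a m / fact m * w ^ m" for w
      using sums_unique2[OF Gs[of w]] by simp
    have "f w = a m / fact m * w powi (int m - int N)" if "w \<noteq> 0" for w
      using G(2)[OF that] Gm[of w] that by (simp add: g_def power_int_diff field_simps)
    moreover have "l = nome powi (int m - int N)"
      using \<mu>m by (simp add: \<mu>_def power_int_diff field_simps)
    ultimately show thesis using that by blast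
  qed
qed

text \<open>Without zeros, \<open>h w = w * deriv f w / f w\<close> is holomorphic and drops by the
  degree when \<open>w\<close> is multiplied by the nome. Then \<open>w * deriv h w\<close> has
  degree 0 and multiplier 1, hence is a constant \<open>c\<close>, and
  \<open>h (exp z) - c * z\<close> is constant. The period of \<open>exp\<close> forces
  \<open>c = 0\<close>, so \<open>h\<close> is constant, contrary to the drop. This stands in for
  the argument principle on a fundamental annulus.\<close>

lemma qfun_has_zero:
  assumes f: "f \<in> qfun (Suc k) l"
  shows "\<exists>a. a \<noteq> 0 \<and> f a = 0"
proof (rule ccontr)
  assume "\<not> ?thesis"
  then have nz: "f w \<noteq> 0" if "w \<noteq> 0" for w using that by blast
  have hol: "f holomorphic_on - {0}" and feq: "\<And>w. w \<noteq> 0 \<Longrightarrow> w ^ Suc k * f (nome * w) = l * f w"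
    using qfunD[OF f] by auto
  define h where "h w = w * deriv f w / f w" for w
  have holh: "h holomorphic_on - {0}"
    unfolding h_def using nz by (intro holomorphic_intros hol) auto
  have Df: "(f has_field_derivative deriv f w) (at w)" if "w \<noteq> 0" for w
    using that by (intro holomorphic_derivI[OF hol]) auto
  have heq: "h (nome * w) = h w - of_nat (Suc k)" if w: "w \<noteq> 0" for w
  proof -
    have D1: "((\<lambda>w. f (nome * w)) has_field_derivative deriv f (nome * w) * nome) (at w)"
      by (rule DERIV_chain'[OF _ Df]) (use w in \<open>auto intro!: derivative_eq_intros\<close>)
    have "((\<lambda>w. w ^ Suc k * f (nome * w)) has_field_derivative
             (of_nat (Suc k) * w ^ k * f (nome * w) + w ^ Suc k * (deriv f (nome * w) * nome))) (at w)"
      by (rule derivative_eq_intros D1 refl | simp)+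
    then have "((\<lambda>w. l * f w) has_field_derivative
             (of_nat (Suc k) * w ^ k * f (nome * w) + w ^ Suc k * (deriv f (nome * w) * nome))) (at w)"
      by (rule has_field_derivative_transform_within_open[of _ _ _ "- {0}"]) (use feq w in auto)
    moreover have "((\<lambda>w. l * f w) has_field_derivative l * deriv f w) (at w)"
      using Df[OF w] by (rule DERIV_cmult)
    ultimately have "of_nat (Suc k) * w ^ k * f (nome * w) + w ^ Suc k * (deriv f (nome * w) * nome) = l * deriv f w"
      by (rule DERIV_unique)
    then have "w * (of_nat (Suc k) * w ^ k * f (nome * w) + w ^ Suc k * (deriv f (nome * w) * nome)) = w * (l * deriv f w)"
      by simp
    moreover have "w ^ Suc k * f (nome * w) * h (nome * w) = w * (w ^ Suc k * (deriv f (nome * w) * nome))"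
      using nz[of "nome * w"] w by (simp add: h_def)
    moreover have "l * f w * h w = w * (l * deriv f w)"
      using nz[OF w] by (simp add: h_def)
    ultimately have "(w ^ Suc k * f (nome * w)) * (of_nat (Suc k) + h (nome * w)) = (l * f w) * h w"
      by (simp only: ring_distribs power_Suc mult_ac)
    moreover have "l * f w \<noteq> 0" using feq[OF w, symmetric] nz[of "nome * w"] w by simp
    ultimately have "of_nat (Suc k) + h (nome * w) = h w"
      unfolding feq[OF w] by (simp only: mult_cancel_left) auto
    then show ?thesis by (simp add: algebra_simps)
  qed
  have Dh: "(h has_field_derivative deriv h w) (at w)" if "w \<noteq> 0" for w
    using that by (intro holomorphic_derivI[OF holh]) auto
  have dheq: "nome * deriv h (nome * w) = deriv h w" if w: "w \<noteq> 0" for w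
  proof -
    have "((\<lambda>w. h (nome * w)) has_field_derivative deriv h (nome * w) * nome) (at w)"
      by (rule DERIV_chain'[OF _ Dh]) (use w in \<open>auto intro!: derivative_eq_intros\<close>)
    then have "((\<lambda>w. h w - of_nat (Suc k)) has_field_derivative deriv h (nome * w) * nome) (at w)"
      by (rule has_field_derivative_transform_within_open[of _ _ _ "- {0}"]) (use heq w in auto)
    moreover have "((\<lambda>w. h w - of_nat (Suc k)) has_field_derivative deriv h w) (at w)"
      using Dh[OF w] by (auto intro!: derivative_eq_intros)
    ultimately show ?thesis using DERIV_unique by (metis mult.commute)
  qed
  have "(\<lambda>w. w * deriv h w) \<in> qfun 0 1"
    unfolding qfun_def using dheq by (auto intro!: holomorphic_intros holh simp: mult_ac)
  then obtain c n where c: "\<And>w. w \<noteq> 0 \<Longrightarrow> w * deriv h w = c * w powi n" "c = 0 \<or> 1 = nome powi n"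
    using qfun_0_monomial by blast
  then have c': "w * deriv h w = c" if "w \<noteq> 0" for w
    using c(1)[OF that] c(2) nome_power_int_eq_1_iff[of n] by auto
  have "((\<lambda>z. h (exp z) - c * z) has_field_derivative 0) (at z within UNIV)" for z
  proof -
    have "((\<lambda>z. h (exp z)) has_field_derivative deriv h (exp z) * exp z) (at z)"
      by (rule DERIV_chain'[OF DERIV_exp Dh]) simp
    moreover have "deriv h (exp z) * exp z = c" using c'[of "exp z"] by (simp add: mult.commute)
    ultimately show ?thesis by (auto intro!: derivative_eq_intros)
  qed
  then obtain d where d: "\<And>z. h (exp z) - c * z = d"
    using has_field_derivative_zero_constant[of UNIV "\<lambda>z. h (exp z) - c * z"] by auto
  have "h (exp (2 * of_real pi * \<i>)) - c * (2 * of_real pi * \<i>) = h (exp 0) - c * 0"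
    by (simp only: d)
  then have "c = 0" by simp
  then have "h (exp (of_real (- 2 * pi))) = h (exp 0)"
    using d by (metis mult_zero_left diff_zero)
  then have "h nome = h 1" unfolding nome_def exp_of_real by simp
  then have "of_nat (Suc k) = (0 :: complex)" using heq[of 1] by (simp del: of_nat_Suc)
  then show False by (simp only: of_nat_eq_0_iff)
qed

section \<open>Theta products\<close>

lemma eventually_prod_nonzero:
  fixes f :: "'i \<Rightarrow> 'a \<Rightarrow> 'b::idom"
  assumes "finite I" "\<And>i. i \<in> I \<Longrightarrow> \<forall>\<^sub>F w in F. f i w \<noteq> 0"
  shows "\<forall>\<^sub>F w in F. (\<Prod>i\<in>I. f i w) \<noteq> 0"
proof -
  have "\<forall>\<^sub>F w in F. \<forall>i\<in>I. f i w \<noteq> 0"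
    using assms by (intro eventually_ball_finite) auto
  then show ?thesis by eventually_elim (use assms(1) in auto)
qed

lemma holomorphic_mult_cancel:
  assumes S: "open S" and fgh: "f holomorphic_on S" "g holomorphic_on S"
    and "w \<in> S" and nz: "\<forall>\<^sub>F z in at w. k z \<noteq> 0"
    and eq: "\<And>z. z \<in> S \<Longrightarrow> k z * f z = k z * g z"
  shows "f w = g (w :: complex)"
proof (rule isCont_eq_if_eventually_eq[of w f g])
  have "\<forall>\<^sub>F z in at w. z \<in> S"
    using S \<open>w \<in> S\<close> by (simp add: eventually_at_in_open')
  with nz show "\<forall>\<^sub>F z in at w. f z = g z"
    by eventually_elim (use eq in auto)
qed (use assms holomorphic_isCont in auto)

text \<open>A product of functions with prescribed zeros determines its factors up to the relation \<open>R\<close>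
  of having proportional factors: a zero of one product has to be a zero of a factor of the other one,
  and this pair of factors cancels.\<close>

lemma product_factors_match:
  fixes \<Phi> :: "'p \<Rightarrow> complex \<Rightarrow> complex"
  assumes S: "open S"
    and hol: "\<And>p. p \<in> D \<Longrightarrow> \<Phi> p holomorphic_on S"
    and nz: "\<And>p w. p \<in> D \<Longrightarrow> w \<in> S \<Longrightarrow> \<forall>\<^sub>F z in at w. \<Phi> p z \<noteq> 0"
    and zero: "\<And>p. p \<in> D \<Longrightarrow> z p \<in> S \<and> \<Phi> p (z p) = 0"
    and rel: "\<And>p p'. p \<in> D \<Longrightarrow> p' \<in> D \<Longrightarrow> \<Phi> p' (z p) = 0 \<Longrightarrow>
      R p p' \<and> (\<exists>u. u holomorphic_on S \<and> (\<forall>w\<in>S. u w \<noteq> 0 \<and> \<Phi> p w = u w * \<Phi> p' w))"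
    and "finite I" "finite I'" "card I = card I'"
    and "\<And>i. i \<in> I \<Longrightarrow> p i \<in> D" "\<And>i. i \<in> I' \<Longrightarrow> p' i \<in> D"
    and "u holomorphic_on S" "\<And>w. w \<in> S \<Longrightarrow> u w \<noteq> 0"
    and "\<And>w. w \<in> S \<Longrightarrow> (\<Prod>i\<in>I. \<Phi> (p i) w) = u w * (\<Prod>i\<in>I'. \<Phi> (p' i) w)"
  shows "\<exists>\<sigma>. bij_betw \<sigma> I I' \<and> (\<forall>i\<in>I. R (p i) (p' (\<sigma> i)))"
  using assms(6-)
\<comment> \<open>Each cancelled pair leaves behind the unit by which its two factors differ, so the
  unit \<open>u\<close> has to vary in the induction.\<close>
proof (induction I arbitrary: I' u rule: finite_induct)
  case empty
  then have "I' = {}" by simp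
  then show ?case by (auto simp: bij_betw_def)
next
  case (insert i I)
  have pi: "p i \<in> D" and zi: "z (p i) \<in> S" "\<Phi> (p i) (z (p i)) = 0"
    using insert.prems zero by auto
  have "(\<Prod>j\<in>I'. \<Phi> (p' j) (z (p i))) = 0"
    using insert.prems(7)[OF zi(1)] insert.prems(6)[OF zi(1)] insert.hyps zi(2) by simp
  then obtain j where j: "j \<in> I'" "\<Phi> (p' j) (z (p i)) = 0"
    using insert.prems(1) by auto
  then obtain v where R: "R (p i) (p' j)" and v: "v holomorphic_on S" "\<And>w. w \<in> S \<Longrightarrow> v w \<noteq> 0"
    "\<And>w. w \<in> S \<Longrightarrow> \<Phi> (p i) w = v w * \<Phi> (p' j) w"
    using rel[OF pi, of "p' j"] insert.prems(4) by blast
  have eq: "(\<Prod>i\<in>I. \<Phi> (p i) w) = u w / v w * (\<Prod>k\<in>I' - {j}. \<Phi> (p' k) w)" if w: "w \<in> S" for w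
  proof (rule holomorphic_mult_cancel[where f = "\<lambda>w. (\<Prod>i\<in>I. \<Phi> (p i) w)"
        and g = "\<lambda>w. u w / v w * (\<Prod>k\<in>I' - {j}. \<Phi> (p' k) w)" and k = "\<lambda>w. v w * \<Phi> (p' j) w", OF S _ _ w])
    show "(\<lambda>w. (\<Prod>i\<in>I. \<Phi> (p i) w)) holomorphic_on S"
      using insert.prems(3) by (intro holomorphic_intros hol) auto
    show "(\<lambda>w. u w / v w * (\<Prod>k\<in>I' - {j}. \<Phi> (p' k) w)) holomorphic_on S"
      using insert.prems(4,5) v by (intro holomorphic_intros hol insert.prems) auto
    have "\<forall>\<^sub>F z in at w. z \<in> S"
      using S w by (simp add: eventually_at_in_open')
    moreover have "\<forall>\<^sub>F z in at w. \<Phi> (p' j) z \<noteq> 0"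
      using nz j insert.prems(4) w by blast
    ultimately show "\<forall>\<^sub>F z in at w. v z * \<Phi> (p' j) z \<noteq> 0"
      by eventually_elim (use v in auto)
  next
    fix x assume x: "x \<in> S"
    have "v x * \<Phi> (p' j) x * (\<Prod>i\<in>I. \<Phi> (p i) x) = u x * (\<Phi> (p' j) x * (\<Prod>k\<in>I' - {j}. \<Phi> (p' k) x))"
      using insert.prems(7)[OF x] insert.hyps v(3)[OF x] prod.remove[OF insert.prems(1) j(1), of "\<lambda>k. \<Phi> (p' k) x"]
      by simp
    then show "v x * \<Phi> (p' j) x * (\<Prod>i\<in>I. \<Phi> (p i) x)
        = v x * \<Phi> (p' j) x * (u x / v x * (\<Prod>k\<in>I' - {j}. \<Phi> (p' k) x))"
      using v(2)[OF x] by simp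
  qed
  have "\<exists>\<sigma>. bij_betw \<sigma> I (I' - {j}) \<and> (\<forall>i\<in>I. R (p i) (p' (\<sigma> i)))"
  proof (rule insert.IH[of "I' - {j}" "\<lambda>w. u w / v w"])
    show "(\<lambda>w. u w / v w) holomorphic_on S"
      using insert.prems(4,5) v by (intro holomorphic_intros insert.prems) auto
    show "card I = card (I' - {j})"
      using insert.prems(1,2) insert.hyps j by simp
  qed (use insert.prems(1,3,4,5,6) v eq in auto)
  then obtain \<sigma> where \<sigma>: "bij_betw \<sigma> I (I' - {j})" "\<And>k. k \<in> I \<Longrightarrow> R (p k) (p' (\<sigma> k))" by blast
  have "bij_betw (\<sigma>(i := j)) (insert i I) (insert j (I' - {j}))"
  proof (rule bij_betw_combine[of _ I _ "{i}" "{j}", unfolded Un_insert_right Un_empty_right])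
    show "bij_betw (\<sigma>(i := j)) I (I' - {j})"
      using \<sigma>(1) insert.hyps(2) by (subst bij_betw_cong[of _ _ \<sigma>]) auto
  qed (auto simp: bij_betw_def)
  then show ?case
    using \<sigma>(2) R j(1) insert.hyps(2) by (intro exI[of _ "\<sigma>(i := j)"]) (auto simp: insert_absorb fun_upd_def)
qed

lemma theta_divide_nome_power:
  obtains c where "c \<noteq> 0"
    "\<And>w a. w \<noteq> 0 \<Longrightarrow> a \<noteq> 0 \<Longrightarrow> theta (w / (nome powi n * a)) = c * (w / a) powi n * theta (w / a)"
proof -
  obtain c where c: "c \<noteq> 0" "\<And>w. w \<noteq> 0 \<Longrightarrow> theta (nome powi (- n) * w) = c * w powi n * theta w"
    using theta_nome_power_mult[of "- n"] by (metis minus_minus)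
  have "theta (w / (nome powi n * a)) = c * (w / a) powi n * theta (w / a)" if "w \<noteq> 0" "a \<noteq> 0" for w a
    using c(2)[of "w / a"] that by (simp add: power_int_minus field_simps)
  then show thesis using c(1) that by blast
qed

text \<open>Moving the zeros by powers of the nome costs a monomial in \<open>w\<close> whose
  exponent is the total shift. A change of lifts is therefore harmless projectively when the shifts
  add up to 0.\<close>

lemma prod_theta_divide_nome_power:
  assumes "finite I" "\<And>i. i \<in> I \<Longrightarrow> a i \<noteq> 0"
  obtains c where "c \<noteq> 0" "\<And>w. w \<noteq> 0 \<Longrightarrow>
    (\<Prod>i\<in>I. theta (w / (nome powi (n i) * a i))) = c * w powi (\<Sum>i\<in>I. n i) * (\<Prod>i\<in>I. theta (w / a i))"
proof -
  have "\<exists>c. c \<noteq> 0 \<and> (\<forall>w. w \<noteq> 0 \<longrightarrow>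
    (\<Prod>i\<in>I. theta (w / (nome powi (n i) * a i))) = c * w powi (\<Sum>i\<in>I. n i) * (\<Prod>i\<in>I. theta (w / a i)))"
    using assms
  proof (induction I rule: finite_induct)
    case (insert i I)
    then obtain c where c: "c \<noteq> 0" "\<And>w. w \<noteq> 0 \<Longrightarrow>
      (\<Prod>i\<in>I. theta (w / (nome powi (n i) * a i))) = c * w powi (\<Sum>i\<in>I. n i) * (\<Prod>i\<in>I. theta (w / a i))"
      by auto
    obtain d where d: "d \<noteq> 0" "\<And>w a. w \<noteq> 0 \<Longrightarrow> a \<noteq> 0 \<Longrightarrow>
        theta (w / (nome powi (n i) * a)) = d * (w / a) powi (n i) * theta (w / a)"
      using theta_divide_nome_power[of "n i"] by blast
    have "a i \<noteq> 0" using insert.prems by simp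
    then show ?case
      using c d insert.hyps
      by (intro exI[of _ "c * d / a i powi (n i)"]) (simp add: power_int_add power_int_divide_distrib)
  qed (auto intro: exI[of _ 1])
  then show thesis using that by blast
qed

lemma prod_theta_eq_imp_permuted:
  assumes "finite I" "\<And>i. i \<in> I \<Longrightarrow> a i \<noteq> 0" "\<And>i. i \<in> I \<Longrightarrow> b i \<noteq> 0" "c \<noteq> 0"
    and "\<And>w. w \<noteq> 0 \<Longrightarrow> (\<Prod>i\<in>I. theta (w / a i)) = c * (\<Prod>i\<in>I. theta (w / b i))"
  shows "\<exists>\<sigma>. \<sigma> permutes I \<and> (\<forall>i\<in>I. \<exists>n. a i = nome powi n * b (\<sigma> i))"
proof -
  have "\<exists>\<sigma>. bij_betw \<sigma> I I \<and> (\<forall>i\<in>I. \<exists>n. a i = nome powi n * b (\<sigma> i))"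
  proof (rule product_factors_match[of "- {0}" "- {0}" "\<lambda>a w. theta (w / a)" "\<lambda>a. a"
        "\<lambda>a b. \<exists>n. a = nome powi n * b" I I a b "\<lambda>w. c"])
    fix a :: complex assume "a \<in> - {0}"
    then show "(\<lambda>w. theta (w / a)) holomorphic_on - {0}"
      by (intro holomorphic_intros) auto
  next
    fix a w :: complex assume "a \<in> - {0}" "w \<in> - {0}"
    then show "\<forall>\<^sub>F z in at w. theta (z / a) \<noteq> 0"
      by (simp add: eventually_theta_nonzero)
  next
    fix a b :: complex assume a: "a \<in> - {0}" and b: "b \<in> - {0}" and "theta (a / b) = 0"
    then obtain n where "a / b = nome powi n" using theta_eq_0_iff[of "a / b"] by auto
    then have n: "a = nome powi n * b" using b by (auto simp: field_simps)
    obtain c where "c \<noteq> 0" "\<And>w a. w \<noteq> 0 \<Longrightarrow> a \<noteq> 0 \<Longrightarrow> theta (w / (nome powi n * a)) = c * (w / a) powi n * theta (w / a)"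
      using theta_divide_nome_power[of n] by blast
    moreover have "(\<lambda>w. c * (w / b) powi n) holomorphic_on - {0}"
      using b by (intro holomorphic_intros) auto
    ultimately show "(\<exists>n. a = nome powi n * b) \<and>
       (\<exists>u. u holomorphic_on - {0} \<and> (\<forall>w\<in>- {0}. u w \<noteq> 0 \<and> theta (w / a) = u w * theta (w / b)))"
      using n b by (intro conjI exI[of _ n] exI[of _ "\<lambda>w. c * (w / b) powi n"]) auto
  qed (use assms in auto)
  then obtain \<sigma> where \<sigma>: "bij_betw \<sigma> I I" "\<forall>i\<in>I. \<exists>n. a i = nome powi n * b (\<sigma> i)" by blast
  then have "restrict_id \<sigma> I permutes I" by (simp add: permutes_restrict_id)
  then show ?thesis using \<sigma>(2) by (intro exI[of _ "restrict_id \<sigma> I"]) auto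
qed

text \<open>Zeros are split off one at a time until degree 0 is reached, where a monomial remains.
  The relation between \<open>l\<close> and the product of the \<open>a i\<close> is Abel's theorem:
  the multiplier determines the sum of the divisor on the curve. The point \<open>w0\<close>
  excludes the zero function.\<close>

lemma qfun_eq_prod_theta:
  assumes "finite I" "f \<in> qfun (card I) l" "l \<noteq> 0" "w0 \<noteq> 0" "f w0 \<noteq> 0"
  shows "\<exists>a c n. c \<noteq> 0 \<and> (\<forall>i\<in>I. a i \<noteq> 0) \<and> l = (-1) ^ card I * (\<Prod>i\<in>I. a i) * nome powi n \<and>
    (\<forall>w. w \<noteq> 0 \<longrightarrow> f w = c * w powi n * (\<Prod>i\<in>I. theta (w / a i)))"
  using assms
proof (induction I arbitrary: f l rule: finite_induct)
  case empty
  then obtain c n where cn: "\<And>w. w \<noteq> 0 \<Longrightarrow> f w = c * w powi n" "c = 0 \<or> l = nome powi n"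
    using qfun_0_monomial[of f l] by auto
  moreover from cn have "c \<noteq> 0" using empty by auto
  ultimately show ?case by (intro exI[of _ "\<lambda>_. 1"] exI[of _ c] exI[of _ n]) auto
next
  case (insert i I)
  then have f: "f \<in> qfun (Suc (card I)) l" by simp
  then obtain b where b: "b \<noteq> 0" "f b = 0" using qfun_has_zero by blast
  obtain g where g: "g \<in> qfun (card I) (- l / b)" "\<And>w. w \<noteq> 0 \<Longrightarrow> f w = theta (w / b) * g w"
    using qfun_divide_theta[OF f insert.prems(2) b] by blast
  have "g w0 \<noteq> 0" "- l / b \<noteq> 0" using g(2)[of w0] insert.prems b by auto
  from insert.IH[OF g(1) this(2) insert.prems(3) this(1)]
  obtain a c n where *: "c \<noteq> 0" "\<And>i. i \<in> I \<Longrightarrow> a i \<noteq> 0" "- l / b = (-1) ^ card I * (\<Prod>i\<in>I. a i) * nome powi n"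
    "\<And>w. w \<noteq> 0 \<Longrightarrow> g w = c * w powi n * (\<Prod>i\<in>I. theta (w / a i))" by blast
  have p: "(\<Prod>j\<in>I. F ((a(i := b)) j)) = (\<Prod>j\<in>I. F (a j))" for F :: "complex \<Rightarrow> complex"
    using insert.hyps by (intro prod.cong) auto
  have "l = - b * (- l / b)" using b by simp
  then have "l = (-1) ^ card (insert i I) * (\<Prod>j\<in>insert i I. (a(i := b)) j) * nome powi n"
    using insert.hyps p[of "\<lambda>x. x"] unfolding *(3) by simp
  moreover have "f w = c * w powi n * (\<Prod>j\<in>insert i I. theta (w / (a(i := b)) j))" if "w \<noteq> 0" for w
    using insert.hyps p[of "\<lambda>x. theta (w / x)"] g(2)[OF that] *(4)[OF that] by simp
  ultimately show ?case
    using * b by (intro exI[of _ "a(i := b)"] exI[of _ c] exI[of _ n]) auto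
qed

lemma qfun_divide_prod_theta:
  assumes "finite I" "f \<in> qfun (card I) l" "l \<noteq> 0"
    and "\<And>i. i \<in> I \<Longrightarrow> b i \<noteq> 0" "\<And>i. i \<in> I \<Longrightarrow> f (b i) = 0"
    and "\<And>i j. i \<in> I \<Longrightarrow> j \<in> I \<Longrightarrow> i \<noteq> j \<Longrightarrow> theta (b i / b j) \<noteq> 0"
  shows "\<exists>g\<in>qfun 0 ((-1) ^ card I * l / (\<Prod>i\<in>I. b i)). \<forall>w. w \<noteq> 0 \<longrightarrow> f w = (\<Prod>i\<in>I. theta (w / b i)) * g w"
  using assms
proof (induction I arbitrary: f l rule: finite_induct)
  case empty
  then show ?case by auto
next
  case (insert i I)
  have f: "f \<in> qfun (Suc (card I)) l" using insert by simp
  obtain g where g: "g \<in> qfun (card I) (- l / b i)" "\<And>w. w \<noteq> 0 \<Longrightarrow> f w = theta (w / b i) * g w"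
    using qfun_divide_theta[OF f insert.prems(2), of "b i"] insert.prems by blast
  have "g (b j) = 0" if "j \<in> I" for j
  proof -
    have "theta (b j / b i) \<noteq> 0" using that insert.hyps insert.prems(5) by (metis insertCI)
    then show ?thesis using g(2)[of "b j"] insert.prems(3,4)[of j] that by auto
  qed
  then obtain h where "h \<in> qfun 0 ((-1) ^ card I * (- l / b i) / (\<Prod>i\<in>I. b i))"
    "\<And>w. w \<noteq> 0 \<Longrightarrow> g w = (\<Prod>i\<in>I. theta (w / b i)) * h w"
    using insert.IH[OF g(1)] insert.prems by auto
  then show ?case
    using g(2) insert.hyps by (intro bexI[of _ h]) (auto simp: field_simps)
qed

text \<open>The prescribed zeros already exhaust the degree, so the cofactor has degree 0 and
  multiplier 1 over the product of the \<open>b i\<close>. A nonzero cofactor would make that a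
  power of the nome, which \<open>bp\<close> forbids: the divisor fails Abel's condition.\<close>

lemma qfun_eq_0:
  assumes I: "finite I" and f: "f \<in> qfun (card I) ((-1) ^ card I)"
    and b: "\<And>i. i \<in> I \<Longrightarrow> b i \<noteq> 0" "\<And>i. i \<in> I \<Longrightarrow> f (b i) = 0"
    "\<And>i j. i \<in> I \<Longrightarrow> j \<in> I \<Longrightarrow> i \<noteq> j \<Longrightarrow> theta (b i / b j) \<noteq> 0"
    and bp: "theta (\<Prod>i\<in>I. b i) \<noteq> 0" and w: "w \<noteq> 0"
  shows "f w = 0"
proof -
  obtain g where g: "g \<in> qfun 0 ((-1) ^ card I * (-1) ^ card I / (\<Prod>i\<in>I. b i))"
      "\<And>w. w \<noteq> 0 \<Longrightarrow> f w = (\<Prod>i\<in>I. theta (w / b i)) * g w"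
    using qfun_divide_prod_theta[OF I f _ b] by force
  have p0: "(\<Prod>i\<in>I. b i) \<noteq> 0" using I b by simp
  have "(\<Prod>i\<in>I. b i) \<noteq> nome powi (- n)" for n
    using bp p0 theta_eq_0_iff by blast
  then have "1 / (\<Prod>i\<in>I. b i) \<noteq> nome powi n" for n
    using p0 by (metis div_by_1 divide_divide_eq_right mult_1 nome_nonzero power_int_minus inverse_eq_divide)
  moreover have "(-1) ^ card I * (-1) ^ card I / (\<Prod>i\<in>I. b i) = 1 / (\<Prod>i\<in>I. b i)"
    by (simp add: power_mult_distrib[symmetric])
  ultimately obtain c n where "\<And>w. w \<noteq> 0 \<Longrightarrow> g w = c * w powi n" "c = 0"
    using qfun_0_monomial[OF g(1)] by metis
  then show ?thesis using g(2)[OF w] w by simp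
qed

lemma prod_theta_qfun:
  "finite I \<Longrightarrow> (\<And>i. i \<in> I \<Longrightarrow> a i \<noteq> 0) \<Longrightarrow>
    (\<lambda>w. \<Prod>i\<in>I. theta (w / a i)) \<in> qfun (card I) ((-1) ^ card I * (\<Prod>i\<in>I. a i))"
  using qfun_prod[of I "\<lambda>i w. theta (w / a i)" 1 "\<lambda>i. - a i"] theta_qfun
  by (simp add: prod_uminus)

section \<open>Even quasiperiodic functions\<close>

text \<open>Up to a constant factor this is the numerator of the difference of the Weierstrass
  function at \<open>w\<close> and at \<open>a\<close>, over the denominator \<open>theta w\<close>
  squared.\<close>

definition theta_sym :: "complex \<Rightarrow> complex \<Rightarrow> complex" where
  "theta_sym a w = theta (w / a) * theta (w * a)"

text \<open>Even means that \<open>w powi (- m) * f w\<close> is invariant under inversion of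
  \<open>w\<close>. The weight is there because \<open>theta\<close> itself picks up a monomial
  under inversion.\<close>

definition even_qfun :: "nat \<Rightarrow> (complex \<Rightarrow> complex) set" where
  "even_qfun m = {f \<in> qfun (2 * m) 1. \<forall>w. w \<noteq> 0 \<longrightarrow> w ^ (2 * m) * f (1 / w) = f w}"

lemma even_qfunD:
  assumes "f \<in> even_qfun m"
  shows "f \<in> qfun (2 * m) 1" "w \<noteq> 0 \<Longrightarrow> w ^ (2 * m) * f (1 / w) = f w"
  using assms by (auto simp: even_qfun_def)

lemma even_qfun_mult:
  assumes f: "f \<in> even_qfun m" and g: "g \<in> even_qfun n"
  shows "(\<lambda>w. f w * g w) \<in> even_qfun (m + n)"
  unfolding even_qfun_def
proof (intro CollectI conjI allI impI)
  show "(\<lambda>w. f w * g w) \<in> qfun (2 * (m + n)) 1"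
    using qfun_mult[OF even_qfunD(1)[OF f] even_qfunD(1)[OF g]] by (simp add: distrib_left)
  fix w :: complex assume w: "w \<noteq> 0"
  have "w ^ (2 * (m + n)) = w ^ (2 * m) * w ^ (2 * n)"
    by (simp add: power_add distrib_left)
  then have "w ^ (2 * (m + n)) * (f (1 / w) * g (1 / w)) = (w ^ (2 * m) * f (1 / w)) * (w ^ (2 * n) * g (1 / w))"
    by (simp add: mult_ac)
  then show "w ^ (2 * (m + n)) * (f (1 / w) * g (1 / w)) = f w * g w"
    using even_qfunD(2)[OF f w] even_qfunD(2)[OF g w] by simp
qed

lemma even_qfun_const: "(\<lambda>w. c) \<in> even_qfun 0"
  by (simp add: even_qfun_def qfun_const)

lemma even_qfun_cmult: "f \<in> even_qfun m \<Longrightarrow> (\<lambda>w. c * f w) \<in> even_qfun m"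
  using even_qfun_mult[OF even_qfun_const] by fastforce

lemma even_qfun_sum:
  "(\<And>i. i \<in> I \<Longrightarrow> f i \<in> even_qfun m) \<Longrightarrow> (\<lambda>w. \<Sum>i\<in>I. f i w) \<in> even_qfun m"
  unfolding even_qfun_def by (auto intro: qfun_sum simp: sum_distrib_left)

lemma even_qfun_diff:
  "f \<in> even_qfun m \<Longrightarrow> g \<in> even_qfun m \<Longrightarrow> (\<lambda>w. f w - g w) \<in> even_qfun m"
  unfolding even_qfun_def by (auto intro: qfun_diff simp: right_diff_distrib)

lemma even_qfun_prod:
  "finite I \<Longrightarrow> (\<And>i. i \<in> I \<Longrightarrow> f i \<in> even_qfun m) \<Longrightarrow> (\<lambda>w. \<Prod>i\<in>I. f i w) \<in> even_qfun (m * card I)"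
  by (induction I rule: finite_induct) (auto intro: even_qfun_mult simp: even_qfun_const)

lemma theta_sym_even_qfun:
  assumes a: "a \<noteq> 0"
  shows "theta_sym a \<in> even_qfun 1"
proof -
  have "(\<lambda>w. theta (w / a) * theta (w / (1 / a))) \<in> qfun (1 + 1) (- a * - (1 / a))"
    using a by (intro qfun_mult theta_qfun) auto
  moreover have "w\<^sup>2 * theta_sym a (1 / w) = theta_sym a w" if w: "w \<noteq> 0" for w
  proof -
    have "(w * a) * theta (1 / (w * a)) = - theta (w * a)"
      using theta_inverse[of "w * a"] theta_nome_mult[of "w * a"] w a by simp
    moreover have "(w / a) * theta (1 / (w / a)) = - theta (w / a)"
      using theta_inverse[of "w / a"] theta_nome_mult[of "w / a"] w a by simp
    moreover have "w\<^sup>2 * theta_sym a (1 / w) = ((w * a) * theta (1 / (w * a))) * ((w / a) * theta (1 / (w / a)))"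
      using a by (simp add: theta_sym_def power2_eq_square)
    ultimately show ?thesis by (simp add: theta_sym_def)
  qed
  ultimately show ?thesis
    using a by (simp add: even_qfun_def theta_sym_def[abs_def] numeral_2_eq_2)
qed

lemma holomorphic_theta_sym: "a \<noteq> 0 \<Longrightarrow> theta_sym a holomorphic_on - {0}"
  using theta_sym_even_qfun even_qfunD(1) qfunD(1) by blast

lemma eventually_theta_sym_nonzero:
  assumes "a \<noteq> 0" "w \<noteq> 0"
  shows "\<forall>\<^sub>F z in at w. theta_sym a z \<noteq> 0"
proof -
  have "\<forall>\<^sub>F z in at w. theta (z / (1 / a)) \<noteq> 0"
    using assms by (intro eventually_theta_nonzero) auto
  with eventually_theta_nonzero[OF assms] show ?thesis
    by eventually_elim (simp add: theta_sym_def)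
qed

lemma theta_sym_self [simp]: "a \<noteq> 0 \<Longrightarrow> theta_sym a a = 0"
  by (simp add: theta_sym_def)

lemma theta_sym_inverse: "theta_sym (1 / a) = theta_sym a"
  by (simp add: theta_sym_def[abs_def] mult.commute)

text \<open>The monomials from the two theta factors are inverse powers of \<open>w\<close>, so only
  a constant survives. Hence the points of a symplectic configuration may be moved by powers of the
  nome independently of each other.\<close>

lemma theta_sym_nome_mult:
  obtains c where "c \<noteq> 0" "\<And>w. w \<noteq> 0 \<Longrightarrow> theta_sym (nome powi n * a) w = c * theta_sym a w"
proof (cases "a = 0")
  case False
  obtain c where c: "c \<noteq> 0" "\<And>w a. w \<noteq> 0 \<Longrightarrow> a \<noteq> 0 \<Longrightarrow>
      theta (w / (nome powi n * a)) = c * (w / a) powi n * theta (w / a)"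
    using theta_divide_nome_power[of n] by blast
  obtain d where d: "d \<noteq> 0" "\<And>w. w \<noteq> 0 \<Longrightarrow> theta (nome powi n * w) = d * w powi (- n) * theta w"
    using theta_nome_power_mult[of n] by blast
  have "theta_sym (nome powi n * a) w = c * d / (a powi n * a powi n) * theta_sym a w" if w: "w \<noteq> 0" for w
  proof -
    have "theta_sym (nome powi n * a) w = theta (w / (nome powi n * a)) * theta (nome powi n * (w * a))"
      by (simp add: theta_sym_def mult_ac)
    also have "\<dots> = c * (w / a) powi n * theta (w / a) * (d * (w * a) powi (- n) * theta (w * a))"
      using c(2)[OF w False] d(2)[of "w * a"] w False by simp
    also have "\<dots> = c * d * ((w / a) powi n * (w * a) powi (- n)) * theta_sym a w"
      by (simp add: theta_sym_def mult_ac)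
    also have "(w / a) powi n * (w * a) powi (- n) = 1 / (a powi n * a powi n)"
      using w False by (simp add: power_int_mult_distrib power_int_divide_distrib power_int_minus field_simps)
    finally show ?thesis by simp
  qed
  then show thesis using that c d False by (metis divide_eq_0_iff mult_eq_0_iff power_int_eq_0_iff)
next
  case True
  then show thesis using that[of 1] by simp
qed

lemma theta_sym_eq_0D:
  assumes "a \<noteq> 0" "b \<noteq> 0" "theta_sym b a = 0"
  shows "\<exists>n. a = nome powi n * b \<or> a = nome powi n * (1 / b)"
proof -
  consider "theta (a / b) = 0" | "theta (a * b) = 0" using assms by (auto simp: theta_sym_def)
  then show ?thesis
  proof cases
    case 1
    then obtain n where "a / b = nome powi n" using theta_eq_0_iff[of "a / b"] assms by auto
    then show ?thesis using assms by (auto intro!: exI[of _ n] simp: field_simps)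
  next
    case 2
    then obtain n where "a * b = nome powi n" using theta_eq_0_iff[of "a * b"] assms by auto
    then show ?thesis using assms by (auto intro!: exI[of _ n] simp: field_simps)
  qed
qed

lemma prod_theta_sym_eq_imp_permuted:
  assumes "finite I" "\<And>i. i \<in> I \<Longrightarrow> a i \<noteq> 0" "\<And>i. i \<in> I \<Longrightarrow> b i \<noteq> 0" "c \<noteq> 0"
    and "\<And>w. w \<noteq> 0 \<Longrightarrow> (\<Prod>i\<in>I. theta_sym (a i) w) = c * (\<Prod>i\<in>I. theta_sym (b i) w)"
  shows "\<exists>\<sigma>. \<sigma> permutes I \<and>
    (\<forall>i\<in>I. \<exists>n. a i = nome powi n * b (\<sigma> i) \<or> a i = nome powi n * (1 / b (\<sigma> i)))"
proof -
  have "\<exists>\<sigma>. bij_betw \<sigma> I I \<and> (\<forall>i\<in>I. \<exists>n. a i = nome powi n * b (\<sigma> i) \<or> a i = nome powi n * (1 / b (\<sigma> i)))"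
  proof (rule product_factors_match[of "- {0}" "- {0}" theta_sym "\<lambda>a. a"
        "\<lambda>a b. \<exists>n. a = nome powi n * b \<or> a = nome powi n * (1 / b)" I I a b "\<lambda>w. c"])
    fix a b :: complex assume a: "a \<in> - {0}" and b: "b \<in> - {0}" and "theta_sym b a = 0"
    then obtain n where n: "a = nome powi n * b \<or> a = nome powi n * (1 / b)"
      using theta_sym_eq_0D[of a b] by auto
    then have "\<exists>c. c \<noteq> 0 \<and> (\<forall>w. w \<noteq> 0 \<longrightarrow> theta_sym a w = c * theta_sym b w)"
      using theta_sym_nome_mult[of n b] theta_sym_nome_mult[of n "1 / b"] theta_sym_inverse[of b] by metis
    then obtain c where "c \<noteq> 0" "\<And>w. w \<noteq> 0 \<Longrightarrow> theta_sym a w = c * theta_sym b w" by blast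
    then show "(\<exists>n. a = nome powi n * b \<or> a = nome powi n * (1 / b)) \<and>
       (\<exists>u. u holomorphic_on - {0} \<and> (\<forall>w\<in>- {0}. u w \<noteq> 0 \<and> theta_sym a w = u w * theta_sym b w))"
      using n by (intro conjI exI[of _ n] exI[of _ "\<lambda>w. c"]) auto
  qed (use assms eventually_theta_sym_nonzero holomorphic_theta_sym in auto)
  then obtain \<sigma> where \<sigma>: "bij_betw \<sigma> I I"
    "\<forall>i\<in>I. \<exists>n. a i = nome powi n * b (\<sigma> i) \<or> a i = nome powi n * (1 / b (\<sigma> i))" by blast
  then have "restrict_id \<sigma> I permutes I" by (simp add: permutes_restrict_id)
  then show ?thesis using \<sigma>(2) by (intro exI[of _ "restrict_id \<sigma> I"]) auto
qed

text \<open>At a point \<open>a\<close> fixed by the involution \<open>w \<mapsto> 1 / (nome powi n * w)\<close>, whose derivative there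
  is \<open>-1\<close>, an even function has zeros of even order only: compare it with an even function \<open>G\<close> of the
  same degree that does not vanish at \<open>a\<close>.\<close>

lemma even_qfun_deriv_zero:
  assumes f: "f \<in> even_qfun m" and a: "a \<noteq> 0" "f a = 0" and n: "nome powi n * a\<^sup>2 = 1"
  shows "deriv f a = 0"
proof -
  \<comment> \<open>This choice keeps \<open>a\<close> off the zeros of \<open>theta_sym b\<close>:
    the quotient \<open>a / b\<close> is \<open>- \<i>\<close>, and \<open>a * b\<close> is \<i>
    times a power of the nome.\<close>
  define b where "b = \<i> * a"
  define G where "G w = theta_sym b w ^ m" for w
  have b: "b \<noteq> 0" using a by (simp add: b_def)
  have G: "G \<in> even_qfun m"
    using even_qfun_prod[of "{..<m}" "\<lambda>_. theta_sym b" 1] theta_sym_even_qfun[OF b]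
    by (simp add: G_def[abs_def])
  have "theta (a / b) \<noteq> 0"
    using a theta_nonzero_if_root_of_unity[of "- \<i>" 4] by (simp add: b_def complex_eq_iff)
  moreover have "theta (a * b) \<noteq> 0"
  proof -
    have "a * b = nome powi (- n) * \<i>"
      using n by (simp add: b_def power_int_minus field_simps power2_eq_square)
    moreover have "theta \<i> \<noteq> 0" using theta_nonzero_if_root_of_unity[of \<i> 4] by simp
    moreover obtain c where "c \<noteq> 0" "theta (nome powi (- n) * \<i>) = c * \<i> powi n * theta \<i>"
      using theta_nome_power_mult[of "- n"] by (metis complex_i_not_zero minus_minus)
    ultimately show ?thesis by simp
  qed
  ultimately have Ga: "G a \<noteq> 0" by (simp add: G_def theta_sym_def)
  define \<phi> where "\<phi> w = 1 / (nome powi n * w)" for w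
  obtain c where c: "\<And>f w. f \<in> qfun (2 * m) 1 \<Longrightarrow> w \<noteq> 0 \<Longrightarrow>
      f (nome powi n * w) = c * w powi (- (int (2 * m) * n)) * f w"
    using qfun_nome_power_mult[of 1 "2 * m" n] by (metis zero_neq_one)
  \<comment> \<open>The factor \<open>K\<close> is the same for all even functions of this degree,
    so it drops out when \<open>f\<close> is compared with \<open>G\<close>; its derivative never
    has to be computed.\<close>
  define K where "K w = c * w powi (- (int (2 * m) * n)) / (nome powi n * w) ^ (2 * m)" for w
  have K: "h (\<phi> w) = K w * h w" if h: "h \<in> even_qfun m" and w: "w \<noteq> 0" for h w
    using even_qfunD(2)[OF h, of "nome powi n * w"] c[OF even_qfunD(1)[OF h] w] w
    by (simp add: K_def \<phi>_def field_simps)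
  have cross: "f (\<phi> w) * G w = f w * G (\<phi> w)" if "w \<noteq> 0" for w
    using K[OF f that] K[OF G that] by simp
  have \<phi>a: "\<phi> a = a" using n a by (simp add: \<phi>_def power2_eq_square field_simps)
  have D\<phi>: "(\<phi> has_field_derivative - 1) (at a)"
  proof -
    have "(\<phi> has_field_derivative (- (nome powi n) / (nome powi n * a)\<^sup>2)) (at a)"
      unfolding \<phi>_def using a by (auto intro!: derivative_eq_intros simp: power2_eq_square)
    moreover have "- (nome powi n) / (nome powi n * a)\<^sup>2 = - 1"
      using n a by (simp add: power2_eq_square field_simps)
    ultimately show ?thesis by simp
  qed
  have Df: "(f has_field_derivative deriv f a) (at a)"
    using a by (intro holomorphic_derivI[OF qfunD(1)[OF even_qfunD(1)[OF f]]]) auto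
  have DG: "(G has_field_derivative deriv G a) (at a)"
    using a by (intro holomorphic_derivI[OF qfunD(1)[OF even_qfunD(1)[OF G]]]) auto
  have Df': "((\<lambda>w. f (\<phi> w)) has_field_derivative deriv f a * - 1) (at a)"
    by (rule DERIV_chain'[OF D\<phi>]) (simp add: \<phi>a Df)
  have DG': "((\<lambda>w. G (\<phi> w)) has_field_derivative deriv G a * - 1) (at a)"
    by (rule DERIV_chain'[OF D\<phi>]) (simp add: \<phi>a DG)
  have "((\<lambda>w. f (\<phi> w) * G w) has_field_derivative - (deriv f a * G a)) (at a)"
    using DERIV_mult[OF Df' DG] by (simp add: \<phi>a a mult_ac)
  then have "((\<lambda>w. f w * G (\<phi> w)) has_field_derivative - (deriv f a * G a)) (at a)"
    by (rule has_field_derivative_transform_within_open[of _ _ _ "- {0}"]) (use cross a in auto)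
  moreover have "((\<lambda>w. f w * G (\<phi> w)) has_field_derivative deriv f a * G a) (at a)"
    using DERIV_mult[OF Df DG'] by (simp add: \<phi>a a mult_ac)
  ultimately have "- (deriv f a * G a) = deriv f a * G a"
    by (rule DERIV_unique)
  then show ?thesis using Ga by simp
qed

text \<open>After division by \<open>theta (w / a)\<close> the quotient \<open>g1\<close> must still
  vanish at \<open>1 / a\<close>. If \<open>a\<close> and \<open>1 / a\<close> differ modulo the
  nome, evenness of \<open>f\<close> gives this. Otherwise \<open>a\<close> is a 2-torsion point,
  where the zero of \<open>f\<close> is at least double by \<open>even_qfun_deriv_zero\<close>, so
  \<open>g1\<close> vanishes at \<open>a\<close> and, by quasiperiodicity, at
  \<open>1 / a\<close>.\<close>

lemma even_qfun_divide_theta_sym: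
  assumes f: "f \<in> even_qfun (Suc m)" and a: "a \<noteq> 0" "f a = 0"
  obtains g where "g \<in> even_qfun m" "\<And>w. w \<noteq> 0 \<Longrightarrow> f w = theta_sym a w * g w"
proof -
  have fq: "f \<in> qfun (Suc (Suc (2 * m))) 1" using even_qfunD(1)[OF f] by simp
  obtain g1 where g1: "g1 \<in> qfun (Suc (2 * m)) (- 1 / a)" "\<And>w. w \<noteq> 0 \<Longrightarrow> f w = theta (w / a) * g1 w"
    using qfun_divide_theta[OF fq _ a] by auto
  have g1a: "g1 (1 / a) = 0"
  proof (cases "theta (1 / a / a) = 0")
    case False
    have "a ^ (2 * Suc m) * f (1 / a) = 0" using even_qfunD(2)[OF f a(1)] a by simp
    then show ?thesis using g1(2)[of "1 / a"] a False by simp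
  next
    case True
    then obtain n where n: "1 / a / a = nome powi n" using theta_eq_0_iff[of "1 / a / a"] a by auto
    then have "nome powi (- n) * (1 / a) = a" using a by (simp add: power_int_minus field_simps)
    have an: "nome powi n * a\<^sup>2 = 1" using n a by (simp add: field_simps power2_eq_square)
    have D: "deriv f a = 0" by (rule even_qfun_deriv_zero[OF f a an])
    have Dt: "(theta has_field_derivative deriv theta 1) (at 1)"
      by (intro holomorphic_derivI[of theta "- {0}"] holomorphic_on_theta[of "\<lambda>z. z"]) auto
    have Dt: "((\<lambda>w. theta (w / a)) has_field_derivative deriv theta 1 * (1 / a)) (at a)"
      by (rule DERIV_chain'[of "\<lambda>w. w / a" "1 / a"]) (use Dt a in \<open>auto intro!: derivative_eq_intros\<close>)
    have Dg: "(g1 has_field_derivative deriv g1 a) (at a)"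
      using a by (intro holomorphic_derivI[OF qfunD(1)[OF g1(1)]]) auto
    have "((\<lambda>w. theta (w / a) * g1 w) has_field_derivative deriv theta 1 * (1 / a) * g1 a) (at a)"
      using DERIV_mult[OF Dt Dg] a by simp
    then have "(f has_field_derivative deriv theta 1 * (1 / a) * g1 a) (at a)"
      by (rule has_field_derivative_transform_within_open[of _ _ _ "- {0}"]) (use g1 a in auto)
    \<comment> \<open>The product rule at the simple zero \<open>a\<close> of
      \<open>theta (w / a)\<close>: only the term with \<open>g1 a\<close> remains.\<close>
    then have "deriv theta 1 * (1 / a) * g1 a = 0" using D DERIV_imp_deriv by metis
    then have "g1 a = 0" using deriv_theta_nonzero[of 1] a by simp
    then have "g1 (nome powi n * a) = 0" using a by (intro qfun_zero_shift[OF g1(1)]) auto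
    then show ?thesis using a by (simp add: n[symmetric])
  qed
  obtain g where g: "g \<in> qfun (2 * m) (- (- 1 / a) / (1 / a))"
      "\<And>w. w \<noteq> 0 \<Longrightarrow> g1 w = theta (w / (1 / a)) * g w"
    using qfun_divide_theta[OF g1(1) _ _ g1a] a by auto
  have fg: "f w = theta_sym a w * g w" if "w \<noteq> 0" for w
    using g1(2)[OF that] g(2)[OF that] by (simp add: theta_sym_def)
  have gq: "g \<in> qfun (2 * m) 1" using g(1) a by simp
  have "w ^ (2 * m) * g (1 / w) = g w" if w: "w \<noteq> 0" for w
  proof (rule holomorphic_mult_cancel[where f = "\<lambda>w. w ^ (2 * m) * g (1 / w)" and g = g
        and S = "- {0}" and k = "theta_sym a"])
    show "(\<lambda>w. w ^ (2 * m) * g (1 / w)) holomorphic_on - {0}"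
      by (intro holomorphic_intros holomorphic_on_compose_gen[OF _ qfunD(1)[OF gq], unfolded o_def]) auto
    show "theta_sym a z * (z ^ (2 * m) * g (1 / z)) = theta_sym a z * g z" if "z \<in> - {0}" for z
    proof -
      have z: "z \<noteq> 0" using that by simp
      have "theta_sym a z * (z ^ (2 * m) * g (1 / z)) = z\<^sup>2 * theta_sym a (1 / z) * (z ^ (2 * m) * g (1 / z))"
        using even_qfunD(2)[OF theta_sym_even_qfun[OF a(1)] z] by simp
      also have "\<dots> = z ^ (2 * Suc m) * f (1 / z)"
        using z by (simp add: fg power_add power2_eq_square)
      also have "\<dots> = theta_sym a z * g z"
        using even_qfunD(2)[OF f z] fg[OF z] by simp
      finally show ?thesis .
    qed
  qed (use w a gq qfunD(1) eventually_theta_sym_nonzero in auto)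
  then show thesis
    using that[of g] gq fg by (simp add: even_qfun_def)
qed

lemma even_qfun_0_const:
  assumes "f \<in> even_qfun 0"
  obtains c where "\<And>w. w \<noteq> 0 \<Longrightarrow> f w = c"
proof -
  obtain c n where cn: "\<And>w. w \<noteq> 0 \<Longrightarrow> f w = c * w powi n" "c = 0 \<or> 1 = nome powi n"
    using qfun_0_monomial[of f 1] even_qfunD(1)[OF assms] by auto
  then have "c = 0 \<or> n = 0" using nome_power_int_eq_1_iff[of n] by auto
  then show thesis using that[of c] cn(1) by auto
qed

lemma even_qfun_eq_prod_theta_sym:
  assumes "finite I" "f \<in> even_qfun (card I)" "w0 \<noteq> 0" "f w0 \<noteq> 0"
  shows "\<exists>a c. c \<noteq> 0 \<and> (\<forall>i\<in>I. a i \<noteq> 0) \<and>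
    (\<forall>w. w \<noteq> 0 \<longrightarrow> f w = c * (\<Prod>i\<in>I. theta_sym (a i) w))"
  using assms
proof (induction I arbitrary: f rule: finite_induct)
  case empty
  then obtain c where "\<And>w. w \<noteq> 0 \<Longrightarrow> f w = c" using even_qfun_0_const by auto
  then show ?case using empty by (intro exI[of _ "\<lambda>_. 1"] exI[of _ c]) auto
next
  case (insert i I)
  then have f: "f \<in> even_qfun (Suc (card I))" by simp
  then have "f \<in> qfun (Suc (Suc (2 * card I))) 1" using even_qfunD(1) by fastforce
  then obtain b where b: "b \<noteq> 0" "f b = 0" using qfun_has_zero by blast
  obtain g where g: "g \<in> even_qfun (card I)" "\<And>w. w \<noteq> 0 \<Longrightarrow> f w = theta_sym b w * g w"
    using even_qfun_divide_theta_sym[OF f b] by blast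
  have "g w0 \<noteq> 0" using g(2)[of w0] insert.prems by auto
  from insert.IH[OF g(1) insert.prems(2) this]
  obtain a c where *: "c \<noteq> 0" "\<And>i. i \<in> I \<Longrightarrow> a i \<noteq> 0"
    "\<And>w. w \<noteq> 0 \<Longrightarrow> g w = c * (\<Prod>i\<in>I. theta_sym (a i) w)" by blast
  have p: "(\<Prod>j\<in>I. theta_sym ((a(i := b)) j) w) = (\<Prod>j\<in>I. theta_sym (a j) w)" for w
    using insert.hyps by (intro prod.cong) auto
  show ?case
    using * b g insert.hyps p by (intro exI[of _ "a(i := b)"] exI[of _ c]) auto
qed

text \<open>The dimension count in disguise: m vanishing conditions leave one free scalar, so one
  further value determines the function.\<close>

lemma even_qfun_eq_prod_theta_sym_if_zeros:
  assumes "finite I" "f \<in> even_qfun (card I)"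
    and "\<And>i. i \<in> I \<Longrightarrow> b i \<noteq> 0" "\<And>i. i \<in> I \<Longrightarrow> f (b i) = 0"
    and "\<And>i j. i \<in> I \<Longrightarrow> j \<in> I \<Longrightarrow> i \<noteq> j \<Longrightarrow> theta_sym (b i) (b j) \<noteq> 0"
  shows "\<exists>c. \<forall>w. w \<noteq> 0 \<longrightarrow> f w = c * (\<Prod>i\<in>I. theta_sym (b i) w)"
  using assms
proof (induction I arbitrary: f rule: finite_induct)
  case empty
  then obtain c where "\<And>w. w \<noteq> 0 \<Longrightarrow> f w = c" using even_qfun_0_const by auto
  then show ?case by auto
next
  case (insert i I)
  have f: "f \<in> even_qfun (Suc (card I))" using insert by simp
  obtain g where g: "g \<in> even_qfun (card I)" "\<And>w. w \<noteq> 0 \<Longrightarrow> f w = theta_sym (b i) w * g w"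
    using even_qfun_divide_theta_sym[OF f, of "b i"] insert.prems by blast
  have "g (b j) = 0" if "j \<in> I" for j
  proof -
    have "theta_sym (b i) (b j) \<noteq> 0" using that insert.hyps insert.prems(4) by (metis insertCI)
    then show ?thesis using g(2)[of "b j"] insert.prems(2,3)[of j] that by auto
  qed
  then obtain c where "\<And>w. w \<noteq> 0 \<Longrightarrow> g w = c * (\<Prod>i\<in>I. theta_sym (b i) w)"
    using insert.IH[OF g(1)] insert.prems by auto
  then show ?case
    using g(2) insert.hyps by (intro exI[of _ c]) auto
qed

section \<open>Divisors as points of projective space\<close>

text \<open>The coordinates \<open>s, t\<close> (modulo 1) on the elliptic curve \<open>\<complex>\<^sup>* / nome\<^bsup>\<int>\<^esup>\<close>.\<close>

definition torus_pt :: "real \<Rightarrow> real \<Rightarrow> complex" where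
  "torus_pt s t = exp (of_real (2 * pi) * (\<i> * of_real s - of_real t))"

lemma torus_pt_nonzero [simp]: "torus_pt s t \<noteq> 0"
  by (simp add: torus_pt_def)

lemma torus_pt_0 [simp]: "torus_pt 0 0 = 1"
  by (simp add: torus_pt_def)

lemma torus_pt_add: "torus_pt (s + s') (t + t') = torus_pt s t * torus_pt s' t'"
  by (simp add: torus_pt_def exp_add[symmetric] algebra_simps)

lemma torus_pt_uminus: "torus_pt (- s) (- t) = 1 / torus_pt s t"
  using torus_pt_add[of s "- s" t "- t"] by (simp add: field_simps)

lemma torus_pt_diff: "torus_pt (s - s') (t - t') = torus_pt s t / torus_pt s' t'"
  using torus_pt_add[of s "- s'" t "- t'"] torus_pt_uminus by simp

lemma torus_pt_sum: "finite I \<Longrightarrow> torus_pt (\<Sum>i\<in>I. s i) (\<Sum>i\<in>I. t i) = (\<Prod>i\<in>I. torus_pt (s i) (t i))"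
  by (induction I rule: finite_induct) (simp_all add: torus_pt_add)

lemma nome_power_int_eq_torus_pt: "nome powi n = torus_pt 0 (of_int n)"
  by (simp add: nome_def torus_pt_def exp_of_real[symmetric] exp_power_int mult_ac)

lemma torus_pt_eq_iff: "torus_pt s t = torus_pt s' t' \<longleftrightarrow> s - s' \<in> \<int> \<and> t = t'"
proof -
  have "torus_pt s t = torus_pt s' t' \<longleftrightarrow>
    (\<exists>n::int. of_real (2 * pi) * (\<i> * of_real s - of_real t) =
      of_real (2 * pi) * (\<i> * of_real s' - of_real t') + (of_int (2 * n) * pi) * \<i>)"
    unfolding torus_pt_def by (rule exp_eq)
  also have "\<dots> \<longleftrightarrow> (\<exists>n::int. t = t' \<and> s = s' + of_int n)"
  proof (intro arg_cong[where f = Ex] ext)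
    fix n :: int
    have "2 * pi * s = 2 * pi * s' + of_int (2 * n) * pi \<longleftrightarrow> 2 * pi * s = 2 * pi * (s' + of_int n)"
      by (simp add: algebra_simps)
    also have "\<dots> \<longleftrightarrow> s = s' + of_int n" by simp
    finally show "of_real (2 * pi) * (\<i> * of_real s - of_real t) =
        of_real (2 * pi) * (\<i> * of_real s' - of_real t') + (of_int (2 * n) * pi) * \<i> \<longleftrightarrow>
        t = t' \<and> s = s' + of_int n"
      by (auto simp: complex_eq_iff)
  qed
  also have "\<dots> \<longleftrightarrow> s - s' \<in> \<int> \<and> t = t'"
    by (auto simp: Ints_def algebra_simps)
  finally show ?thesis .
qed

lemma torus_pt_eq_nome_mult_iff:
  "torus_pt s t = nome powi n * torus_pt s' t' \<longleftrightarrow> s - s' \<in> \<int> \<and> t - t' = of_int n"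
  unfolding nome_power_int_eq_torus_pt torus_pt_add[symmetric] torus_pt_eq_iff by auto

lemma torus_pt_surj:
  assumes "a \<noteq> 0"
  obtains s t where "a = torus_pt s t"
proof -
  have "a = torus_pt (Im (Ln a) / (2 * pi)) (- Re (Ln a) / (2 * pi))"
  proof -
    have "of_real (2 * pi) * (\<i> * of_real (Im (Ln a) / (2 * pi)) - of_real (- Re (Ln a) / (2 * pi))) = Ln a"
      by (simp add: complex_eq_iff)
    then show ?thesis unfolding torus_pt_def using assms by simp
  qed
  then show thesis using that by blast
qed

lemma theta_torus_pt_eq_0_iff: "theta (torus_pt s t) = 0 \<longleftrightarrow> s \<in> \<int> \<and> t \<in> \<int>"
proof -
  have "theta (torus_pt s t) = 0 \<longleftrightarrow> (\<exists>n. torus_pt s t = nome powi n * torus_pt 0 0)"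
    by (simp add: theta_eq_0_iff)
  then show ?thesis
    unfolding torus_pt_eq_nome_mult_iff by (auto simp: Ints_def)
qed

lemma continuous_on_torus_pt [continuous_intros]:
  "continuous_on S f \<Longrightarrow> continuous_on S g \<Longrightarrow> continuous_on S (\<lambda>x. torus_pt (f x) (g x))"
  unfolding torus_pt_def by (intro continuous_intros)

text \<open>The fractional parts add up to an integer between 0 and \<open>card I\<close>;
  subtracting all of it at one index balances the sum. The bound, independent of \<open>x\<close>,
  is what keeps the parameter space of logarithms compact.\<close>

lemma sum_Ints_shift_to_0:
  fixes x :: "'i \<Rightarrow> real"
  assumes I: "finite I" "I \<noteq> {}" and "(\<Sum>i\<in>I. x i) \<in> \<int>"
  shows "\<exists>y. (\<forall>i\<in>I. x i - y i \<in> \<int> \<and> \<bar>y i\<bar> \<le> card I) \<and> (\<Sum>i\<in>I. y i) = 0"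
proof -
  obtain i0 where i0: "i0 \<in> I" using I by blast
  define k where "k = (\<Sum>i\<in>I. frac (x i))"
  define y where "y i = frac (x i) - (if i = i0 then k else 0)" for i
  have xf: "x i - frac (x i) \<in> \<int>" for i by (simp add: frac_def)
  have "k = (\<Sum>i\<in>I. x i) - (\<Sum>i\<in>I. x i - frac (x i))"
    by (simp add: k_def sum_subtractf)
  also have "\<dots> \<in> \<int>" by (intro Ints_diff Ints_sum assms xf)
  finally have k: "k \<in> \<int>" .
  have k0: "0 \<le> k" unfolding k_def by (intro sum_nonneg) simp
  have "k \<le> (\<Sum>i\<in>I. 1)" unfolding k_def by (intro sum_mono) (simp add: frac_lt_1 less_imp_le)
  then have k1: "k \<le> card I" by simp
  have c: "1 \<le> real (card I)" using I by (simp add: Suc_le_eq card_gt_0_iff)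
  have "x i - y i \<in> \<int> \<and> \<bar>y i\<bar> \<le> card I" for i
  proof
    have eq: "x i - y i = (x i - frac (x i)) + (if i = i0 then k else 0)" by (simp add: y_def)
    show "x i - y i \<in> \<int>" unfolding eq using xf[of i] k by (intro Ints_add) auto
    have f: "0 \<le> frac (x i)" "frac (x i) < 1" by (simp_all add: frac_lt_1)
    have "y i = frac (x i) - k \<or> y i = frac (x i)" by (simp add: y_def)
    then show "\<bar>y i\<bar> \<le> card I" unfolding abs_le_iff using k0 k1 c f by linarith
  qed
  moreover have "(\<Sum>i\<in>I. y i) = 0"
    using I i0 by (simp add: y_def sum_subtractf k_def)
  ultimately show ?thesis by blast
qed

text \<open>Sample points, numerous enough for a function to be determined by its values there, and with
  small logarithms so that their products are not powers of the nome.\<close>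

definition sample_coord :: "'k::finite \<Rightarrow> real" where
  "sample_coord = (SOME b. inj b \<and> (\<forall>k. 0 < b k \<and> b k < 1 / (2 * (real CARD('k) + 1))))"

definition sample_pt :: "'k::finite \<Rightarrow> complex" where
  "sample_pt k = torus_pt 0 (sample_coord k)"

text \<open>The bound puts the sum of any two coordinates, and also the sum of all of them, strictly
  between 0 and 1, hence off the integers.\<close>

lemma sample_coord:
  shows "inj (sample_coord :: 'k::finite \<Rightarrow> real)"
    and "0 < sample_coord (k :: 'k)" "sample_coord (k :: 'k) < 1 / (2 * (real CARD('k) + 1))"
proof -
  obtain h :: "'k \<Rightarrow> nat" where h: "bij_betw h UNIV {0..<CARD('k)}"
    using ex_bij_betw_finite_nat[of "UNIV :: 'k set"] by auto
  define N where "N = real CARD('k)"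
  define b where "b k = (real (h k) + 1) / (2 * (N + 1)\<^sup>2)" for k
  have N: "N \<ge> 0" by (simp add: N_def)
  have "inj b"
    using h N unfolding b_def by (intro injI) (auto simp: bij_betw_def inj_def)
  moreover have "0 < b k" for k
    unfolding b_def using N by (intro divide_pos_pos) auto
  moreover have "b k < 1 / (2 * (N + 1))" for k
  proof -
    have "h k < CARD('k)" using h by (auto simp: bij_betw_def)
    then have "real (h k) + 1 < N + 1" by (simp add: N_def)
    then have "b k < (N + 1) / (2 * (N + 1)\<^sup>2)"
      unfolding b_def using N by (intro divide_strict_right_mono) auto
    also have "\<dots> = 1 / (2 * (N + 1))" using N by (simp add: power2_eq_square)
    finally show ?thesis .
  qed
  ultimately have "\<exists>b :: 'k \<Rightarrow> real. inj b \<and> (\<forall>k. 0 < b k \<and> b k < 1 / (2 * (real CARD('k) + 1)))"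
    unfolding N_def by blast
  from someI_ex[OF this, folded sample_coord_def]
  show "inj (sample_coord :: 'k::finite \<Rightarrow> real)"
    "0 < sample_coord (k :: 'k)" "sample_coord (k :: 'k) < 1 / (2 * (real CARD('k) + 1))"
    by blast+
qed

lemma sample_coord_less_half: "sample_coord (k :: 'k::finite) < 1 / 2"
proof -
  have "1 / (2 * (real CARD('k) + 1)) \<le> 1 / 2" by (simp add: field_simps)
  then show ?thesis using sample_coord(3)[of k] by linarith
qed

lemma not_Ints_if_between: "0 < \<bar>x\<bar> \<Longrightarrow> \<bar>x\<bar> < 1 \<Longrightarrow> (x :: real) \<notin> \<int>"
  by (metis Ints_nonzero_abs_ge1 abs_zero less_irrefl not_le)

lemma sample_pt_nonzero [simp]: "sample_pt k \<noteq> 0"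
  by (simp add: sample_pt_def)

lemma theta_sample_pt_divide: "k \<noteq> l \<Longrightarrow> theta (sample_pt k / sample_pt l) \<noteq> 0"
proof -
  assume "k \<noteq> l"
  then have "sample_coord k \<noteq> sample_coord l" by (simp add: inj_eq[OF sample_coord(1)])
  then have "sample_coord k - sample_coord l \<notin> \<int>"
    using sample_coord(2)[of k] sample_coord(2)[of l] sample_coord_less_half[of k] sample_coord_less_half[of l]
    by (intro not_Ints_if_between) linarith+
  then show ?thesis
    unfolding sample_pt_def torus_pt_diff[symmetric] theta_torus_pt_eq_0_iff by simp
qed

lemma theta_sample_pt_mult: "theta (sample_pt k * sample_pt l) \<noteq> 0"
proof -
  have "sample_coord k + sample_coord l \<notin> \<int>"
    using sample_coord(2)[of k] sample_coord(2)[of l] sample_coord_less_half[of k] sample_coord_less_half[of l]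
    by (intro not_Ints_if_between) linarith+
  then show ?thesis
    unfolding sample_pt_def torus_pt_add[symmetric] theta_torus_pt_eq_0_iff by simp
qed

lemma theta_prod_sample_pt: "theta (\<Prod>k\<in>UNIV. sample_pt (k :: 'k::finite)) \<noteq> 0"
proof -
  have "0 < (\<Sum>k\<in>UNIV. sample_coord (k :: 'k))"
    using sample_coord(2) by (intro sum_pos) auto
  moreover have "(\<Sum>k\<in>UNIV. sample_coord (k :: 'k)) < (\<Sum>k\<in>(UNIV :: 'k set). 1 / (2 * (real CARD('k) + 1)))"
    using sample_coord(3) by (intro sum_strict_mono) auto
  moreover have "(\<Sum>k\<in>(UNIV :: 'k set). 1 / (2 * (real CARD('k) + 1))) \<le> 1"
    by (simp add: field_simps)
  ultimately have "(\<Sum>k\<in>UNIV. sample_coord (k :: 'k)) \<notin> \<int>"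
    by (intro not_Ints_if_between) linarith+
  then have "theta (torus_pt (\<Sum>k\<in>(UNIV :: 'k set). 0) (\<Sum>k\<in>UNIV. sample_coord (k :: 'k))) \<noteq> 0"
    by (simp add: theta_torus_pt_eq_0_iff)
  then show ?thesis unfolding torus_pt_sum[OF finite] sample_pt_def .
qed

text \<open>Integer changes of \<open>s\<close> are invisible, those of \<open>t\<close> move points
  by powers of the nome; \<open>n\<close> is the total of the latter. It yields one inclusion of
  fibres, with \<open>n = 0\<close>, and the normalisation of the logarithms in
  \<open>theta_map_surj\<close>.\<close>

lemma prod_theta_torus_pt_proportional:
  fixes s t s' t' :: "'k::finite \<Rightarrow> real"
  assumes \<sigma>: "\<sigma> permutes UNIV"
    and st: "\<And>k. s k - s' (\<sigma> k) \<in> \<int>" "\<And>k. t k - t' (\<sigma> k) \<in> \<int>"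
    and sum: "(\<Sum>k\<in>UNIV. t k) = (\<Sum>k\<in>UNIV. t' k) + of_int n"
  obtains c where "c \<noteq> 0"
    "\<And>w. w \<noteq> 0 \<Longrightarrow> (\<Prod>k\<in>UNIV. theta (w / torus_pt (s k) (t k)))
      = c * w powi n * (\<Prod>k\<in>UNIV. theta (w / torus_pt (s' k) (t' k)))"
proof -
  have "\<forall>k. \<exists>n. t k - t' (\<sigma> k) = of_int n" using st(2) by (auto simp: Ints_def)
  then obtain m where m: "\<And>k. t k - t' (\<sigma> k) = of_int (m k)" by metis
  have pt: "torus_pt (s k) (t k) = nome powi (m k) * torus_pt (s' (\<sigma> k)) (t' (\<sigma> k))" for k
    using st(1) m by (simp add: torus_pt_eq_nome_mult_iff)
  have "(\<Sum>k\<in>UNIV. t' (\<sigma> k)) = (\<Sum>k\<in>UNIV. t' k)"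
    using sum.permute[OF \<sigma>, of t'] by (simp add: o_def)
  then have "(\<Sum>k\<in>UNIV. t k - t' (\<sigma> k)) = of_int n"
    using sum by (simp add: sum_subtractf)
  then have "of_int (\<Sum>k\<in>UNIV. m k) = (of_int n :: real)"
    by (simp add: m)
  then have mn: "(\<Sum>k\<in>UNIV. m k) = n" by (simp only: of_int_eq_iff)
  obtain c where c: "c \<noteq> 0" "\<And>w. w \<noteq> 0 \<Longrightarrow>
      (\<Prod>k\<in>UNIV. theta (w / (nome powi (m k) * torus_pt (s' (\<sigma> k)) (t' (\<sigma> k)))))
      = c * w powi n * (\<Prod>k\<in>UNIV. theta (w / torus_pt (s' (\<sigma> k)) (t' (\<sigma> k))))"
    using prod_theta_divide_nome_power[of UNIV "\<lambda>k. torus_pt (s' (\<sigma> k)) (t' (\<sigma> k))" m] mn by auto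
  have "(\<Prod>k\<in>UNIV. theta (w / torus_pt (s' (\<sigma> k)) (t' (\<sigma> k)))) = (\<Prod>k\<in>UNIV. theta (w / torus_pt (s' k) (t' k)))" for w
    using prod.permute[OF \<sigma>, of "\<lambda>k. theta (w / torus_pt (s' k) (t' k))"] by (simp add: o_def)
  then show thesis using that[OF c(1)] c(2) by (simp add: pt)
qed

section \<open>Homogeneous coordinates for SU(m)\<close>

definition theta_map :: "(real^'m) \<times> (real^'m) \<Rightarrow> complex^'m" where
  "theta_map p = (\<chi> k. \<Prod>i\<in>UNIV. theta (sample_pt k / torus_pt (fst p $ i) (snd p $ i)))"

lemma continuous_on_theta: "continuous_on (- {0}) theta"
  by (intro holomorphic_on_imp_continuous_on holomorphic_on_theta[of "\<lambda>z. z"]) auto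

lemma continuous_on_theta_map: "continuous_on S (theta_map :: _ \<Rightarrow> complex^'m)"
  unfolding theta_map_def
  by (intro continuous_intros continuous_on_compose2[OF continuous_on_theta]) auto

text \<open>As many points as the degree suffice because the product of the sample points is not a
  power of the nome.\<close>

lemma qfun_eq_0_if_sample_pt_zero:
  assumes f: "f \<in> qfun CARD('m) ((-1) ^ CARD('m))" and zero: "\<And>k :: 'm::finite. f (sample_pt k) = 0" and w: "w \<noteq> 0"
  shows "f w = 0"
  by (rule qfun_eq_0[of "UNIV :: 'm set" f sample_pt, OF _ f _ _ _ _ w])
     (auto simp: zero theta_sample_pt_divide theta_prod_sample_pt)

text \<open>Sums exactly 0 make the product of the points exactly 1, so all these products lie in
  one and the same vector space.\<close>

lemma prod_theta_torus_pt_qfun: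
  fixes s t :: "real^'m"
  assumes "(\<Sum>i\<in>UNIV. s $ i) = 0" "(\<Sum>i\<in>UNIV. t $ i) = 0"
  shows "(\<lambda>w. \<Prod>i\<in>UNIV. theta (w / torus_pt (s $ i) (t $ i))) \<in> qfun CARD('m) ((-1) ^ CARD('m))"
  using prod_theta_qfun[of "UNIV :: 'm set" "\<lambda>i. torus_pt (s $ i) (t $ i)"]
    torus_pt_sum[of "UNIV :: 'm set" "\<lambda>i. s $ i" "\<lambda>i. t $ i"] assms by simp

lemma theta_map_nonzero:
  fixes p :: "(real^'m) \<times> (real^'m)"
  assumes "(\<Sum>i\<in>UNIV. fst p $ i) = 0" "(\<Sum>i\<in>UNIV. snd p $ i) = 0"
  shows "theta_map p \<noteq> 0"
proof
  assume "theta_map p = 0"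
  then have "(\<Prod>i\<in>UNIV. theta (sample_pt k / torus_pt (fst p $ i) (snd p $ i))) = 0" for k :: 'm
    by (simp add: theta_map_def vec_eq_iff)
  then have "(\<Prod>i\<in>UNIV. theta (w / torus_pt (fst p $ i) (snd p $ i))) = 0" if "w \<noteq> 0" for w
    using qfun_eq_0_if_sample_pt_zero[OF prod_theta_torus_pt_qfun[OF assms] _ that] by blast
  moreover have "\<forall>\<^sub>F w in at 1. (\<Prod>i\<in>UNIV. theta (w / torus_pt (fst p $ i) (snd p $ i))) \<noteq> 0"
    by (intro eventually_prod_nonzero eventually_theta_nonzero) auto
  ultimately have "\<forall>\<^sub>F w in at (1 :: complex). w = 0"
    by (elim eventually_mono) blast
  moreover have "\<forall>\<^sub>F w in at 1. (w :: complex) \<noteq> 0"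
    using eventually_neq_at_within[of 0 1 UNIV] by simp
  ultimately have "\<forall>\<^sub>F w in at (1 :: complex). False"
    by eventually_elim simp
  then show False by simp
qed

text \<open>The function \<open>f p' - c * f p\<close> lies in the vector space on which evaluation
  at the sample points is injective, so proportionality of the coordinates extends to all
  \<open>w\<close>; the zeros then match up.\<close>

lemma theta_map_proportional_imp:
  fixes p p' :: "(real^'m) \<times> (real^'m)"
  assumes p: "(\<Sum>i\<in>UNIV. fst p $ i) = 0" "(\<Sum>i\<in>UNIV. snd p $ i) = 0"
    and p': "(\<Sum>i\<in>UNIV. fst p' $ i) = 0" "(\<Sum>i\<in>UNIV. snd p' $ i) = 0"
    and proportional: "(theta_map p, theta_map p') \<in> proj_rel"
  obtains \<sigma> where "\<sigma> permutes UNIV" "\<And>i. fst p' $ i - fst p $ \<sigma> i \<in> \<int>" "\<And>i. snd p' $ i - snd p $ \<sigma> i \<in> \<int>"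
proof -
  define f where "f p w = (\<Prod>i\<in>UNIV. theta (w / torus_pt (fst p $ i) (snd p $ i)))" for p :: "(real^'m) \<times> (real^'m)" and w
  obtain c where c: "c \<noteq> 0" "theta_map p' = c *s theta_map p"
    using proportional by (auto simp: proj_rel_def)
  have q: "(\<lambda>w. f p' w - c * f p w) \<in> qfun CARD('m) ((-1) ^ CARD('m))"
    unfolding f_def by (intro qfun_diff qfun_cmult prod_theta_torus_pt_qfun p p')
  have "f p' (sample_pt k) - c * f p (sample_pt k) = 0" for k :: 'm
    using c(2) by (simp add: theta_map_def vec_eq_iff f_def)
  then have "f p' w - c * f p w = 0" if "w \<noteq> 0" for w
    using qfun_eq_0_if_sample_pt_zero[OF q _ that] by blast
  then have "(\<Prod>i\<in>UNIV. theta (w / torus_pt (fst p' $ i) (snd p' $ i)))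
      = c * (\<Prod>i\<in>UNIV. theta (w / torus_pt (fst p $ i) (snd p $ i)))" if "w \<noteq> 0" for w
    using that by (simp add: f_def)
  then obtain \<sigma> where "\<sigma> permutes UNIV"
    "\<forall>i. \<exists>n. torus_pt (fst p' $ i) (snd p' $ i) = nome powi n * torus_pt (fst p $ \<sigma> i) (snd p $ \<sigma> i)"
    using prod_theta_eq_imp_permuted[of UNIV "\<lambda>i. torus_pt (fst p' $ i) (snd p' $ i)"
        "\<lambda>i. torus_pt (fst p $ i) (snd p $ i)" c] c(1) by auto
  then show thesis
    using that[of \<sigma>] unfolding torus_pt_eq_nome_mult_iff by (metis Ints_of_int)
qed

lemma theta_map_surj:
  fixes v :: "complex^'m"
  assumes "v \<noteq> 0"
  obtains p :: "(real^'m) \<times> (real^'m)" where "(\<Sum>i\<in>UNIV. fst p $ i) = 0" "(\<Sum>i\<in>UNIV. snd p $ i) = 0"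
    "\<And>i. \<bar>fst p $ i\<bar> \<le> CARD('m)" "\<And>i. \<bar>snd p $ i\<bar> \<le> CARD('m)" "(theta_map p, v) \<in> proj_rel"
proof -
  \<comment> \<open>Zeros of the Lagrange function \<open>L k\<close>: the other sample points, and
    one last zero forced by the condition that the product be 1. At \<open>sample_pt k\<close> the
    factor of this last zero is \<open>theta\<close> of the product of all sample points, which is
    nonzero.\<close>
  define a where "a k l = (if l = k then 1 / (\<Prod>j\<in>UNIV - {k}. sample_pt j) else sample_pt l)" for k l :: 'm
  define L where "L k w = (\<Prod>l\<in>UNIV. theta (w / a k l))" for k w
  have a0: "a k l \<noteq> 0" for k l by (simp add: a_def)
  have split: "(\<Prod>l\<in>UNIV. g l) = g k * (\<Prod>l\<in>UNIV - {k}. g l)" for k :: 'm and g :: "'m \<Rightarrow> complex"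
    by (simp add: prod.remove)
  have "(\<Prod>l\<in>UNIV. a k l) = 1" for k
  proof -
    have "(\<Prod>l\<in>UNIV - {k}. a k l) = (\<Prod>l\<in>UNIV - {k}. sample_pt l)"
      by (intro prod.cong) (auto simp: a_def)
    then show ?thesis unfolding split[of _ k] by (simp add: a_def)
  qed
  then have Lq: "L k \<in> qfun CARD('m) ((-1) ^ CARD('m))" for k
    using prod_theta_qfun[of "UNIV :: 'm set" "a k"] a0 by (simp add: L_def[abs_def])
  have L0: "L k (sample_pt j) = 0" if "j \<noteq> k" for j k
    unfolding L_def using that by (intro prod_zero) (auto intro!: bexI[of _ j] simp: a_def)
  have Lk: "L k (sample_pt k) \<noteq> 0" for k
  proof -
    have "sample_pt k / a k k = (\<Prod>l\<in>UNIV. sample_pt (l :: 'm))"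
      by (simp add: a_def prod.remove[of UNIV k sample_pt])
    then have "theta (sample_pt k / a k k) \<noteq> 0" by (simp add: theta_prod_sample_pt)
    moreover have "theta (sample_pt k / a k l) \<noteq> 0" if "l \<noteq> k" for l
      using that theta_sample_pt_divide[of k l] by (simp add: a_def)
    ultimately show ?thesis unfolding L_def by (metis (no_types, lifting) finite prod_zero_iff)
  qed
  define f where "f w = (\<Sum>k\<in>UNIV. v $ k / L k (sample_pt k) * L k w)" for w
  have fq: "f \<in> qfun CARD('m) ((-1) ^ CARD('m))"
    unfolding f_def by (intro qfun_sum qfun_cmult Lq)
  have fv: "f (sample_pt j) = v $ j" for j
  proof -
    have "f (sample_pt j) = (\<Sum>k\<in>UNIV. if k = j then v $ j else 0)"
      unfolding f_def by (intro sum.cong) (auto simp: L0 Lk)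
    then show ?thesis by simp
  qed
  obtain k where "v $ k \<noteq> 0" using assms by (auto simp: vec_eq_iff)
  then have "f (sample_pt k) \<noteq> 0" by (simp add: fv)
  then obtain a c n where c: "c \<noteq> 0" and a: "\<And>i::'m. a i \<noteq> 0"
    "(-1) ^ CARD('m) = (-1) ^ CARD('m) * (\<Prod>i\<in>UNIV. a i) * nome powi n"
    "\<And>w. w \<noteq> 0 \<Longrightarrow> f w = c * w powi n * (\<Prod>i\<in>UNIV. theta (w / a i))"
    using qfun_eq_prod_theta[of "UNIV :: 'm set" f "(-1) ^ CARD('m)" "sample_pt k"] fq by auto
  have "\<forall>i. \<exists>s t. a i = torus_pt s t" using a(1) torus_pt_surj by metis
  then obtain s t where st: "\<And>i. a i = torus_pt (s i) (t i)" by metis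
  \<comment> \<open>By Abel's relation the exponent \<open>n\<close> of the monomial is minus the
    sum of the \<open>t i\<close>, so making the sums 0 removes the monomial.\<close>
  have "torus_pt (\<Sum>i\<in>UNIV. s i) (\<Sum>i\<in>UNIV. t i) = nome powi (- n) * torus_pt 0 0"
    using a(2) by (simp add: torus_pt_sum st power_int_minus field_simps)
  then have sums: "(\<Sum>i\<in>UNIV. s i) \<in> \<int>" "(\<Sum>i\<in>UNIV. t i) = of_int (- n)"
    unfolding torus_pt_eq_nome_mult_iff by auto
  then have "(\<Sum>i\<in>UNIV. t i) \<in> \<int>" by simp
  from sum_Ints_shift_to_0[OF _ _ this] sum_Ints_shift_to_0[OF _ _ sums(1)]
  obtain s' t' where s': "\<And>i. s i - s' i \<in> \<int>" "\<And>i. \<bar>s' i\<bar> \<le> CARD('m)" "(\<Sum>i\<in>UNIV. s' i) = 0"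
    and t': "\<And>i. t i - t' i \<in> \<int>" "\<And>i. \<bar>t' i\<bar> \<le> CARD('m)" "(\<Sum>i\<in>UNIV. t' i) = 0"
    by auto
  obtain d where d: "d \<noteq> 0" "\<And>w. w \<noteq> 0 \<Longrightarrow> (\<Prod>i\<in>UNIV. theta (w / torus_pt (s i) (t i)))
      = d * w powi (- n) * (\<Prod>i\<in>UNIV. theta (w / torus_pt (s' i) (t' i)))"
    using prod_theta_torus_pt_proportional[of id s s' t t' "- n"] s' t' sums by (auto simp: permutes_id)
  define p where "p = ((\<chi> i. s' i) :: real^'m, (\<chi> i. t' i) :: real^'m)"
  have pst: "fst p $ i = s' i" "snd p $ i = t' i" for i by (simp_all add: p_def)
  have "v = (c * d) *s theta_map p"
  proof -
    have "v $ k = (c * d) * theta_map p $ k" for k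
    proof -
      have "v $ k = c * sample_pt k powi n * (\<Prod>i\<in>UNIV. theta (sample_pt k / torus_pt (s i) (t i)))"
        using a(3)[of "sample_pt k"] by (simp add: fv st)
      also have "\<dots> = (c * d) * theta_map p $ k"
        using d(2)[of "sample_pt k"] by (simp add: theta_map_def pst power_int_minus)
      finally show ?thesis .
    qed
    then show ?thesis by (simp add: vec_eq_iff)
  qed
  moreover have "theta_map p \<noteq> 0" using theta_map_nonzero[of p] s'(3) t'(3) by (simp add: pst)
  ultimately have "(theta_map p, v) \<in> proj_rel"
    using c d(1) by (auto simp: proj_rel_def intro!: exI[of _ "c * d"])
  then show thesis using that[of p] s' t' by (simp add: pst)
qed

section \<open>Homogeneous coordinates for Sp(m)\<close>

definition theta_sym_map :: "(real^'m) \<times> (real^'m) \<Rightarrow> complex^('m::finite option)" where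
  "theta_sym_map p = (\<chi> k. \<Prod>i\<in>UNIV. theta_sym (torus_pt (fst p $ i) (snd p $ i)) (sample_pt k))"

lemma continuous_on_theta_sym_map: "continuous_on S (theta_sym_map :: _ \<Rightarrow> complex^('m::finite option))"
  unfolding theta_sym_map_def theta_sym_def
  by (intro continuous_intros continuous_on_compose2[OF continuous_on_theta]) auto

lemma theta_sym_sample_pt_nonzero: "k \<noteq> l \<Longrightarrow> theta_sym (sample_pt k) (sample_pt l) \<noteq> 0"
  using theta_sample_pt_divide[of l k] theta_sample_pt_mult[of l k] by (auto simp: theta_sym_def)

text \<open>The points \<open>Some i\<close> reduce \<open>f\<close> to a multiple of one theta
  product, which does not vanish at the additional point \<open>None\<close>; so the scalar is
  0.\<close>

lemma even_qfun_eq_0_if_sample_pt_zero: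
  assumes f: "f \<in> even_qfun CARD('m)" and zero: "\<And>k :: 'm::finite option. f (sample_pt k) = 0" and w: "w \<noteq> 0"
  shows "f w = 0"
proof -
  obtain c where c: "\<And>w. w \<noteq> 0 \<Longrightarrow> f w = c * (\<Prod>i\<in>UNIV. theta_sym (sample_pt (Some (i :: 'm))) w)"
    using even_qfun_eq_prod_theta_sym_if_zeros[OF _ f, of "\<lambda>i. sample_pt (Some i)"] zero
    by (auto simp: theta_sym_sample_pt_nonzero)
  have "(\<Prod>i\<in>UNIV. theta_sym (sample_pt (Some (i :: 'm))) (sample_pt (None :: 'm option))) \<noteq> 0"
    by (simp add: theta_sym_sample_pt_nonzero)
  then have "c = 0" using c[of "sample_pt (None :: 'm option)"] zero by simp
  then show ?thesis using c[OF w] by simp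
qed

lemma prod_theta_sym_even_qfun:
  "(\<And>i. a i \<noteq> 0) \<Longrightarrow> (\<lambda>w. \<Prod>i\<in>UNIV. theta_sym (a (i :: 'm::finite)) w) \<in> even_qfun CARD('m)"
  using even_qfun_prod[of "UNIV :: 'm set" "\<lambda>i. theta_sym (a i)" 1] theta_sym_even_qfun by simp

lemma theta_sym_map_nonzero: "theta_sym_map p \<noteq> (0 :: complex^('m::finite option))"
proof
  assume "theta_sym_map p = 0"
  then have "(\<Prod>i\<in>UNIV. theta_sym (torus_pt (fst p $ i) (snd p $ i)) (sample_pt k)) = 0" for k :: "'m option"
    by (simp add: theta_sym_map_def vec_eq_iff)
  then have "(\<Prod>i\<in>UNIV. theta_sym (torus_pt (fst p $ i) (snd p $ i)) w) = 0" if "w \<noteq> 0" for w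
    using even_qfun_eq_0_if_sample_pt_zero[OF prod_theta_sym_even_qfun _ that,
        of "\<lambda>i. torus_pt (fst p $ i) (snd p $ i)"] by simp
  moreover have "\<forall>\<^sub>F w in at 1. (\<Prod>i\<in>UNIV. theta_sym (torus_pt (fst p $ i) (snd p $ i)) w) \<noteq> 0"
    by (intro eventually_prod_nonzero eventually_theta_sym_nonzero) auto
  ultimately have "\<forall>\<^sub>F w in at (1 :: complex). w = 0"
    by (elim eventually_mono) blast
  moreover have "\<forall>\<^sub>F w in at 1. (w :: complex) \<noteq> 0"
    using eventually_neq_at_within[of 0 1 UNIV] by simp
  ultimately have "\<forall>\<^sub>F w in at (1 :: complex). False"
    by eventually_elim simp
  then show False by simp
qed

lemma theta_sym_map_proportional_imp:
  fixes p p' :: "(real^'m) \<times> (real^'m)"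
  assumes proportional: "(theta_sym_map p, theta_sym_map p') \<in> proj_rel"
  obtains \<sigma> where "\<sigma> permutes UNIV"
    "\<And>i. (fst p' $ i - fst p $ \<sigma> i \<in> \<int> \<and> snd p' $ i - snd p $ \<sigma> i \<in> \<int>) \<or>
         (fst p' $ i + fst p $ \<sigma> i \<in> \<int> \<and> snd p' $ i + snd p $ \<sigma> i \<in> \<int>)"
proof -
  define f where "f p w = (\<Prod>i\<in>UNIV. theta_sym (torus_pt (fst p $ i) (snd p $ i)) w)" for p :: "(real^'m) \<times> (real^'m)" and w
  obtain c where c: "c \<noteq> 0" "theta_sym_map p' = c *s theta_sym_map p"
    using proportional by (auto simp: proj_rel_def)
  have q: "(\<lambda>w. f p' w - c * f p w) \<in> even_qfun CARD('m)"
    unfolding f_def by (intro even_qfun_diff even_qfun_cmult prod_theta_sym_even_qfun) auto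
  have "f p' (sample_pt k) - c * f p (sample_pt k) = 0" for k :: "'m option"
    using c(2) by (simp add: theta_sym_map_def vec_eq_iff f_def)
  then have "f p' w - c * f p w = 0" if "w \<noteq> 0" for w
    using even_qfun_eq_0_if_sample_pt_zero[OF q _ that] by blast
  then have "(\<Prod>i\<in>UNIV. theta_sym (torus_pt (fst p' $ i) (snd p' $ i)) w)
      = c * (\<Prod>i\<in>UNIV. theta_sym (torus_pt (fst p $ i) (snd p $ i)) w)" if "w \<noteq> 0" for w
    using that by (simp add: f_def)
  then obtain \<sigma> where \<sigma>: "\<sigma> permutes UNIV"
    "\<forall>i. \<exists>n. torus_pt (fst p' $ i) (snd p' $ i) = nome powi n * torus_pt (fst p $ \<sigma> i) (snd p $ \<sigma> i) \<or>
             torus_pt (fst p' $ i) (snd p' $ i) = nome powi n * torus_pt (- (fst p $ \<sigma> i)) (- (snd p $ \<sigma> i))"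
    using prod_theta_sym_eq_imp_permuted[of UNIV "\<lambda>i. torus_pt (fst p' $ i) (snd p' $ i)"
        "\<lambda>i. torus_pt (fst p $ i) (snd p $ i)" c] c(1) unfolding torus_pt_uminus by auto
  then have "\<forall>i. (fst p' $ i - fst p $ \<sigma> i \<in> \<int> \<and> snd p' $ i - snd p $ \<sigma> i \<in> \<int>) \<or>
         (fst p' $ i + fst p $ \<sigma> i \<in> \<int> \<and> snd p' $ i + snd p $ \<sigma> i \<in> \<int>)"
    unfolding torus_pt_eq_nome_mult_iff diff_minus_eq_add by (metis Ints_of_int)
  then show thesis
    using that[of \<sigma>] \<sigma>(1) by blast
qed

lemma theta_sym_map_surj:
  fixes v :: "complex^('m::finite option)"
  assumes "v \<noteq> 0"
  obtains p :: "(real^'m) \<times> (real^'m)" where "\<And>i. \<bar>fst p $ i\<bar> \<le> 1" "\<And>i. \<bar>snd p $ i\<bar> \<le> 1" "(theta_sym_map p, v) \<in> proj_rel"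
proof -
  \<comment> \<open>The m remaining sample points are exactly the zeros, up to inversion, that the
    degree allows; no Abel condition forces another one.\<close>
  define L where "L k w = (\<Prod>l\<in>UNIV - {k}. theta_sym (sample_pt l) w)" for k :: "'m option" and w
  have Lq: "L k \<in> even_qfun CARD('m)" for k
  proof -
    have "card (UNIV - {k}) = CARD('m)" by (simp add: card_Diff_singleton)
    then show ?thesis
      using even_qfun_prod[of "UNIV - {k}" "\<lambda>l. theta_sym (sample_pt l)" 1] theta_sym_even_qfun
      by (simp add: L_def[abs_def])
  qed
  have L0: "L k (sample_pt j) = 0" if "j \<noteq> k" for j k
    unfolding L_def using that by (intro prod_zero) (auto intro!: bexI[of _ j])
  have Lk: "L k (sample_pt k) \<noteq> 0" for k
    unfolding L_def by (simp add: theta_sym_sample_pt_nonzero)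
  define f where "f w = (\<Sum>k\<in>UNIV. v $ k / L k (sample_pt k) * L k w)" for w
  have fq: "f \<in> even_qfun CARD('m)"
    unfolding f_def by (intro even_qfun_sum even_qfun_cmult Lq)
  have fv: "f (sample_pt j) = v $ j" for j
  proof -
    have "f (sample_pt j) = (\<Sum>k\<in>UNIV. if k = j then v $ j else 0)"
      unfolding f_def by (intro sum.cong) (auto simp: L0 Lk)
    then show ?thesis by simp
  qed
  obtain k where "v $ k \<noteq> 0" using assms by (auto simp: vec_eq_iff)
  then have "f (sample_pt k) \<noteq> 0" by (simp add: fv)
  then obtain a c where c: "c \<noteq> 0" and a: "\<And>i::'m. a i \<noteq> 0"
    "\<And>w. w \<noteq> 0 \<Longrightarrow> f w = c * (\<Prod>i\<in>UNIV. theta_sym (a i) w)"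
    using even_qfun_eq_prod_theta_sym[of "UNIV :: 'm set" f "sample_pt k"] fq by auto
  have "\<forall>i. \<exists>s t. a i = torus_pt s t" using a(1) torus_pt_surj by metis
  then obtain s t where st: "\<And>i. a i = torus_pt (s i) (t i)" by metis
  \<comment> \<open>Fractional parts suffice here: each change of lift costs a constant only, by
    \<open>theta_sym_nome_mult\<close>, so no sum has to be balanced.\<close>
  define p where "p = ((\<chi> i. frac (s i)) :: real^'m, (\<chi> i. frac (t i)) :: real^'m)"
  have pst: "fst p $ i = frac (s i)" "snd p $ i = frac (t i)" for i by (simp_all add: p_def)
  have "\<exists>d. d \<noteq> 0 \<and> (\<forall>w. w \<noteq> 0 \<longrightarrow> theta_sym (a i) w = d * theta_sym (torus_pt (frac (s i)) (frac (t i))) w)" for i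
  proof -
    have "a i = nome powi \<lfloor>t i\<rfloor> * torus_pt (frac (s i)) (frac (t i))"
      unfolding st torus_pt_eq_nome_mult_iff by (simp add: frac_def)
    then show ?thesis using theta_sym_nome_mult by metis
  qed
  then obtain d where d: "\<And>i. d i \<noteq> 0"
    "\<And>i w. w \<noteq> 0 \<Longrightarrow> theta_sym (a i) w = d i * theta_sym (torus_pt (frac (s i)) (frac (t i))) w"
    by metis
  have "v $ k = (c * (\<Prod>i\<in>UNIV. d i)) * theta_sym_map p $ k" for k
    using a(2)[of "sample_pt k"] by (simp add: fv theta_sym_map_def pst d(2) prod.distrib)
  then have "v = (c * (\<Prod>i\<in>UNIV. d i)) *s theta_sym_map p" by (simp add: vec_eq_iff)
  moreover have "c * (\<Prod>i\<in>UNIV. d i) \<noteq> 0" using c d(1) by simp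
  ultimately have "(theta_sym_map p, v) \<in> proj_rel"
    using theta_sym_map_nonzero[of p] unfolding proj_rel_def by blast
  moreover have "\<bar>frac x\<bar> \<le> 1" for x :: real using frac_lt_1[of x] by simp
  ultimately show thesis using that[of p] by (simp add: pst)
qed

section \<open>Joint eigenvectors of commuting unitary matrices\<close>

definition cinner :: "complex^'n \<Rightarrow> complex^'n \<Rightarrow> complex" where
  "cinner v w = (\<Sum>i\<in>UNIV. cnj (v $ i) * w $ i)"

lemma cinner_add_right: "cinner v (w + w') = cinner v w + cinner v w'"
  by (simp add: cinner_def distrib_left sum.distrib)

lemma cinner_scale_right: "cinner v (c *s w) = c * cinner v w"
  by (simp add: cinner_def sum_distrib_left mult_ac)

lemma cinner_scale_left: "cinner (c *s v) w = cnj c * cinner v w"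
  by (simp add: cinner_def sum_distrib_left mult_ac)

lemma cinner_zero_right [simp]: "cinner v 0 = 0"
  by (simp add: cinner_def)

lemma cinner_minus_left: "cinner (- v) w = - cinner v w"
  by (simp add: cinner_def sum_negf)

lemma cinner_minus_right: "cinner v (- w) = - cinner v w"
  by (simp add: cinner_def sum_negf)

lemma cinner_commute: "cinner w v = cnj (cinner v w)"
  by (simp add: cinner_def mult.commute)

lemma cinner_self: "cinner v v = of_real ((norm v)\<^sup>2)"
  by (simp add: cinner_def norm_vec_def L2_set_def sum_nonneg mult.commute complex_norm_square[symmetric])

lemma cinner_axis: "cinner (axis i 1) (axis j 1) = (if i = j then 1 else 0)"
proof -
  have "cinner (axis i 1) (axis j 1) = (\<Sum>k\<in>UNIV. if k = i then (if i = j then 1 else 0) else 0)"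
    unfolding cinner_def by (intro sum.cong) (auto simp: axis_def)
  then show ?thesis by simp
qed

lemma cinner_matrix_vector_mult:
  "cinner v (A *v w) = cinner (adjoint_mat A *v v) w"
proof -
  have "cinner v (A *v w) = (\<Sum>i\<in>UNIV. \<Sum>j\<in>UNIV. cnj (v $ i) * (A $ i $ j * w $ j))"
    by (simp add: cinner_def matrix_vector_mult_def sum_distrib_left)
  also have "\<dots> = (\<Sum>j\<in>UNIV. \<Sum>i\<in>UNIV. cnj (v $ i) * (A $ i $ j * w $ j))"
    by (rule sum.swap)
  also have "\<dots> = cinner (adjoint_mat A *v v) w"
    by (simp add: cinner_def matrix_vector_mult_def adjoint_mat_def transpose_def sum_distrib_right sum_distrib_left mult_ac)
  finally show ?thesis .
qed

section \<open>Matrices given by their diagonal or their columns\<close>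

definition diag_mat :: "('n \<Rightarrow> complex) \<Rightarrow> complex^'n^'n" where
  "diag_mat a = (\<chi> i j. if i = j then a i else 0)"

definition mat_of_cols :: "('n \<Rightarrow> complex^'m) \<Rightarrow> complex^'n^'m" where
  "mat_of_cols v = (\<chi> i j. v j $ i)"

lemma diag_mat_mult: "diag_mat a ** diag_mat b = diag_mat (\<lambda>i. a i * b i)"
proof -
  have "(\<Sum>k\<in>UNIV. (if i = k then a i else 0) * (if k = j then b k else 0)) = (if i = j then a i * b i else 0)" for i j
  proof -
    have "(\<Sum>k\<in>UNIV. (if i = k then a i else 0) * (if k = j then b k else 0))
      = (\<Sum>k\<in>UNIV. if i = k then a i * (if k = j then b k else 0) else 0)"
      by (intro sum.cong) auto
    then show ?thesis by simp
  qed
  then show ?thesis by (simp add: diag_mat_def matrix_matrix_mult_def vec_eq_iff)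
qed

lemma diag_mat_one: "diag_mat (\<lambda>_. 1) = mat 1"
  by (simp add: diag_mat_def mat_def)

lemma mat_eq_diag_mat: "mat c = diag_mat (\<lambda>_. c)"
  by (simp add: diag_mat_def mat_def)

lemma diag_mat_add: "diag_mat a + diag_mat b = diag_mat (\<lambda>i. a i + b i)"
  by (simp add: diag_mat_def vec_eq_iff)

lemma adjoint_diag_mat: "adjoint_mat (diag_mat a) = diag_mat (\<lambda>i. cnj (a i))"
  by (auto simp: adjoint_mat_def diag_mat_def vec_eq_iff transpose_def)

lemma det_diag_mat: "det (diag_mat a) = (\<Prod>i\<in>UNIV. a i)"
  by (subst det_diagonal) (simp_all add: diag_mat_def)

lemma diag_mat_eq_iff: "diag_mat a = diag_mat b \<longleftrightarrow> a = b"
  by (auto simp: diag_mat_def vec_eq_iff fun_eq_iff)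

lemma diag_mat_axis: "diag_mat a *v axis k 1 = a k *s axis k 1"
proof -
  have "(\<Sum>j\<in>UNIV. (if i = j then a i else 0) * (axis k 1 :: complex^'a) $ j) = a k * (axis k 1 :: complex^'a) $ i" for i
  proof -
    have "(\<Sum>j\<in>UNIV. (if i = j then a i else 0) * (axis k 1 :: complex^'a) $ j)
       = (\<Sum>j\<in>UNIV. if i = j then a i * (axis k 1 :: complex^'a) $ j else 0)"
      by (intro sum.cong) auto
    also have "\<dots> = a k * (axis k 1 :: complex^'a) $ i" by (simp add: axis_def)
    finally show ?thesis .
  qed
  then show ?thesis by (simp add: diag_mat_def matrix_vector_mult_def vec_eq_iff)
qed

lemma mat_of_cols_mult_diag_mat: "mat_of_cols v ** diag_mat a = mat_of_cols (\<lambda>j. a j *s v j)"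
proof -
  have "(\<Sum>k\<in>UNIV. v k $ i * (if k = j then a k else 0)) = a j * v j $ i" for i j
  proof -
    have "(\<Sum>k\<in>UNIV. v k $ i * (if k = j then a k else 0)) = (\<Sum>k\<in>UNIV. if k = j then a k * v k $ i else 0)"
      by (intro sum.cong) auto
    then show ?thesis by simp
  qed
  then show ?thesis by (simp add: diag_mat_def mat_of_cols_def matrix_matrix_mult_def vec_eq_iff)
qed

lemma mult_mat_of_cols: "A ** mat_of_cols v = mat_of_cols (\<lambda>j. A *v v j)"
  by (simp add: mat_of_cols_def matrix_matrix_mult_def matrix_vector_mult_def vec_eq_iff)

lemma mat_of_cols_unitary:
  assumes "\<And>i j. cinner (v i) (v j) = (if i = j then 1 else 0)"
  shows "mat_of_cols v \<in> unitary_matrices"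
proof -
  have "(adjoint_mat (mat_of_cols v) ** mat_of_cols v) $ i $ j = cinner (v i) (v j)" for i j
    by (simp add: adjoint_mat_def mat_of_cols_def matrix_matrix_mult_def transpose_def cinner_def)
  then show ?thesis
    using assms by (simp add: unitary_matrices_def vec_eq_iff mat_def)
qed

text \<open>The vector p(A) v by Horner's scheme; it avoids powers of matrices and stays in every
  \<open>A\<close>-invariant subspace containing \<open>v\<close>.\<close>

definition poly_mat_apply :: "complex^'n^'n \<Rightarrow> complex^'n \<Rightarrow> complex poly \<Rightarrow> complex^'n" where
  "poly_mat_apply A v p = fold_coeffs (\<lambda>a u. a *s v + A *v u) p 0"

lemma poly_mat_apply_0 [simp]: "poly_mat_apply A v 0 = 0"
  by (simp add: poly_mat_apply_def)

lemma poly_mat_apply_pCons [simp]: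
  "poly_mat_apply A v (pCons a p) = a *s v + A *v poly_mat_apply A v p"
  by (cases "p = 0 \<and> a = 0") (auto simp: poly_mat_apply_def)

lemma poly_mat_apply_add: "poly_mat_apply A v (p + q) = poly_mat_apply A v p + poly_mat_apply A v q"
  by (induction p q rule: poly_induct2)
     (simp_all add: matrix_vector_right_distrib vector_sadd_rdistrib algebra_simps)

lemma poly_mat_apply_smult: "poly_mat_apply A v (smult c p) = c *s poly_mat_apply A v p"
  by (induction p) (simp_all add: vector_add_ldistrib vector_smult_assoc matrix_vector_mult_scaleR vec.scale algebra_simps)

lemma poly_mat_apply_monom: "poly_mat_apply A v (monom c n) = c *s (((*v) A) ^^ n) v"
  by (induction n) (simp_all add: monom_0 monom_Suc vec.scale)

lemma poly_mat_apply_sum: "poly_mat_apply A v (\<Sum>i\<in>I. p i) = (\<Sum>i\<in>I. poly_mat_apply A v (p i))"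
  by (induction I rule: infinite_finite_induct) (simp_all add: poly_mat_apply_add)

lemma poly_mat_apply_mem:
  assumes "vec.subspace S" "\<And>u. u \<in> S \<Longrightarrow> A *v u \<in> S" "v \<in> S"
  shows "poly_mat_apply A v p \<in> S"
  using assms by (induction p) (auto simp: vec.subspace_0 vec.subspace_add vec.subspace_scale)

text \<open>Among v, A v, A^2 v, ... either two vectors coincide, which gives a difference of two
  monomials, or the first \<open>CARD('n) + 1\<close> of them are distinct and hence linearly
  dependent.\<close>

lemma ex_annihilating_poly:
  fixes v :: "complex^'n"
  shows "\<exists>p. p \<noteq> 0 \<and> poly_mat_apply A v p = 0"
proof -
  define f where "f n = (((*v) A) ^^ n) v" for n
  show ?thesis
  proof (cases "inj f")
    case False
    then obtain i j where ij: "i \<noteq> j" "f i = f j" by (auto simp: inj_def)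
    define p :: "complex poly" where "p = monom 1 i + monom (- 1) j"
    have "coeff p i = 1" using ij by (simp add: p_def)
    then have "p \<noteq> 0" by auto
    moreover have "poly_mat_apply A v p = 0"
      using ij(2) by (simp add: p_def poly_mat_apply_add poly_mat_apply_monom f_def)
    ultimately show ?thesis by blast
  next
    case True
    define N where "N = CARD('n)"
    have card: "card (f ` {..N}) = Suc N"
      using True by (simp add: card_image inj_on_subset[of f UNIV])
    have "vec.dependent (f ` {..N})"
    proof (rule ccontr)
      assume "\<not> ?thesis"
      then have "card (f ` {..N}) \<le> vec.dim (UNIV :: (complex^'n) set)"
        by (intro vec.independent_card_le_dim) auto
      then show False using card by (simp add: N_def vec_dim_card del: vec.dim_UNIV)
    qed
    then obtain u where u: "\<exists>w\<in>f ` {..N}. u w \<noteq> 0" "(\<Sum>w\<in>f ` {..N}. u w *s w) = 0"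
      using vec.dependent_finite[of "f ` {..N}"] by auto
    then obtain k where k: "k \<le> N" "u (f k) \<noteq> 0" by auto
    have s: "(\<Sum>i\<le>N. u (f i) *s f i) = 0"
      using u(2) True by (subst (asm) sum.reindex) (auto intro: inj_on_subset)
    define p where "p = (\<Sum>i\<le>N. monom (u (f i)) i)"
    have "coeff p k = u (f k)" using k by (simp add: p_def coeff_sum)
    then have "p \<noteq> 0" using k by auto
    moreover have "poly_mat_apply A v p = 0"
      using s by (simp add: p_def poly_mat_apply_sum poly_mat_apply_monom f_def)
    ultimately show ?thesis by blast
  qed
qed

text \<open>Split a linear factor off a polynomial annihilating \<open>v\<close>: either the
  cofactor applied to \<open>v\<close> is an eigenvector for the root, or the cofactor annihilates
  \<open>v\<close> as well and has smaller degree. Working from a vector of \<open>S\<close> avoids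
  restricting \<open>A\<close> to \<open>S\<close> as a matrix.\<close>

lemma ex_eigenvector:
  fixes A :: "complex^'n^'n"
  assumes S: "vec.subspace S" "\<And>u. u \<in> S \<Longrightarrow> A *v u \<in> S" and v: "v \<in> S" "v \<noteq> 0"
  shows "\<exists>u c. u \<in> S \<and> u \<noteq> 0 \<and> A *v u = c *s u"
proof -
  have *: "\<exists>u c. u \<in> S \<and> u \<noteq> 0 \<and> A *v u = c *s u" if "p \<noteq> 0" "poly_mat_apply A v p = 0" for p
    using that
  proof (induction "degree p" arbitrary: p)
    case 0
    then obtain a where "p = [:a:]" by (metis degree_eq_zeroE)
    then show ?case using 0 v by simp
  next
    case (Suc n)
    obtain r where "poly p r = 0"
      using alg_closed_imp_poly_has_root[of p] Suc.hyps(2) by auto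
    then obtain q where q: "p = [:- r, 1:] * q" by (metis dvdE poly_eq_0_iff_dvd)
    define u where "u = poly_mat_apply A v q"
    have "poly_mat_apply A v p = A *v u - r *s u"
      unfolding q mult_pCons_left poly_mat_apply_add poly_mat_apply_smult u_def by simp
    then have eig: "A *v u = r *s u" using Suc.prems by simp
    show ?case
    proof (cases "u = 0")
      case True
      have q0: "q \<noteq> 0" using Suc.prems q by auto
      then have "degree p = Suc (degree q)" unfolding q by (subst degree_mult_eq) auto
      then show ?thesis using Suc.hyps True q0 by (auto simp: u_def)
    next
      case False
      moreover have "u \<in> S" unfolding u_def by (intro poly_mat_apply_mem S v)
      ultimately show ?thesis using eig by blast
    qed
  qed
  show ?thesis using ex_annihilating_poly[of A v] * by blast
qed

text \<open>The eigenspace of \<open>A\<close> inside \<open>S\<close> is invariant under the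
  commuting \<open>B\<close>, so it contains an eigenvector of \<open>B\<close>.\<close>

lemma ex_joint_eigenvector:
  fixes A B :: "complex^'n^'n"
  assumes S: "vec.subspace S" "\<And>u. u \<in> S \<Longrightarrow> A *v u \<in> S" "\<And>u. u \<in> S \<Longrightarrow> B *v u \<in> S"
    and v: "v \<in> S" "v \<noteq> 0" and comm: "A ** B = B ** A"
  shows "\<exists>u a b. u \<in> S \<and> u \<noteq> 0 \<and> A *v u = a *s u \<and> B *v u = b *s u"
proof -
  obtain u a where u: "u \<in> S" "u \<noteq> 0" "A *v u = a *s u"
    using ex_eigenvector[OF S(1,2) v] by blast
  define T where "T = {w \<in> S. A *v w = a *s w}"
  have T: "vec.subspace T"
    unfolding vec.subspace_def T_def
    using S(1) by (auto simp: vec.subspace_0 vec.subspace_add vec.subspace_scale matrix_vector_right_distrib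
        vector_add_ldistrib vec.scale vector_smult_assoc mult.commute)
  have "B *v w \<in> T" if "w \<in> T" for w
  proof -
    have "A *v (B *v w) = B *v (A *v w)"
      by (simp add: matrix_vector_mul_assoc comm)
    then show ?thesis using that S(3) by (simp add: T_def vec.scale)
  qed
  then show ?thesis
    using ex_eigenvector[OF T, of B u] u by (auto simp: T_def)
qed

lemma unitary_adjoint_eigenvector:
  assumes A: "A \<in> unitary_matrices" and v: "A *v v = a *s v" "v \<noteq> 0"
  shows "a \<noteq> 0" "adjoint_mat A *v v = inverse a *s v"
proof -
  have "v = adjoint_mat A *v (A *v v)"
    using A by (simp add: unitary_matrices_def matrix_vector_mul_assoc)
  then have *: "v = a *s (adjoint_mat A *v v)" by (simp add: v(1) vec.scale)
  then show "a \<noteq> 0" using v(2) by auto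
  then show "adjoint_mat A *v v = inverse a *s v"
    by (subst (2) *) (simp add: vector_smult_assoc)
qed

text \<open>An eigenvector of a unitary matrix is also one of its adjoint, so the orthogonal
  complement of joint eigenvectors is invariant under both matrices and contains a joint eigenvector
  unless it is 0.\<close>

lemma ex_orthogonal_joint_eigenvector:
  fixes A B :: "complex^'n^'n" and K :: "'n set"
  assumes A: "A \<in> unitary_matrices" and B: "B \<in> unitary_matrices" and comm: "A ** B = B ** A"
    and K: "K \<noteq> UNIV"
    and W: "\<And>k. k \<in> K \<Longrightarrow> W k \<noteq> 0 \<and> (\<exists>a. A *v W k = a *s W k) \<and> (\<exists>b. B *v W k = b *s W k)"
  obtains u a b where "cinner u u = 1" "A *v u = a *s u" "B *v u = b *s u"
    "\<And>k. k \<in> K \<Longrightarrow> cinner (W k) u = 0"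
proof -
  define S where "S = {u. \<forall>k\<in>K. cinner (W k) u = 0}"
  have S: "vec.subspace S"
    by (auto simp: vec.subspace_def S_def cinner_add_right cinner_scale_right)
  have inv: "C *v u \<in> S" if C: "C \<in> unitary_matrices" "\<And>k. k \<in> K \<Longrightarrow> \<exists>a. C *v W k = a *s W k" and u: "u \<in> S" for C u
    unfolding S_def
  proof (intro CollectI ballI)
    fix k assume k: "k \<in> K"
    then obtain a where "C *v W k = a *s W k" using C by blast
    then have "adjoint_mat C *v W k = inverse a *s W k"
      using unitary_adjoint_eigenvector[OF C(1)] W[OF k] by blast
    then show "cinner (W k) (C *v u) = 0"
      using u k by (simp add: cinner_matrix_vector_mult cinner_scale_left S_def)
  qed
  \<comment> \<open>The complement of fewer than \<open>CARD('n)\<close> vectors is nonzero: put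
    their conjugates into the rows indexed by \<open>K\<close>; a row outside \<open>K\<close> is
    zero, so \<open>M\<close> is singular, and its kernel lies in \<open>S\<close>.\<close>
  define M :: "complex^'n^'n" where "M = (\<chi> k j. if k \<in> K then cnj (W k $ j) else 0)"
  obtain k0 where k0: "k0 \<notin> K" using K by auto
  have "det M = 0"
    by (rule det_zero_row(1)[of k0]) (simp add: row_def M_def k0 vec_eq_iff)
  then have "\<not> (\<exists>N. N ** M = mat 1)"
    using invertible_det_nz[of M] by (auto simp: invertible_left_inverse)
  then obtain x where x: "M *v x = 0" "x \<noteq> 0"
    using matrix_left_invertible_ker[of M] by blast
  have "x \<in> S"
    unfolding S_def
  proof (intro CollectI ballI)
    fix k assume "k \<in> K"
    then have "(M *v x) $ k = cinner (W k) x"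
      by (simp add: M_def matrix_vector_mult_def cinner_def)
    then show "cinner (W k) x = 0" using x by simp
  qed
  then obtain u a b where u: "u \<in> S" "u \<noteq> 0" "A *v u = a *s u" "B *v u = b *s u"
    using ex_joint_eigenvector[OF S, of A B x] inv[OF A] inv[OF B] W comm x(2) by blast
  define w where "w = of_real (1 / norm u) *s u"
  have "cinner w w = 1"
    using u(2) unfolding w_def cinner_scale_left cinner_scale_right by (simp add: cinner_self power2_eq_square)
  moreover have "A *v w = a *s w" "B *v w = b *s w"
    using u by (simp_all add: w_def vec.scale vector_smult_assoc mult.commute)
  moreover have "cinner (W k) w = 0" if "k \<in> K" for k
    using u(1) that by (simp add: S_def w_def cinner_scale_right)
  ultimately show thesis using that by blast
qed

lemma ex_orthonormal_joint_eigenbasis: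
  fixes A B :: "complex^'n^'n"
  assumes "A \<in> unitary_matrices" "B \<in> unitary_matrices" "A ** B = B ** A"
  obtains v a b where "\<And>i j. cinner (v i) (v j) = (if i = j then 1 else 0)"
    "\<And>i :: 'n. A *v v i = a i *s v i" "\<And>i. B *v v i = b i *s v i"
proof -
  have "\<exists>v a b. (\<forall>i\<in>I. \<forall>j\<in>I. cinner (v i) (v j) = (if i = j then 1 else 0)) \<and>
     (\<forall>i\<in>I. A *v v i = a i *s v i \<and> B *v v i = b i *s v i)" for I :: "'n set"
    using finite[of I]
  proof (induction I rule: finite_induct)
    case (insert k I)
    then obtain v a b where v: "\<And>i j. i \<in> I \<Longrightarrow> j \<in> I \<Longrightarrow> cinner (v i) (v j) = (if i = j then 1 else 0)"
      "\<And>i. i \<in> I \<Longrightarrow> A *v v i = a i *s v i \<and> B *v v i = b i *s v i" by blast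
    have "v i \<noteq> 0" if "i \<in> I" for i using v(1)[OF that that] by auto
    then obtain u a' b' where u: "cinner u u = 1" "A *v u = a' *s u" "B *v u = b' *s u"
      "\<And>i. i \<in> I \<Longrightarrow> cinner (v i) u = 0"
      using ex_orthogonal_joint_eigenvector[OF assms, of I v] v(2) insert.hyps(2) by blast
    have u': "cinner u (v i) = 0" if "i \<in> I" for i
      using u(4)[OF that] by (subst cinner_commute) simp
    show ?case
      using u u' v insert.hyps(2)
      by (intro exI[of _ "v(k := u)"] exI[of _ "a(k := a')"] exI[of _ "b(k := b')"]) auto
  qed auto
  from this[of UNIV] show thesis using that by (elim exE conjE) blast
qed

section \<open>Conjugation in groups of unitary matrices\<close>

lemma inv_matrix_group:
  assumes "group (matrix_group S)" "S \<subseteq> unitary_matrices" "A \<in> S" "adjoint_mat A \<in> S"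
  shows "inv\<^bsub>matrix_group S\<^esub> A = adjoint_mat A"
  by (rule group.inv_equality[OF assms(1)]) (use assms in \<open>auto simp: matrix_group_def unitary_matrices_def\<close>)

text \<open>The intertwining form of conjugacy, since \<open>A ** g = g ** C\<close> is what
  eigenvector columns give with \<open>C\<close> diagonal. That \<open>C\<close> and
  \<open>D\<close> lie in the group and commute is inherited from \<open>A\<close> and
  \<open>B\<close>.\<close>

lemma conj_rel_matrix_groupI:
  assumes grp: "group (matrix_group S)" and S: "S \<subseteq> unitary_matrices" "\<And>A. A \<in> S \<Longrightarrow> adjoint_mat A \<in> S"
    and A: "A \<in> S" "B \<in> S" "A ** B = B ** A"
    and g: "g \<in> S" "A ** g = g ** C" "B ** g = g ** D"
  shows "((C, D), (A, B)) \<in> conj_rel (matrix_group S)"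
proof -
  interpret group "matrix_group S" by (rule grp)
  have gg: "adjoint_mat g ** g = mat 1" "g ** adjoint_mat g = mat 1"
    using S g(1) unitary_matrices_adjoint(2) by (auto simp: unitary_matrices_def)
  have inv: "inv\<^bsub>matrix_group S\<^esub> g = adjoint_mat g"
    using inv_matrix_group[OF grp S(1) g(1)] S g by blast
  have mem: "adjoint_mat g ** X ** g \<in> S" if "X \<in> S" for X
    using m_closed[of "adjoint_mat g ** X" g] m_closed[of "adjoint_mat g" X] that g(1) S(2)
    by (simp add: matrix_group_def)
  have "adjoint_mat g ** A ** g = C" "adjoint_mat g ** B ** g = D"
    unfolding matrix_mul_assoc[symmetric] g(2,3) by (simp_all add: matrix_mul_assoc gg)
  then have CD: "C \<in> S" "D \<in> S" "C = adjoint_mat g ** A ** g" "D = adjoint_mat g ** B ** g"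
    using mem A by auto
  have cancel: "g ** (adjoint_mat g ** X) = X" for X by (simp add: matrix_mul_assoc gg)
  have "C ** D = adjoint_mat g ** (A ** B) ** g" "D ** C = adjoint_mat g ** (B ** A) ** g"
    unfolding CD(3,4) by (simp_all add: matrix_mul_assoc[symmetric] cancel)
  then have "C ** D = D ** C" using A(3) by simp
  moreover have "A = g ** C ** adjoint_mat g" "B = g ** D ** adjoint_mat g"
    unfolding g(2,3)[symmetric] by (simp_all add: matrix_mul_assoc[symmetric] gg)
  ultimately show ?thesis
    using CD(1,2) g(1) inv by (auto simp: conj_rel_def Hom_Z2_def matrix_group_def intro!: bexI[of _ g])
qed

section \<open>Diagonalisation in the special unitary and symplectic groups\<close>

lemma SU_carrier: "carrier SU = {A \<in> unitary_matrices. det A = 1}"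
  by (simp add: SU_def matrix_group_def)

lemma Sp_carrier: "carrier Sp = {A \<in> unitary_matrices. transpose A ** symplectic_J ** A = symplectic_J}"
  by (simp add: Sp_def matrix_group_def)

lemma Hom_Z2_SU: "Hom_Z2 SU = {(A, B). A \<in> carrier SU \<and> B \<in> carrier SU \<and> A ** B = B ** A}"
  by (simp add: Hom_Z2_def SU_def matrix_group_def)

lemma Hom_Z2_Sp: "Hom_Z2 Sp = {(A, B). A \<in> carrier Sp \<and> B \<in> carrier Sp \<and> A ** B = B ** A}"
  by (simp add: Hom_Z2_def Sp_def matrix_group_def)

lemma SU_adjoint: "A \<in> carrier SU \<Longrightarrow> adjoint_mat A \<in> carrier SU"
  unfolding SU_carrier
proof -
  assume "A \<in> {A \<in> unitary_matrices. det A = 1}"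
  then have A: "A \<in> unitary_matrices" "det A = 1" by auto
  have "det (adjoint_mat A) * det A = det (mat 1 :: complex^'a^'a)"
    using A(1) by (simp add: unitary_matrices_def flip: det_mul)
  then show "adjoint_mat A \<in> {A \<in> unitary_matrices. det A = 1}"
    using A by (simp add: unitary_matrices_adjoint)
qed

lemma cnj_mult_self_eq_1_iff: "cnj z * z = 1 \<longleftrightarrow> cmod z = 1"
proof -
  have "cnj z * z = of_real ((cmod z)\<^sup>2)"
    by (simp only: complex_norm_square mult.commute)
  then have "cnj z * z = 1 \<longleftrightarrow> (cmod z)\<^sup>2 = 1"
    by (simp only: of_real_eq_1_iff)
  also have "\<dots> \<longleftrightarrow> cmod z = 1"
    using power2_eq_imp_eq[of "cmod z" 1] by auto
  finally show ?thesis .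
qed

lemma diag_mat_commute: "diag_mat a ** diag_mat b = diag_mat b ** diag_mat a"
  by (simp add: diag_mat_mult mult.commute)

lemma diag_mat_unitary_iff: "diag_mat a \<in> unitary_matrices \<longleftrightarrow> (\<forall>i. cmod (a i) = 1)"
proof -
  have "diag_mat a \<in> unitary_matrices \<longleftrightarrow> (\<lambda>i. cnj (a i) * a i) = (\<lambda>_. 1)"
    by (simp add: unitary_matrices_def adjoint_diag_mat diag_mat_mult diag_mat_one[symmetric] diag_mat_eq_iff)
  also have "\<dots> \<longleftrightarrow> (\<forall>i. cmod (a i) = 1)"
    by (simp add: fun_eq_iff cnj_mult_self_eq_1_iff)
  finally show ?thesis .
qed

lemma diag_mat_SU_iff: "diag_mat a \<in> carrier SU \<longleftrightarrow> (\<forall>i. cmod (a i) = 1) \<and> (\<Prod>i\<in>UNIV. a i) = 1"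
  by (simp add: SU_carrier diag_mat_unitary_iff det_diag_mat)

lemma det_map_cnj: "det (map_matrix cnj A) = cnj (det A)"
  by (simp add: det_def map_matrix_def)

text \<open>The matrix of eigenvectors is unitary, but its determinant is any phase. Rescaling one
  column by the conjugate phase corrects this and commutes with the diagonal matrices.\<close>

lemma SU_conj_rel_diag:
  fixes A B :: "complex^'n^'n"
  assumes AB: "(A, B) \<in> Hom_Z2 SU"
    and v: "\<And>i j. cinner (v i) (v j) = (if i = j then 1 else 0)"
    and ab: "\<And>i. A *v v i = a i *s v i" "\<And>i. B *v v i = b i *s v i"
  shows "((diag_mat a, diag_mat b), (A, B)) \<in> conj_rel SU"
proof -
  define U where "U = mat_of_cols v"
  have U: "U \<in> unitary_matrices" unfolding U_def by (rule mat_of_cols_unitary) (rule v)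
  have "adjoint_mat U ** U = mat 1" using U by (simp add: unitary_matrices_def)
  then have "det (adjoint_mat U) * det U = 1" by (metis det_I det_mul)
  moreover have "det (adjoint_mat U) = cnj (det U)"
    unfolding adjoint_mat_def by (simp add: det_map_cnj)
  ultimately have d: "cnj (det U) * det U = 1" by simp
  \<comment> \<open>Any index will do; it selects the column that absorbs the phase.\<close>
  obtain k :: 'n where True by blast
  define e where "e i = (if i = k then cnj (det U) else 1)" for i
  have "cmod (det U) = 1"
    using d by (simp only: cnj_mult_self_eq_1_iff)
  then have E: "diag_mat e \<in> unitary_matrices" by (simp add: diag_mat_unitary_iff e_def)
  have "(\<Prod>i\<in>UNIV. e i) = cnj (det U)" by (simp add: e_def)
  then have "det (U ** diag_mat e) = 1" using d by (simp add: det_mul det_diag_mat mult.commute)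
  then have g: "U ** diag_mat e \<in> carrier SU"
    using unitary_matrices_mult[OF U E] by (simp add: SU_carrier)
  have swap: "C ** (U ** diag_mat e) = (U ** diag_mat e) ** diag_mat c" if "\<And>i. C *v v i = c i *s v i" for C c
  proof -
    have "C ** U = U ** diag_mat c"
      unfolding U_def mult_mat_of_cols mat_of_cols_mult_diag_mat by (simp add: that)
    then have "C ** (U ** diag_mat e) = U ** (diag_mat c ** diag_mat e)"
      by (simp add: matrix_mul_assoc)
    also have "\<dots> = (U ** diag_mat e) ** diag_mat c"
      by (simp add: diag_mat_mult mult.commute flip: matrix_mul_assoc)
    finally show ?thesis .
  qed
  show ?thesis
    unfolding SU_def
  proof (rule conj_rel_matrix_groupI)
    show "group (matrix_group {A :: complex^'n^'n. A \<in> unitary_matrices \<and> det A = 1})"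
      using group_SU by (simp add: SU_def)
  qed (use AB g SU_adjoint swap ab in \<open>auto simp: Hom_Z2_SU SU_carrier\<close>)
qed

lemma SU_conj_diagonal:
  fixes A B :: "complex^'n^'n"
  assumes AB: "(A, B) \<in> Hom_Z2 SU"
  obtains a b where "\<And>i. cmod (a i) = 1" "\<And>i. cmod (b i) = 1"
    "(\<Prod>i\<in>UNIV. a i) = 1" "(\<Prod>i\<in>UNIV. b i) = 1" "((diag_mat a, diag_mat b), (A, B)) \<in> conj_rel SU"
proof -
  have "A \<in> unitary_matrices" "B \<in> unitary_matrices" "A ** B = B ** A"
    using AB by (auto simp: Hom_Z2_SU SU_carrier)
  then obtain v a b where v: "\<And>i j. cinner (v i) (v j) = (if i = j then 1 else 0)"
    "\<And>i :: 'n. A *v v i = a i *s v i" "\<And>i. B *v v i = b i *s v i"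
    using ex_orthonormal_joint_eigenbasis by blast
  have c: "((diag_mat a, diag_mat b), (A, B)) \<in> conj_rel SU"
    by (rule SU_conj_rel_diag[OF AB v])
  then have "diag_mat a \<in> carrier SU" "diag_mat b \<in> carrier SU"
    by (auto simp: conj_rel_def Hom_Z2_def)
  then show thesis using that[of a b] c by (simp add: diag_mat_SU_iff)
qed

text \<open>The Weyl group action, from the permuted standard basis as eigenbasis; the determinant
  -1 of an odd permutation is corrected inside \<open>SU_conj_rel_diag\<close>.\<close>

lemma SU_conj_permuted_diagonal:
  assumes "(diag_mat a, diag_mat b) \<in> Hom_Z2 SU" "\<sigma> permutes UNIV"
  shows "((diag_mat (\<lambda>i. a (\<sigma> i)), diag_mat (\<lambda>i. b (\<sigma> i))), (diag_mat a, diag_mat b)) \<in> conj_rel SU"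
  by (rule SU_conj_rel_diag[OF assms(1), of "\<lambda>i. axis (\<sigma> i) 1"])
     (use assms(2) in \<open>auto simp: cinner_axis diag_mat_axis permutes_inj inj_eq\<close>)

text \<open>Right multiplication by the quaternion \<open>j\<close> on \<open>\<complex>\<^bsup>2m\<^esup>\<close>.\<close>

definition quat_j :: "complex^('m::finite + 'm) \<Rightarrow> complex^('m + 'm)" where
  "quat_j v = (\<chi> k. case k of Inl a \<Rightarrow> - cnj (v $ Inr a) | Inr a \<Rightarrow> cnj (v $ Inl a))"

lemma sum_UNIV_Plus:
  "(\<Sum>k\<in>(UNIV :: ('a::finite + 'b::finite) set). f k) = (\<Sum>a\<in>UNIV. f (Inl a)) + (\<Sum>b\<in>UNIV. f (Inr b))"
  by (subst UNIV_Plus_UNIV[symmetric], subst sum.Plus) (simp_all add: o_def)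

lemma prod_UNIV_Plus:
  "(\<Prod>k\<in>(UNIV :: ('a::finite + 'b::finite) set). f k) = (\<Prod>a\<in>UNIV. f (Inl a)) * (\<Prod>b\<in>UNIV. f (Inr b))"
  by (subst UNIV_Plus_UNIV[symmetric], subst prod.Plus) (simp_all add: o_def)

lemma quat_j_quat_j [simp]: "quat_j (quat_j v) = - v"
  by (simp add: quat_j_def vec_eq_iff split: sum.split)

lemma quat_j_scale: "quat_j (c *s v) = cnj c *s quat_j v"
  by (simp add: quat_j_def vec_eq_iff split: sum.split)

lemma quat_j_eq_0_iff: "quat_j v = 0 \<longleftrightarrow> v = 0"
  by (metis neg_equal_0_iff_equal quat_j_quat_j quat_j_scale vector_smult_lzero complex_cnj_zero)

lemma cinner_quat_j: "cinner (quat_j v) (quat_j w) = cnj (cinner v w)"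
  by (simp add: cinner_def quat_j_def sum_UNIV_Plus add.commute)

text \<open>Antisymmetry makes every vector orthogonal to its own image under \<open>quat_j\<close>,
  so \<open>v\<close> and \<open>quat_j v\<close> can belong to one orthonormal basis.\<close>

lemma cinner_quat_j_right: "cinner v (quat_j w) = - cinner w (quat_j v)"
  by (simp add: cinner_def quat_j_def sum_UNIV_Plus sum_negf mult.commute)

lemma cinner_quat_j_self [simp]: "cinner v (quat_j v) = 0" "cinner (quat_j v) v = 0"
proof -
  show *: "cinner v (quat_j v) = 0" using cinner_quat_j_right[of v v] by simp
  then show "cinner (quat_j v) v = 0" by (subst cinner_commute) simp
qed

lemma symplectic_J_mult: "symplectic_J *v v = (\<chi> k. case k of Inl a \<Rightarrow> v $ Inr a | Inr a \<Rightarrow> - v $ Inl a)"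
proof -
  have 1: "(\<Sum>b\<in>UNIV. (if a = b then 1 else 0) * f b) = f a" for a :: 'a and f :: "'a \<Rightarrow> complex"
    by (simp add: if_distrib[of "\<lambda>x. x * _"] cong: if_cong)
  have 2: "(\<Sum>b\<in>UNIV. (if a = b then - 1 else 0) * f b) = - f a" for a :: 'a and f :: "'a \<Rightarrow> complex"
    by (simp add: if_distrib[of "\<lambda>x. x * _"] cong: if_cong)
  show ?thesis
    by (auto simp: vec_eq_iff symplectic_J_def matrix_vector_mult_def sum_UNIV_Plus 1 2 split: sum.split)
qed

lemma quat_j_eq: "quat_j v = - (symplectic_J *v (\<chi> k. cnj (v $ k)))"
  by (simp add: symplectic_J_mult quat_j_def vec_eq_iff split: sum.split)

lemma matrix_vector_mult_minus:
  fixes A :: "complex^'n^'m"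
  shows "(- A) *v v = - (A *v v)" "A *v (- v) = - (A *v v)"
  by (simp_all add: matrix_vector_mult_def vec_eq_iff sum_negf)

lemma symplectic_J_squared: "symplectic_J ** symplectic_J = - mat 1"
proof -
  have "(symplectic_J ** symplectic_J) *v v = (- mat 1) *v v" for v :: "complex^('a + 'a)"
  proof -
    have "(symplectic_J ** symplectic_J) *v v = - v"
      by (simp add: symplectic_J_mult vec_eq_iff flip: matrix_vector_mul_assoc split: sum.split)
    also have "- v = (- mat 1) *v v"
      by (metis matrix_vector_mul_lid matrix_vector_mult_minus(1))
    finally show ?thesis .
  qed
  then show ?thesis by (simp add: matrix_eq)
qed

text \<open>Unitarity makes the entrywise conjugate inverse to the transpose, so the symplectic
  condition becomes J A = cnj(A) J: the matrix is quaternionic linear. Consequently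
  \<open>quat_j\<close> maps eigenvectors to eigenvectors with the conjugate eigenvalue.\<close>

lemma Sp_quat_j_commute:
  fixes A :: "complex^('m::finite + 'm)^('m + 'm)"
  assumes "A \<in> carrier Sp"
  shows "A *v quat_j v = quat_j (A *v v)"
proof -
  have A: "A ** adjoint_mat A = mat 1" "transpose A ** symplectic_J ** A = symplectic_J"
    using assms unitary_matrices_adjoint(2) by (auto simp: Sp_carrier)
  define C where "C = transpose (adjoint_mat A)"
  have C: "C $ i $ k = cnj (A $ i $ k)" for i k
    by (simp add: C_def adjoint_mat_def transpose_def)
  have "C ** transpose A = transpose (A ** adjoint_mat A)"
    by (simp add: C_def matrix_transpose_mul)
  then have CA: "C ** transpose A = mat 1" by (simp add: A(1) transpose_mat)
  have "C ** symplectic_J = C ** (transpose A ** symplectic_J ** A)" by (simp add: A(2))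
  also have "\<dots> = C ** transpose A ** symplectic_J ** A" by (simp add: matrix_mul_assoc)
  also have "\<dots> = symplectic_J ** A" by (simp add: CA)
  finally have JA: "symplectic_J ** A = C ** symplectic_J" by simp
  have cA: "(\<chi> k. cnj ((A *v v) $ k)) = C *v (\<chi> k. cnj (v $ k))"
    by (simp add: vec_eq_iff matrix_vector_mult_def C)
  \<comment> \<open>Multiplying by J on both sides and using J^2 = -1 moves J to the other side of
    \<open>A\<close> and \<open>C\<close>.\<close>
  have "symplectic_J ** (symplectic_J ** A) ** symplectic_J = symplectic_J ** C ** (symplectic_J ** symplectic_J)"
    by (simp add: JA matrix_mul_assoc)
  then have "(symplectic_J ** symplectic_J) ** (A ** symplectic_J) = symplectic_J ** C ** (symplectic_J ** symplectic_J)"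
    by (simp add: matrix_mul_assoc)
  moreover have neg: "(- mat 1) ** X = - X" "X ** (- mat 1) = - X" for X :: "complex^('m::finite + 'm)^('m + 'm)"
    by (simp_all add: matrix_matrix_mult_def vec_eq_iff mat_def sum_negf if_distrib[of "\<lambda>x. x * _"]
        if_distrib[of "\<lambda>x. _ * x"] if_distrib[of uminus] cong: if_cong)
  ultimately have AJ: "A ** symplectic_J = symplectic_J ** C"
    unfolding symplectic_J_squared neg by simp
  have "A *v quat_j v = - ((A ** symplectic_J) *v (\<chi> k. cnj (v $ k)))"
    by (simp add: quat_j_eq matrix_vector_mul_assoc matrix_vector_mult_minus(2))
  also have "\<dots> = quat_j (A *v v)"
    by (simp add: AJ quat_j_eq cA matrix_vector_mul_assoc)
  finally show ?thesis .
qed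

text \<open>Entry (k, l) of the transformed form is \<open>cinner (quat_j (V k)) (V l)\<close>,
  which the orthonormality of a basis closed up to sign under \<open>quat_j\<close> evaluates to the
  entry of J.\<close>

lemma Sp_mat_of_cols:
  fixes V :: "'m::finite + 'm \<Rightarrow> complex^('m + 'm)"
  assumes V: "\<And>k l. cinner (V k) (V l) = (if k = l then 1 else 0)"
    and j: "\<And>i. V (Inr i) = quat_j (V (Inl i))"
  shows "mat_of_cols V \<in> carrier Sp"
proof -
  let ?U = "mat_of_cols V"
  have J: "(\<Sum>x\<in>UNIV. v $ x * (symplectic_J *v w) $ x) = cinner (quat_j v) w" for v w :: "complex^('m + 'm)"
    by (simp add: symplectic_J_mult cinner_def quat_j_def sum_UNIV_Plus sum_negf)
  have tr: "(w v* ?U) $ k = (\<Sum>x\<in>UNIV. V k $ x * w $ x)" for w k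
    by (simp add: vector_matrix_mult_def mat_of_cols_def mult.commute)
  have entry: "mat_of_cols W $ k $ l = W l $ k" for W :: "'m + 'm \<Rightarrow> complex^('m + 'm)" and k l
    by (simp add: mat_of_cols_def)
  have "(transpose ?U ** symplectic_J ** ?U) $ k $ l = symplectic_J $ k $ l" for k l
  proof -
    have "(transpose ?U ** symplectic_J ** ?U) $ k $ l = (transpose ?U ** (symplectic_J ** ?U)) $ k $ l"
      by (simp add: matrix_mul_assoc)
    also have "\<dots> = (\<Sum>x\<in>UNIV. V k $ x * (symplectic_J *v V l) $ x)"
      by (simp add: mult_mat_of_cols entry tr)
    also have "\<dots> = cinner (quat_j (V k)) (V l)" by (rule J)
    also have "\<dots> = symplectic_J $ k $ l"
    proof (cases k)
      case (Inl i)
      then show ?thesis unfolding Inl j[symmetric] V by (simp add: symplectic_J_def split: sum.split)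
    next
      case (Inr i)
      then show ?thesis unfolding Inr j quat_j_quat_j cinner_minus_left V
        by (simp add: symplectic_J_def split: sum.split)
    qed
    finally show ?thesis .
  qed
  then show ?thesis
    using mat_of_cols_unitary[of V] V by (simp add: Sp_carrier vec_eq_iff)
qed

text \<open>The eigenvalue pattern of a quaternionic diagonal matrix: \<open>a i\<close> on a basis
  vector, its conjugate on the image under \<open>quat_j\<close>.\<close>

definition quat_diag :: "('m \<Rightarrow> complex) \<Rightarrow> 'm + 'm \<Rightarrow> complex" where
  "quat_diag a k = (case k of Inl i \<Rightarrow> a i | Inr i \<Rightarrow> cnj (a i))"

lemma diag_quat_diag_Sp:
  assumes "\<And>i :: 'm::finite. cmod (a i) = 1"
  shows "diag_mat (quat_diag a) \<in> carrier Sp"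
proof -
  have "mat_of_cols (\<lambda>k. quat_diag a k *s axis k 1) \<in> carrier Sp"
  proof (rule Sp_mat_of_cols)
    have "cnj (quat_diag a k) * quat_diag a k = 1" for k
      using assms by (simp add: cnj_mult_self_eq_1_iff quat_diag_def split: sum.split)
    then show "cinner (quat_diag a k *s axis k 1) (quat_diag a l *s axis l 1) = (if k = l then 1 else 0)" for k l
      by (auto simp: cinner_scale_left cinner_scale_right cinner_axis mult.commute)
    show "quat_diag a (Inr i) *s axis (Inr i) 1 = quat_j (quat_diag a (Inl i) *s axis (Inl i) 1)" for i
      by (simp add: quat_diag_def quat_j_def vec_eq_iff axis_def split: sum.split)
  qed
  also have "mat_of_cols (\<lambda>k. quat_diag a k *s axis k 1) = diag_mat (quat_diag a)"
    by (simp add: mat_of_cols_def diag_mat_def vec_eq_iff axis_def)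
  finally show ?thesis .
qed

lemma Sp_adjoint: "A \<in> carrier Sp \<Longrightarrow> adjoint_mat A \<in> carrier Sp"
proof -
  let ?J = "symplectic_J :: complex^('m::finite + 'm)^('m + 'm)"
  assume A: "A \<in> carrier Sp"
  have A': "A \<in> unitary_matrices" "transpose A ** ?J ** A = ?J" using A by (auto simp: Sp_carrier)
  have AA: "A ** adjoint_mat A = mat 1" using A' by (simp add: unitary_matrices_adjoint)
  have "transpose (adjoint_mat A) ** transpose A = mat 1"
    by (metis AA matrix_transpose_mul transpose_mat)
  then have "?J = transpose (adjoint_mat A) ** transpose A ** ?J ** (A ** adjoint_mat A)"
    using AA by simp
  also have "\<dots> = transpose (adjoint_mat A) ** (transpose A ** ?J ** A) ** adjoint_mat A"
    by (simp add: matrix_mul_assoc)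
  finally show ?thesis
    using A' by (simp add: Sp_carrier unitary_matrices_adjoint)
qed

lemma Sp_conj_rel_diag:
  fixes v :: "'m::finite \<Rightarrow> complex^('m + 'm)"
  assumes AB: "(A, B) \<in> Hom_Z2 Sp"
    and v: "\<And>i j. cinner (v i) (v j) = (if i = j then 1 else 0)" "\<And>i j. cinner (v i) (quat_j (v j)) = 0"
    and ab: "\<And>i. A *v v i = a i *s v i" "\<And>i. B *v v i = b i *s v i"
  shows "((diag_mat (quat_diag a), diag_mat (quat_diag b)), (A, B)) \<in> conj_rel Sp"
proof -
  define V where "V k = (case k of Inl i \<Rightarrow> v i | Inr i \<Rightarrow> quat_j (v i))" for k
  have v': "cinner (quat_j (v i)) (v j) = 0" for i j
    using v(2)[of j i] by (subst cinner_commute) simp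
  have U: "mat_of_cols V \<in> carrier Sp"
    by (rule Sp_mat_of_cols) (auto simp: V_def v v' cinner_quat_j split: sum.split)
  have swap: "C ** mat_of_cols V = mat_of_cols V ** diag_mat (quat_diag c)"
    if "C \<in> carrier Sp" "\<And>i. C *v v i = c i *s v i" for C c
  proof -
    have "C *v V k = quat_diag c k *s V k" for k
      by (simp add: V_def quat_diag_def that Sp_quat_j_commute quat_j_scale split: sum.split)
    then show ?thesis unfolding mult_mat_of_cols mat_of_cols_mult_diag_mat by simp
  qed
  show ?thesis
    unfolding Sp_def
  proof (rule conj_rel_matrix_groupI)
    show "group (matrix_group {A :: complex^('m + 'm)^('m + 'm).
        A \<in> unitary_matrices \<and> transpose A ** symplectic_J ** A = symplectic_J})"
      using group_Sp by (simp add: Sp_def)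
    show "A ** mat_of_cols V = mat_of_cols V ** diag_mat (quat_diag a)"
      "B ** mat_of_cols V = mat_of_cols V ** diag_mat (quat_diag b)"
      using swap AB ab by (auto simp: Hom_Z2_Sp)
  qed (use AB U Sp_adjoint in \<open>auto simp: Hom_Z2_Sp Sp_carrier\<close>)
qed

lemma Sp_conj_diagonal:
  fixes A B :: "complex^('m::finite + 'm)^('m + 'm)"
  assumes AB: "(A, B) \<in> Hom_Z2 Sp"
  obtains a b :: "'m \<Rightarrow> complex" where "\<And>i. cmod (a i) = 1" "\<And>i. cmod (b i) = 1"
    "((diag_mat (quat_diag a), diag_mat (quat_diag b)), (A, B)) \<in> conj_rel Sp"
proof -
  have u: "A \<in> unitary_matrices" "B \<in> unitary_matrices" "A ** B = B ** A"
    and Sp: "A \<in> carrier Sp" "B \<in> carrier Sp"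
    using AB by (auto simp: Hom_Z2_Sp Sp_carrier)
  have "\<exists>v a b. (\<forall>i\<in>I. \<forall>j\<in>I. cinner (v i) (v j) = (if i = j then 1 else 0) \<and> cinner (v i) (quat_j (v j)) = 0) \<and>
     (\<forall>i\<in>I. A *v v i = a i *s v i \<and> B *v v i = b i *s v i)" for I :: "'m set"
    using finite[of I]
  proof (induction I rule: finite_induct)
    case (insert k I)
    then obtain v a b where v: "\<And>i j. i \<in> I \<Longrightarrow> j \<in> I \<Longrightarrow> cinner (v i) (v j) = (if i = j then 1 else 0)"
      "\<And>i j. i \<in> I \<Longrightarrow> j \<in> I \<Longrightarrow> cinner (v i) (quat_j (v j)) = 0"
      "\<And>i. i \<in> I \<Longrightarrow> A *v v i = a i *s v i \<and> B *v v i = b i *s v i" by blast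
    \<comment> \<open>The next vector has to be orthogonal to the chosen vectors and to their images
      under \<open>quat_j\<close>; these are indexed by \<open>I <+> I\<close>, still a proper
      subset of the index type because \<open>k\<close> is left out.\<close>
    define W where "W l = (case l of Inl i \<Rightarrow> v i | Inr i \<Rightarrow> quat_j (v i))" for l
    have v0: "v i \<noteq> 0" if "i \<in> I" for i using v(1)[OF that that] by auto
    have "W l \<noteq> 0 \<and> (\<exists>a. A *v W l = a *s W l) \<and> (\<exists>b. B *v W l = b *s W l)" if "l \<in> I <+> I" for l
      using that v0 v(3) unfolding W_def
      by (elim PlusE) (auto simp: quat_j_eq_0_iff Sp_quat_j_commute[OF Sp(1)] Sp_quat_j_commute[OF Sp(2)] quat_j_scale)
    moreover have "I <+> I \<noteq> UNIV" using insert.hyps(2) by auto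
    ultimately obtain u a' b' where u: "cinner u u = 1" "A *v u = a' *s u" "B *v u = b' *s u"
      "\<And>l. l \<in> I <+> I \<Longrightarrow> cinner (W l) u = 0"
      using ex_orthogonal_joint_eigenvector[OF u, of "I <+> I" W] by blast
    have u1: "cinner (v i) u = 0" "cinner (quat_j (v i)) u = 0" if "i \<in> I" for i
      using u(4)[of "Inl i"] u(4)[of "Inr i"] that by (auto simp: W_def)
    have u2: "cinner u (v i) = 0" "cinner u (quat_j (v i)) = 0" if "i \<in> I" for i
      using u1[OF that] cinner_commute[of u "v i"] cinner_commute[of u "quat_j (v i)"] by auto
    \<comment> \<open>Orthogonality of \<open>quat_j u\<close> to the earlier vectors comes for
      free, by antisymmetry.\<close>
    have u3: "cinner (v i) (quat_j u) = 0" if "i \<in> I" for i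
      using u2(2)[OF that] cinner_quat_j_right[of "v i" u] by simp
    show ?case
      using u u1 u2 u3 v insert.hyps(2)
      by (intro exI[of _ "v(k := u)"] exI[of _ "a(k := a')"] exI[of _ "b(k := b')"]) auto
  qed auto
  from this[of UNIV] obtain v :: "'m \<Rightarrow> complex^('m + 'm)" and a b where
    v: "\<And>i j. cinner (v i) (v j) = (if i = j then 1 else 0)" "\<And>i j. cinner (v i) (quat_j (v j)) = 0"
    "\<And>i. A *v v i = a i *s v i" "\<And>i. B *v v i = b i *s v i" by (elim exE conjE) blast
  have c: "((diag_mat (quat_diag a), diag_mat (quat_diag b)), (A, B)) \<in> conj_rel Sp"
    by (rule Sp_conj_rel_diag[OF AB v])
  then have "diag_mat (quat_diag a) \<in> unitary_matrices" "diag_mat (quat_diag b) \<in> unitary_matrices"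
    by (auto simp: conj_rel_def Hom_Z2_Sp Sp_carrier)
  then have "cmod (quat_diag a (Inl i)) = 1" "cmod (quat_diag b (Inl i)) = 1" for i
    unfolding diag_mat_unitary_iff by blast+
  then show thesis using that[of a b] c by (simp add: quat_diag_def)
qed

text \<open>The Weyl group of signed permutations. Where \<open>e i\<close> fails, the basis vector
  is replaced by the one in the \<open>Inr\<close> half, which carries the conjugate eigenvalues of
  both matrices at once.\<close>

lemma Sp_conj_permuted_diagonal:
  fixes a b :: "'m::finite \<Rightarrow> complex"
  assumes "(diag_mat (quat_diag a), diag_mat (quat_diag b)) \<in> Hom_Z2 Sp" "\<sigma> permutes UNIV"
  shows "((diag_mat (quat_diag (\<lambda>i. if e i then a (\<sigma> i) else cnj (a (\<sigma> i)))),
           diag_mat (quat_diag (\<lambda>i. if e i then b (\<sigma> i) else cnj (b (\<sigma> i))))),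
          (diag_mat (quat_diag a), diag_mat (quat_diag b))) \<in> conj_rel Sp"
proof -
  define v :: "'m \<Rightarrow> complex^('m + 'm)" where "v i = axis (if e i then Inl (\<sigma> i) else Inr (\<sigma> i)) 1" for i
  have inj: "\<sigma> i = \<sigma> j \<longleftrightarrow> i = j" for i j
    using assms(2) by (simp add: permutes_inj inj_eq)
  have j: "quat_j (v i) = (if e i then axis (Inr (\<sigma> i)) 1 else - axis (Inl (\<sigma> i)) 1)" for i
    by (simp add: v_def quat_j_def vec_eq_iff axis_def split: sum.split)
  show ?thesis
  proof (rule Sp_conj_rel_diag[OF assms(1), of v])
    show "cinner (v i) (v j) = (if i = j then 1 else 0)" for i j
      by (auto simp: v_def cinner_axis inj)
    show "cinner (v i) (quat_j (v j)) = 0" for i j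
      unfolding j by (auto simp: v_def cinner_axis inj cinner_minus_right)
  qed (simp_all add: v_def diag_mat_axis quat_diag_def)
qed

text \<open>Its values separate the conjugacy classes, which makes the orbit space Hausdorff.\<close>

definition joint_char_poly :: "complex \<times> complex \<times> complex \<Rightarrow> (complex^'n^'n) \<times> (complex^'n^'n) \<Rightarrow> complex" where
  "joint_char_poly l p = (case l of (x, y, z) \<Rightarrow> det (mat x + mat y ** fst p + mat z ** snd p))"

lemma continuous_on_joint_char_poly: "continuous_on S (joint_char_poly l)"
  unfolding joint_char_poly_def det_def matrix_matrix_mult_def
  by (cases l) (auto intro!: continuous_intros)

lemma joint_char_poly_diag:
  "joint_char_poly (x, y, z) (diag_mat a, diag_mat b) = (\<Prod>i\<in>UNIV. x + y * a i + z * b i)"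
  by (simp add: joint_char_poly_def mat_eq_diag_mat diag_mat_mult diag_mat_add det_diag_mat)

lemma mat_commute: "mat c ** A = A ** mat (c :: complex)"
  by (simp add: vec_eq_iff matrix_matrix_mult_def mat_def if_distrib[of "\<lambda>x. x * _"]
      if_distrib[of "\<lambda>x. _ * x"] mult.commute cong: if_cong)

lemma matrix_add_rdistrib: "(A + B) ** (C :: complex^'n^'m) = A ** C + B ** C"
  by (simp add: matrix_matrix_mult_def vec_eq_iff distrib_right sum.distrib)

lemma joint_char_poly_conj_rel:
  assumes grp: "group (matrix_group S)" and S: "S \<subseteq> unitary_matrices" "\<And>A. A \<in> S \<Longrightarrow> adjoint_mat A \<in> S"
    and pq: "(p, q) \<in> conj_rel (matrix_group S)"
  shows "joint_char_poly l p = joint_char_poly l q"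
proof -
  obtain A B g where p: "p = (A, B)" and g: "g \<in> S"
    and q: "q = (g ** A ** adjoint_mat g, g ** B ** adjoint_mat g)"
    using pq inv_matrix_group[OF grp S(1)] S(2) by (auto simp: conj_rel_def matrix_group_def)
  obtain x y z where l: "l = (x, y, z)" by (cases l)
  have gg: "g ** adjoint_mat g = mat 1" using S(1) g unitary_matrices_adjoint(2) by blast
  have "mat c ** (g ** X ** adjoint_mat g) = g ** (mat c ** X) ** adjoint_mat g" for c X
    by (simp add: matrix_mul_assoc mat_commute[of c g])
  moreover have "mat x = g ** mat x ** adjoint_mat g"
  proof -
    have "mat x ** (g ** adjoint_mat g) = g ** mat x ** adjoint_mat g"
      by (simp only: mat_commute[of x g] matrix_mul_assoc)
    then show ?thesis by (simp add: gg)
  qed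
  ultimately have "mat x + mat y ** fst q + mat z ** snd q
      = g ** (mat x + mat y ** A + mat z ** B) ** adjoint_mat g"
    by (simp add: q matrix_add_ldistrib matrix_add_rdistrib)
  moreover have "det g * det (adjoint_mat g) = 1"
    using gg by (metis det_I det_mul)
  ultimately show ?thesis
    by (simp add: joint_char_poly_def l p det_mul)
qed

text \<open>For generic \<open>z\<close> the number \<open>a i + z * b i\<close> determines the
  pair, so matching the linear factors of a one-variable polynomial matches the pairs by a single
  permutation.\<close>

lemma joint_char_poly_diag_eq_imp_permuted:
  fixes a b a' b' :: "'n::finite \<Rightarrow> complex"
  assumes "\<And>l. joint_char_poly l (diag_mat a, diag_mat b) = joint_char_poly l (diag_mat a', diag_mat b')"
  obtains \<sigma> where "\<sigma> permutes UNIV" "\<And>i. a i = a' (\<sigma> i)" "\<And>i. b i = b' (\<sigma> i)"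
proof -
  \<comment> \<open>The finitely many values of \<open>z\<close> at which two pairs with different
    second entries collide. A zero denominator merely contributes the value 0.\<close>
  define T where "T = (\<lambda>(i, j). (a' j - a i) / (b i - b' j)) ` (UNIV :: ('n \<times> 'n) set)"
  have "finite T" unfolding T_def by simp
  then obtain z where z: "z \<notin> T" using infinite_UNIV_char_0 ex_new_if_finite by blast
  have "\<exists>\<sigma>. bij_betw \<sigma> UNIV UNIV \<and> (\<forall>i\<in>UNIV. a i + z * b i = a' (\<sigma> i) + z * b' (\<sigma> i))"
  proof (rule product_factors_match[where S = UNIV and D = UNIV and \<Phi> = "\<lambda>p w. w + p" and z = uminus
        and R = "(=)" and u = "\<lambda>w. 1"])
    fix w p :: complex
    show "\<forall>\<^sub>F y in at w. y + p \<noteq> 0"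
      using eventually_neq_at_within[of "- p" w UNIV] by (simp add: eq_neg_iff_add_eq_0)
    show "(\<Prod>i\<in>UNIV. w + (a i + z * b i)) = 1 * (\<Prod>i\<in>UNIV. w + (a' i + z * b' i))"
      using assms[of "(w, 1, z)"] by (simp add: joint_char_poly_diag add.assoc)
  next
    fix p p' :: complex assume "- p + p' = 0"
    then show "p = p' \<and> (\<exists>u. u holomorphic_on UNIV \<and> (\<forall>w\<in>UNIV. u w \<noteq> 0 \<and> w + p = u w * (w + p')))"
      by (intro conjI exI[of _ "\<lambda>w. 1"]) (auto simp: add_eq_0_iff)
  qed (auto intro!: holomorphic_intros)
  then obtain \<sigma> where \<sigma>: "bij \<sigma>" "\<And>i. a i + z * b i = a' (\<sigma> i) + z * b' (\<sigma> i)" by auto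
  have b: "b i = b' (\<sigma> i)" for i
  proof (rule ccontr)
    assume "b i \<noteq> b' (\<sigma> i)"
    then have "z = (a' (\<sigma> i) - a i) / (b i - b' (\<sigma> i))" using \<sigma>(2)[of i] by (simp add: field_simps)
    then show False using z unfolding T_def by (metis (no_types, lifting) case_prod_conv rangeI)
  qed
  have "a i = a' (\<sigma> i)" for i using \<sigma>(2)[of i] b[of i] by simp
  then show thesis using that[of \<sigma>] b bij_imp_permutes[of \<sigma> UNIV] \<sigma>(1) by blast
qed

section \<open>The homeomorphisms\<close>

lemma cis_2pi_eq_iff: "cis (2 * pi * x) = cis (2 * pi * y) \<longleftrightarrow> x - y \<in> \<int>"
proof -
  have "cis (2 * pi * x) = torus_pt x 0" for x
    by (simp add: torus_pt_def cis_conv_exp mult_ac)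
  then show ?thesis by (simp add: torus_pt_eq_iff)
qed

lemma cis_2pi_eq_cnj_iff: "cis (2 * pi * x) = cnj (cis (2 * pi * y)) \<longleftrightarrow> x + y \<in> \<int>"
  using cis_2pi_eq_iff[of x "- y"] by (simp add: cis_cnj)

lemma cis_sum: "finite I \<Longrightarrow> (\<Prod>i\<in>I. cis (f i)) = cis (\<Sum>i\<in>I. f i)"
  by (induction I rule: finite_induct) (simp_all add: cis_mult)

lemma ex_cis_2pi:
  assumes "cmod a = 1"
  obtains x where "a = cis (2 * pi * x)"
proof -
  obtain r where "a = cis r" using assms
    by (metis cis_Arg sgn_eq norm_zero zero_neq_one div_by_1 of_real_1)
  then have "a = cis (2 * pi * (r / (2 * pi)))" by simp
  then show thesis using that by blast
qed

lemma ex_cis_2pi_fun: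
  assumes "\<And>i. cmod (a i) = 1"
  shows "\<exists>x. \<forall>i. a i = cis (2 * pi * x i)"
proof (rule choice, rule allI)
  show "\<exists>x. a i = cis (2 * pi * x)" for i
    by (rule ex_cis_2pi[OF assms]) (rule exI)
qed

definition diag_pair :: "(real^'m) \<times> (real^'m) \<Rightarrow> (complex^'m^'m) \<times> (complex^'m^'m)" where
  "diag_pair p = (diag_mat (\<lambda>i. cis (2 * pi * fst p $ i)), diag_mat (\<lambda>i. cis (2 * pi * snd p $ i)))"

definition quat_diag_pair ::
  "(real^'m::finite) \<times> (real^'m) \<Rightarrow> (complex^('m + 'm)^('m + 'm)) \<times> (complex^('m + 'm)^('m + 'm))" where
  "quat_diag_pair p = (diag_mat (quat_diag (\<lambda>i. cis (2 * pi * fst p $ i))),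
     diag_mat (quat_diag (\<lambda>i. cis (2 * pi * snd p $ i))))"

lemma continuous_on_vec_lambda2:
  assumes "\<And>i j. continuous_on S (\<lambda>x. f x i j)"
  shows "continuous_on S (\<lambda>x. \<chi> i j. f x i j)"
  by (intro continuous_intros assms)

lemma continuous_on_diag_mat:
  assumes "\<And>i. continuous_on S (\<lambda>x. f x i)"
  shows "continuous_on S (\<lambda>x. diag_mat (f x))"
  unfolding diag_mat_def
proof (rule continuous_on_vec_lambda2)
  show "continuous_on S (\<lambda>x. if i = j then f x i else 0)" for i j
    using assms by (cases "i = j") auto
qed

lemma continuous_on_quat_diag:
  assumes "\<And>i. continuous_on S (\<lambda>x. f x i)"
  shows "continuous_on S (\<lambda>x. quat_diag (f x) k)"
  unfolding quat_diag_def using assms by (cases k) (auto intro!: continuous_intros)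

lemma continuous_on_diag_pair: "continuous_on S diag_pair"
  unfolding diag_pair_def by (intro continuous_intros continuous_on_diag_mat)

lemma continuous_on_quat_diag_pair: "continuous_on S quat_diag_pair"
  unfolding quat_diag_pair_def by (intro continuous_intros continuous_on_diag_mat continuous_on_quat_diag)

lemma compact_vec_box:
  "compact {p :: (real^'m) \<times> (real^'m). (\<forall>i. \<bar>fst p $ i\<bar> \<le> r) \<and> (\<forall>i. \<bar>snd p $ i\<bar> \<le> r)}"
proof -
  have "{p :: (real^'m) \<times> (real^'m). (\<forall>i. \<bar>fst p $ i\<bar> \<le> r) \<and> (\<forall>i. \<bar>snd p $ i\<bar> \<le> r)} =
      cbox (\<chi> i. - r) (\<chi> i. r) \<times> cbox (\<chi> i. - r) (\<chi> i. r)"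
    by (auto simp: mem_box_cart abs_le_iff minus_le_iff)
  then show ?thesis by (simp add: compact_Times)
qed

lemma diag_pair_Hom_Z2:
  assumes "(\<Sum>i\<in>UNIV. fst p $ i) = 0" "(\<Sum>i\<in>UNIV. snd p $ i) = 0"
  shows "diag_pair p \<in> Hom_Z2 SU"
proof -
  have "(\<Prod>i\<in>UNIV. cis (2 * pi * x $ i)) = 1" if "(\<Sum>i\<in>UNIV. x $ i) = 0" for x :: "real^'a"
    using that by (simp add: cis_sum flip: sum_distrib_left)
  then show ?thesis
    using assms unfolding diag_pair_def Hom_Z2_SU
    by (simp add: diag_mat_SU_iff diag_mat_commute[of "\<lambda>i. cis (2 * pi * fst p $ i)"])
qed

lemma quat_diag_pair_Hom_Z2: "quat_diag_pair p \<in> Hom_Z2 Sp"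
  unfolding quat_diag_pair_def Hom_Z2_Sp
  by (simp add: diag_quat_diag_Sp
      diag_mat_commute[of "quat_diag (\<lambda>i. cis (2 * pi * fst p $ i))"])

lemma joint_char_poly_conj_SU:
  "(p, q) \<in> conj_rel SU \<Longrightarrow> joint_char_poly l p = joint_char_poly l q"
  unfolding SU_def
  by (rule joint_char_poly_conj_rel[OF group_SU[unfolded SU_def]])
     (use SU_adjoint[unfolded SU_carrier] in auto)

lemma joint_char_poly_conj_Sp:
  "(p, q) \<in> conj_rel Sp \<Longrightarrow> joint_char_poly l p = joint_char_poly l q"
  unfolding Sp_def
  by (rule joint_char_poly_conj_rel[OF group_Sp[unfolded Sp_def]])
     (use Sp_adjoint[unfolded Sp_carrier] in auto)

lemma ex_sum_zero_cis:
  fixes a :: "'m::finite \<Rightarrow> complex"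
  assumes "\<And>i. cmod (a i) = 1" "(\<Prod>i\<in>UNIV. a i) = 1"
  obtains s :: "real^'m" where "\<And>i. a i = cis (2 * pi * s $ i)"
    "(\<Sum>i\<in>UNIV. s $ i) = 0" "\<And>i. \<bar>s $ i\<bar> \<le> CARD('m)"
proof -
  obtain x where x: "\<And>i. a i = cis (2 * pi * x i)" using ex_cis_2pi_fun[of a, OF assms(1)] by blast
  have "cis (2 * pi * (\<Sum>i\<in>UNIV. x i)) = cis (2 * pi * 0)"
    using assms(2) by (simp add: x cis_sum sum_distrib_left)
  then have "(\<Sum>i\<in>UNIV. x i) \<in> \<int>" unfolding cis_2pi_eq_iff by simp
  from sum_Ints_shift_to_0[OF _ _ this]
  obtain y where y: "\<And>i. x i - y i \<in> \<int>" "\<And>i. \<bar>y i\<bar> \<le> CARD('m)" "(\<Sum>i\<in>UNIV. y i) = 0" by auto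
  have "a i = cis (2 * pi * y i)" for i unfolding x cis_2pi_eq_iff by (rule y)
  then show thesis using that[of "\<chi> i. y i"] y by simp
qed

lemma Rep_Z2_SU_homeomorphic:
  "Rep_Z2 (SU :: (complex^'m^'m) monoid) homeomorphic_space (complex_proj_space :: (complex^'m) set topology)"
proof -
  \<comment> \<open>The bound is the one that \<open>sum_Ints_shift_to_0\<close> provides; balancing
    the sum may push one logarithm that far. The sum conditions are closed, so \<open>K\<close> is
    compact.\<close>
  define K :: "((real^'m) \<times> (real^'m)) set" where
    "K = {p. (\<forall>i. \<bar>fst p $ i\<bar> \<le> CARD('m)) \<and> (\<forall>i. \<bar>snd p $ i\<bar> \<le> CARD('m))} \<inter>
      {p. (\<Sum>i\<in>UNIV. fst p $ i) = 0 \<and> (\<Sum>i\<in>UNIV. snd p $ i) = 0}"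
  have KD: "(\<Sum>i\<in>UNIV. fst p $ i) = 0" "(\<Sum>i\<in>UNIV. snd p $ i) = 0" if "p \<in> K" for p
    using that by (auto simp: K_def)
  have cl: "closed {p :: (real^'m) \<times> (real^'m). (\<Sum>i\<in>UNIV. fst p $ i) = 0 \<and> (\<Sum>i\<in>UNIV. snd p $ i) = 0}"
    by (intro closed_Collect_conj closed_Collect_eq continuous_intros)
  show ?thesis
    unfolding Rep_Z2_def
  proof (rule quotient_homeomorphic_complex_proj_space[where K = K and \<delta> = diag_pair and inv_fun = joint_char_poly
        and F = theta_map])
    show "compact K" unfolding K_def by (intro compact_Int_closed compact_vec_box cl)
    show "equiv (Hom_Z2 SU) (conj_rel (SU :: (complex^'m^'m) monoid))"
      by (rule group.equiv_conj_rel[OF group_SU])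
    show "continuous_on K diag_pair" by (rule continuous_on_diag_pair)
    show "diag_pair ` K \<subseteq> Hom_Z2 SU" using KD diag_pair_Hom_Z2 by blast
    show "continuous_on (Hom_Z2 SU) (joint_char_poly l)" for l :: "complex \<times> complex \<times> complex"
      by (rule continuous_on_joint_char_poly)
    show "continuous_on K theta_map" by (rule continuous_on_theta_map)
    show "theta_map p \<noteq> 0" if "p \<in> K" for p using KD[OF that] by (rule theta_map_nonzero)
  next
    fix x :: "(complex^'m^'m) \<times> (complex^'m^'m)" assume x: "x \<in> Hom_Z2 SU"
    obtain A B where AB: "x = (A, B)" by (cases x)
    obtain a b where ab: "\<And>i. cmod (a i) = 1" "\<And>i. cmod (b i) = 1"
      "(\<Prod>i\<in>UNIV. a i) = 1" "(\<Prod>i\<in>UNIV. b i) = 1" "((diag_mat a, diag_mat b), x) \<in> conj_rel SU"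
      using SU_conj_diagonal[of A B] x unfolding AB by blast
    obtain s :: "real^'m" where s: "\<And>i. a i = cis (2 * pi * s $ i)" "(\<Sum>i\<in>UNIV. s $ i) = 0" "\<And>i. \<bar>s $ i\<bar> \<le> CARD('m)"
      using ex_sum_zero_cis[OF ab(1,3)] by blast
    obtain t :: "real^'m" where t: "\<And>i. b i = cis (2 * pi * t $ i)" "(\<Sum>i\<in>UNIV. t $ i) = 0" "\<And>i. \<bar>t $ i\<bar> \<le> CARD('m)"
      using ex_sum_zero_cis[OF ab(2,4)] by blast
    have "(s, t) \<in> K" using s t by (simp add: K_def)
    moreover have "diag_pair (s, t) = (diag_mat a, diag_mat b)"
      by (simp add: diag_pair_def diag_mat_eq_iff fun_eq_iff s(1) t(1))
    ultimately show "\<exists>p\<in>K. (diag_pair p, x) \<in> conj_rel SU" using ab(5) by (intro bexI[of _ "(s, t)"]) simp_all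
  next
    fix l and x y :: "(complex^'m^'m) \<times> (complex^'m^'m)" assume "(x, y) \<in> conj_rel SU"
    then show "joint_char_poly l x = joint_char_poly l y"
      by (rule joint_char_poly_conj_SU)
  next
    fix v :: "complex^'m" assume v: "v \<noteq> 0"
    obtain p :: "(real^'m) \<times> (real^'m)" where p: "(\<Sum>i\<in>UNIV. fst p $ i) = 0" "(\<Sum>i\<in>UNIV. snd p $ i) = 0"
      "\<And>i. \<bar>fst p $ i\<bar> \<le> CARD('m)" "\<And>i. \<bar>snd p $ i\<bar> \<le> CARD('m)" "(theta_map p, v) \<in> proj_rel"
      using theta_map_surj[OF v] by blast
    then show "\<exists>p\<in>K. (theta_map p, v) \<in> proj_rel" by (intro bexI[of _ p]) (simp_all add: K_def)
  next
    fix p p' assume p: "p \<in> K" and p': "p' \<in> K"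
      and eq: "\<And>l. joint_char_poly l (diag_pair p) = joint_char_poly l (diag_pair p')"
    obtain \<sigma> where \<sigma>: "\<sigma> permutes (UNIV :: 'm set)" "\<And>i. cis (2 * pi * fst p $ i) = cis (2 * pi * fst p' $ \<sigma> i)"
      "\<And>i. cis (2 * pi * snd p $ i) = cis (2 * pi * snd p' $ \<sigma> i)"
      using joint_char_poly_diag_eq_imp_permuted[OF eq[unfolded diag_pair_def]] by blast
    \<comment> \<open>The logarithms agree up to a permutation and integers. Both families sum to 0,
      so the total shift is \<open>n = 0\<close> and no monomial separates the two products.\<close>
    obtain c where c: "c \<noteq> 0" "\<And>w. w \<noteq> 0 \<Longrightarrow>
       (\<Prod>i\<in>UNIV. theta (w / torus_pt (fst p $ i) (snd p $ i)))
         = c * w powi 0 * (\<Prod>i\<in>UNIV. theta (w / torus_pt (fst p' $ i) (snd p' $ i)))"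
    proof (rule prod_theta_torus_pt_proportional[where \<sigma> = \<sigma> and n = 0 and s = "\<lambda>i. fst p $ i" and t = "\<lambda>i. snd p $ i"
          and s' = "\<lambda>i. fst p' $ i" and t' = "\<lambda>i. snd p' $ i"])
    qed (use \<sigma> KD[OF p] KD[OF p'] in \<open>auto simp: cis_2pi_eq_iff\<close>)
    have "theta_map p = c *s theta_map p'"
      using c(2) by (simp add: theta_map_def vec_eq_iff)
    then have "theta_map p' = inverse c *s theta_map p" using c(1) by (simp add: vector_smult_assoc)
    then show "(theta_map p, theta_map p') \<in> proj_rel"
      using c(1) theta_map_nonzero[OF KD[OF p]] by (auto simp: proj_rel_def intro!: exI[of _ "inverse c"])
  next
    fix p p' assume p: "p \<in> K" and p': "p' \<in> K" and "(theta_map p, theta_map p') \<in> proj_rel"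
    then obtain \<sigma> where \<sigma>: "\<sigma> permutes UNIV" "\<And>i. fst p' $ i - fst p $ \<sigma> i \<in> \<int>" "\<And>i. snd p' $ i - snd p $ \<sigma> i \<in> \<int>"
      using theta_map_proportional_imp[OF KD[OF p] KD[OF p']] by blast
    have "diag_pair p' = (diag_mat (\<lambda>i. cis (2 * pi * fst p $ \<sigma> i)), diag_mat (\<lambda>i. cis (2 * pi * snd p $ \<sigma> i)))"
      using \<sigma> by (simp add: diag_pair_def diag_mat_eq_iff fun_eq_iff cis_2pi_eq_iff)
    then have "(diag_pair p', diag_pair p) \<in> conj_rel SU"
      using SU_conj_permuted_diagonal[OF diag_pair_Hom_Z2[OF KD[OF p], unfolded diag_pair_def] \<sigma>(1)]
      by (simp add: diag_pair_def)
    then show "(diag_pair p, diag_pair p') \<in> conj_rel SU"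
      using group.equiv_conj_rel[OF group_SU] by (meson equivE symE)
  qed
qed

text \<open>The symplectic product over m pairs is an ordinary theta product over 2m points whose
  logarithms sum to 0, so the proportionality lemma used for SU applies to it.\<close>

lemma theta_sym_map_eq:
  "theta_sym_map p $ k = (\<Prod>l\<in>UNIV. theta (sample_pt k /
     torus_pt (case_sum (\<lambda>i. fst p $ i) (\<lambda>i. - (fst p $ i)) l) (case_sum (\<lambda>i. snd p $ i) (\<lambda>i. - (snd p $ i)) l)))"
  by (simp add: theta_sym_map_def prod_UNIV_Plus theta_sym_def torus_pt_uminus prod.distrib)

lemma quat_diag_cis: "quat_diag (\<lambda>i. cis (2 * pi * f i)) l = cis (2 * pi * case_sum f (\<lambda>i. - f i) l)"
  by (simp add: quat_diag_def cis_cnj split: sum.split)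

lemma Rep_Z2_Sp_homeomorphic:
  "Rep_Z2 (Sp :: (complex^('m::finite + 'm)^('m + 'm)) monoid) homeomorphic_space
     (complex_proj_space :: (complex^('m option)) set topology)"
proof -
  \<comment> \<open>Fractional parts represent every configuration, since no sum has to be balanced;
    the closed box makes \<open>K\<close> compact.\<close>
  define K :: "((real^'m) \<times> (real^'m)) set" where
    "K = {p. (\<forall>i. \<bar>fst p $ i\<bar> \<le> 1) \<and> (\<forall>i. \<bar>snd p $ i\<bar> \<le> 1)}"
  show ?thesis
    unfolding Rep_Z2_def
  proof (rule quotient_homeomorphic_complex_proj_space[where K = K and \<delta> = quat_diag_pair and inv_fun = joint_char_poly
        and F = theta_sym_map])
    show "compact K" unfolding K_def by (rule compact_vec_box)
    show "equiv (Hom_Z2 Sp) (conj_rel (Sp :: (complex^('m + 'm)^('m + 'm)) monoid))"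
      by (rule group.equiv_conj_rel[OF group_Sp])
    show "continuous_on K quat_diag_pair" by (rule continuous_on_quat_diag_pair)
    show "quat_diag_pair ` K \<subseteq> Hom_Z2 Sp" using quat_diag_pair_Hom_Z2 by blast
    show "continuous_on (Hom_Z2 Sp) (joint_char_poly l)" for l :: "complex \<times> complex \<times> complex"
      by (rule continuous_on_joint_char_poly)
    show "continuous_on K theta_sym_map" by (rule continuous_on_theta_sym_map)
    show "theta_sym_map p \<noteq> 0" for p :: "(real^'m) \<times> (real^'m)" by (rule theta_sym_map_nonzero)
  next
    fix x :: "(complex^('m + 'm)^('m + 'm)) \<times> (complex^('m + 'm)^('m + 'm))" assume x: "x \<in> Hom_Z2 Sp"
    obtain A B where AB: "x = (A, B)" by (cases x)
    obtain a b :: "'m \<Rightarrow> complex" where ab: "\<And>i. cmod (a i) = 1" "\<And>i. cmod (b i) = 1"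
      "((diag_mat (quat_diag a), diag_mat (quat_diag b)), x) \<in> conj_rel Sp"
      using Sp_conj_diagonal[of A B] x unfolding AB by blast
    obtain s where s: "\<And>i. a i = cis (2 * pi * s i)" using ex_cis_2pi_fun[of a, OF ab(1)] by blast
    obtain t where t: "\<And>i. b i = cis (2 * pi * t i)" using ex_cis_2pi_fun[of b, OF ab(2)] by blast
    define p where "p = ((\<chi> i. frac (s i)) :: real^'m, (\<chi> i. frac (t i)) :: real^'m)"
    have "\<bar>frac x\<bar> \<le> 1" for x :: real using frac_lt_1[of x] by simp
    then have pK: "p \<in> K" by (simp add: K_def p_def)
    have "cis (2 * pi * frac x) = cis (2 * pi * x)" for x
      unfolding cis_2pi_eq_iff by (simp add: frac_def)
    moreover have "a = (\<lambda>i. cis (2 * pi * s i))" "b = (\<lambda>i. cis (2 * pi * t i))"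
      using s t by blast+
    ultimately have "quat_diag_pair p = (diag_mat (quat_diag a), diag_mat (quat_diag b))"
      by (simp add: quat_diag_pair_def p_def)
    then show "\<exists>p\<in>K. (quat_diag_pair p, x) \<in> conj_rel Sp" using ab(3) pK by (intro bexI[of _ p]) simp_all
  next
    fix l and x y :: "(complex^('m + 'm)^('m + 'm)) \<times> (complex^('m + 'm)^('m + 'm))" assume "(x, y) \<in> conj_rel Sp"
    then show "joint_char_poly l x = joint_char_poly l y"
      by (rule joint_char_poly_conj_Sp)
  next
    fix v :: "complex^('m option)" assume v: "v \<noteq> 0"
    obtain p :: "(real^'m) \<times> (real^'m)" where p:
      "\<And>i. \<bar>fst p $ i\<bar> \<le> 1" "\<And>i. \<bar>snd p $ i\<bar> \<le> 1" "(theta_sym_map p, v) \<in> proj_rel"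
      using theta_sym_map_surj[OF v] by blast
    then show "\<exists>p\<in>K. (theta_sym_map p, v) \<in> proj_rel" by (intro bexI[of _ p]) (simp_all add: K_def)
  next
    fix p p' :: "(real^'m) \<times> (real^'m)"
    assume eq: "\<And>l. joint_char_poly l (quat_diag_pair p) = joint_char_poly l (quat_diag_pair p')"
    \<comment> \<open>The permutation acts on all 2m eigenvalues and may ignore their grouping into
      conjugate pairs. The product over 2m points does not see that grouping, so \<sigma> never has
      to be repaired.\<close>
    obtain \<sigma> where \<sigma>: "\<sigma> permutes (UNIV :: ('m + 'm) set)"
      "\<And>l. quat_diag (\<lambda>i. cis (2 * pi * fst p $ i)) l = quat_diag (\<lambda>i. cis (2 * pi * fst p' $ i)) (\<sigma> l)"
      "\<And>l. quat_diag (\<lambda>i. cis (2 * pi * snd p $ i)) l = quat_diag (\<lambda>i. cis (2 * pi * snd p' $ i)) (\<sigma> l)"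
      using joint_char_poly_diag_eq_imp_permuted[OF eq[unfolded quat_diag_pair_def]] by blast
    define s where "s p = case_sum (\<lambda>i. fst p $ i) (\<lambda>i. - (fst p $ i))" for p :: "(real^'m) \<times> (real^'m)"
    define t where "t p = case_sum (\<lambda>i. snd p $ i) (\<lambda>i. - (snd p $ i))" for p :: "(real^'m) \<times> (real^'m)"
    have sum0: "(\<Sum>l\<in>UNIV. t p l) = 0" for p by (simp add: t_def sum_UNIV_Plus sum_negf)
    obtain c where c: "c \<noteq> 0" "\<And>w. w \<noteq> 0 \<Longrightarrow>
       (\<Prod>l\<in>UNIV. theta (w / torus_pt (s p l) (t p l)))
         = c * w powi 0 * (\<Prod>l\<in>UNIV. theta (w / torus_pt (s p' l) (t p' l)))"
    proof (rule prod_theta_torus_pt_proportional[where \<sigma> = \<sigma> and n = 0 and s = "s p" and t = "t p"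
          and s' = "s p'" and t' = "t p'"])
    qed (use \<sigma> in \<open>auto simp: quat_diag_cis cis_2pi_eq_iff s_def t_def sum0[unfolded t_def]\<close>)
    have "theta_sym_map p = c *s theta_sym_map p'"
      using c(2) by (simp add: theta_sym_map_eq vec_eq_iff s_def t_def)
    then have "theta_sym_map p' = inverse c *s theta_sym_map p" using c(1) by (simp add: vector_smult_assoc)
    then show "(theta_sym_map p, theta_sym_map p') \<in> proj_rel"
      using c(1) theta_sym_map_nonzero[of p] by (auto simp: proj_rel_def intro!: exI[of _ "inverse c"])
  next
    fix p p' :: "(real^'m) \<times> (real^'m)"
    assume "(theta_sym_map p, theta_sym_map p') \<in> proj_rel"
    then obtain \<sigma> where \<sigma>: "\<sigma> permutes UNIV"
      "\<And>i. (fst p' $ i - fst p $ \<sigma> i \<in> \<int> \<and> snd p' $ i - snd p $ \<sigma> i \<in> \<int>) \<or>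
         (fst p' $ i + fst p $ \<sigma> i \<in> \<int> \<and> snd p' $ i + snd p $ \<sigma> i \<in> \<int>)"
      using theta_sym_map_proportional_imp by blast
    \<comment> \<open>Where both alternatives hold, the value agrees with its conjugate, so
      preferring the first one is harmless.\<close>
    define e where "e i \<longleftrightarrow> fst p' $ i - fst p $ \<sigma> i \<in> \<int> \<and> snd p' $ i - snd p $ \<sigma> i \<in> \<int>" for i
    define a where "a i = cis (2 * pi * fst p $ i)" for i
    define b where "b i = cis (2 * pi * snd p $ i)" for i
    have "cis (2 * pi * fst p' $ i) = (if e i then a (\<sigma> i) else cnj (a (\<sigma> i))) \<and>
          cis (2 * pi * snd p' $ i) = (if e i then b (\<sigma> i) else cnj (b (\<sigma> i)))" for i
      using \<sigma>(2)[of i] unfolding a_def b_def e_def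
      by (simp only: cis_2pi_eq_iff cis_2pi_eq_cnj_iff split: if_split) blast
    then have p': "quat_diag_pair p' = (diag_mat (quat_diag (\<lambda>i. if e i then a (\<sigma> i) else cnj (a (\<sigma> i)))),
           diag_mat (quat_diag (\<lambda>i. if e i then b (\<sigma> i) else cnj (b (\<sigma> i)))))"
      by (simp add: quat_diag_pair_def)
    have p: "quat_diag_pair p = (diag_mat (quat_diag a), diag_mat (quat_diag b))"
      by (simp add: quat_diag_pair_def a_def[abs_def] b_def[abs_def])
    have "(quat_diag_pair p', quat_diag_pair p) \<in> conj_rel Sp"
      using Sp_conj_permuted_diagonal[of a b \<sigma> e] \<sigma>(1) quat_diag_pair_Hom_Z2[of p] unfolding p p' by blast
    then show "(quat_diag_pair p, quat_diag_pair p') \<in> conj_rel Sp"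
      using group.equiv_conj_rel[OF group_Sp] by (meson equivE symE)
  qed
qed

text \<open>Finite types are nonempty, so m = \<open>CARD('m)\<close> ranges over the integers \<ge>
  1; \<open>'m option\<close> has the m + 1 homogeneous coordinates of complex projective
  m-space.\<close>

theorem corollary1p5:
  shows "Rep_Z2 (Sp :: (complex^('m::finite + 'm)^('m + 'm)) monoid)
           homeomorphic_space (complex_proj_space :: (complex^('m option)) set topology) \<and>
         Rep_Z2 (SU :: (complex^'m^'m) monoid)
           homeomorphic_space (complex_proj_space :: (complex^'m) set topology)"
  using Rep_Z2_Sp_homeomorphic Rep_Z2_SU_homeomorphic by (rule conjI)

end
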